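(* Let $G$ be a Lie group and let $\mathcal{L}$ be a central extension of $LG$ by $\mathrm{U}(1)$ equipped with a multiplicative fusion product and a multiplicative, fusive thin homotopy equivariant structure. Then $\mathcal{L}$ is disjoint commutative: if $\tau_1,\tau_2\in LG$ are supported on disjoint intervals, and $p_1\in\mathcal{L}_{\tau_1}$, $p_2\in\mathcal{L}_{\tau_2}$, then $p_1\cdot p_2=p_2\cdot p_1$.
   Context: A loop $\tau\in LG$ is *supported on an interval* $I\subseteq S^1$ if $\tau(z)=1$ for all $z\in S^1\setminus I$. $LG=C^\infty(S^1,G)$ is the loop group (Fréchet Lie group, pointwise multiplication). A central extension is a central extension $1\to\mathrm{U}(1)\to\mathcal{L}\to LG\to1$ of Fréchet Lie groups; $\mathcal{L}_\tau$ denotes the fibre over $\tau\in LG$. Fréchet manifolds are regarded as diffeological spaces. $PG$ is the diffeological space of smooth paths $\gamma:[0,1]\to G$ that are constant near $0$ and near $1$ ($c:U\to PG$ is a plot iff $(u,t)\mapsto c(u)(t)$ is smooth); $PG^{[k]}$ is the space of $k$-tuples of paths with a common initial point and a common end point. $\overline\gamma$ is the reversed path, $\gamma_2\star\gamma_1$ is concatenation (first $\gamma_1$), $\gamma_1\cup\gamma_2:=\overline{\gamma_2}\star\gamma_1\in LG$ for $(\gamma_1,\gamma_2)\in PG^{[2]}$. For a smooth manifold $X$, a path $\gamma:[0,1]\to LX$ is *thin* if $(t,z)\mapsto\gamma(t)(z)$ has rank at most one everywhere; $LX^2_{thin}\subseteq LX\times LX$ is the set of pairs of loops connected by a thin path,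 with plots the smooth maps $U\to LX\times LX$ into this set for which thin homotopies can locally be chosen in smooth families. A *fusion product* on $\mathcal{L}$ is a smooth bundle morphism $\lambda$ over $PG^{[3]}$ with components $\lambda:\mathcal{L}_{\gamma_1\cup\gamma_2}\otimes\mathcal{L}_{\gamma_2\cup\gamma_3}\to\mathcal{L}_{\gamma_1\cup\gamma_3}$, associative over $PG^{[4]}$. It is *multiplicative* if $\lambda(p_{12}\otimes p_{23})\cdot\lambda(p_{12}'\otimes p_{23}')=\lambda(p_{12}p_{12}'\otimes p_{23}p_{23}')$ for all $p_{ij}\in\mathcal{L}_{\gamma_i\cup\gamma_j}$, $p_{ij}'\in\mathcal{L}_{\gamma_i'\cup\gamma_j'}$. A *thin homotopy equivariant structure* is a smooth bundle isomorphism $d:\mathrm{pr}_1^*\mathcal{L}\to\mathrm{pr}_2^*\mathcal{L}$ over $LG^2_{thin}$ (components $d_{\tau_0,\tau_1}:\mathcal{L}_{\tau_0}\to\mathcal{L}_{\tau_1}$) with $d_{\tau_2,\tau_3}\circ d_{\tau_1,\tau_2}=d_{\tau_1,\tau_3}$. It is *multiplicative* if $d_{\tau_0\gamma_0,\tau_1\gamma_1}(p\cdot q)=d_{\tau_0,\tau_1}(p)\cdot d_{\gamma_0,\gamma_1}(q)$ for all $((\tau_0,\gamma_0),(\tau_1,\gamma_1))\in L(G\times G)^2_{thin}$, $p\in\mathcal{L}_{\tau_0}$, $q\in\mathcal{L}_{\gamma_0}$. It is *compatible* with $\lambda$ if for every path $(\gamma_1,\gamma_2,\gamma_3)$ in $PG^{[3]}$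 such that the three paths $t\mapsto\gamma_i(t)\cup\gamma_j(t)$ are thin, $d\circ\lambda=\lambda\circ(d\otimes d)$ as maps $\mathcal{L}_{\gamma_1(0)\cup\gamma_2(0)}\otimes\mathcal{L}_{\gamma_2(0)\cup\gamma_3(0)}\to\mathcal{L}_{\gamma_1(1)\cup\gamma_3(1)}$. It *symmetrizes* $\lambda$ if $d_{\gamma_1\cup\gamma_3,\overline{\gamma_3}\cup\overline{\gamma_1}}(\lambda(p\otimes p'))=\lambda(d_{\gamma_2\cup\gamma_3,\overline{\gamma_3}\cup\overline{\gamma_2}}(p')\otimes d_{\gamma_1\cup\gamma_2,\overline{\gamma_2}\cup\overline{\gamma_1}}(p))$ for all $(\gamma_1,\gamma_2,\gamma_3)\in PG^{[3]}$, $p\in\mathcal{L}_{\gamma_1\cup\gamma_2}$, $p'\in\mathcal{L}_{\gamma_2\cup\gamma_3}$ (note $\overline{\gamma_j}\cup\overline{\gamma_i}$ is $\gamma_i\cup\gamma_j$ rotated by $\pi$). It is *fusive* if it is compatible and symmetrizing. *)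

theory Defs
  imports
    "HOL-Analysis.Analysis"
    "HOL-Algebra.Product_Groups"
    "HOL-Library.Function_Algebras"
begin

section \<open>Calculus in Fr\'echet spaces\<close>

instantiation "fun" :: (type, real_vector) real_vector
begin

definition scaleR_fun :: "real \<Rightarrow> ('a \<Rightarrow> 'b) \<Rightarrow> 'a \<Rightarrow> 'b"
  where "scaleR_fun r f = (\<lambda>x. r *\<^sub>R f x)"

instance
  by standard (simp_all add: scaleR_fun_def plus_fun_def fun_eq_iff scaleR_add_right scaleR_add_left)

end

definition seminorm_on :: "'v::real_vector set \<Rightarrow> ('v \<Rightarrow> real) \<Rightarrow> bool"
  where "seminorm_on S p \<longleftrightarrow>
    (\<forall>x\<in>S. 0 \<le> p x) \<and> (\<forall>x\<in>S. \<forall>y\<in>S. p (x + y) \<le> p x + p y) \<and>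
    (\<forall>a. \<forall>x\<in>S. p (a *\<^sub>R x) = \<bar>a\<bar> * p x)"

definition seminorm_open :: "'v::real_vector set \<Rightarrow> (nat \<Rightarrow> 'v \<Rightarrow> real) \<Rightarrow> 'v set \<Rightarrow> bool"
  where "seminorm_open S p U \<longleftrightarrow>
    U \<subseteq> S \<and> (\<forall>x\<in>U. \<exists>N. \<exists>e>0. \<forall>y\<in>S. (\<forall>k<N. p k (y - x) < e) \<longrightarrow> y \<in> U)"

definition seminorm_topology :: "'v::real_vector set \<Rightarrow> (nat \<Rightarrow> 'v \<Rightarrow> real) \<Rightarrow> 'v topology"
  where "seminorm_topology S p = topology (seminorm_open S p)"

lemma istopology_seminorm_open: "istopology (seminorm_open S p)"
  unfolding istopology_def
proof (intro conjI allI impI)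
  fix U V assume U: "seminorm_open S p U" and V: "seminorm_open S p V"
  show "seminorm_open S p (U \<inter> V)"
    unfolding seminorm_open_def
  proof (intro conjI ballI)
    show "U \<inter> V \<subseteq> S" using U by (auto simp: seminorm_open_def)
    fix x assume "x \<in> U \<inter> V"
    then obtain N e N' e' where
      *: "e > 0" "\<And>y. y \<in> S \<Longrightarrow> (\<forall>k<N. p k (y - x) < e) \<Longrightarrow> y \<in> U"
         "e' > 0" "\<And>y. y \<in> S \<Longrightarrow> (\<forall>k<N'. p k (y - x) < e') \<Longrightarrow> y \<in> V"
      using U V unfolding seminorm_open_def by (metis IntD1 IntD2)
    show "\<exists>N. \<exists>e>0. \<forall>y\<in>S. (\<forall>k<N. p k (y - x) < e) \<longrightarrow> y \<in> U \<inter> V"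
      by (rule exI[of _ "max N N'"], rule exI[of _ "min e e'"]) (use * in auto)
  qed
next
  fix K assume *: "\<forall>U\<in>K. seminorm_open S p U"
  show "seminorm_open S p (\<Union>K)"
    unfolding seminorm_open_def
  proof (intro conjI ballI)
    show "\<Union>K \<subseteq> S" using * by (auto simp: seminorm_open_def)
    fix x assume "x \<in> \<Union>K"
    then obtain U where U: "U \<in> K" "x \<in> U" by blast
    then obtain N e where "e > 0" "\<forall>y\<in>S. (\<forall>k<N. p k (y - x) < e) \<longrightarrow> y \<in> U"
      using * unfolding seminorm_open_def by metis
    with U show "\<exists>N. \<exists>e>0. \<forall>y\<in>S. (\<forall>k<N. p k (y - x) < e) \<longrightarrow> y \<in> \<Union>K" by blast
  qed
qed

lemma openin_seminorm_topology [simp]: "openin (seminorm_topology S p) = seminorm_open S p"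
  by (simp add: seminorm_topology_def istopology_seminorm_open topology_inverse')

lemma topspace_seminorm_topology [simp]: "topspace (seminorm_topology S p) = S"
proof -
  have "seminorm_open S p S" unfolding seminorm_open_def using zero_less_one by blast
  then have "openin (seminorm_topology S p) S" by simp
  then have "S \<subseteq> topspace (seminorm_topology S p)" by (rule openin_subset)
  moreover have "seminorm_open S p (topspace (seminorm_topology S p))"
    by (metis openin_seminorm_topology openin_topspace)
  then have "topspace (seminorm_topology S p) \<subseteq> S" by (simp only: seminorm_open_def)
  ultimately show ?thesis by blast
qed

text \<open>
  A Fr\'echet space is given by its topology, whose underlying set is a linear subspace of the
  ambient vector space. This covers the Fr\'echet space R^n in the form
  \<^term>\<open>Euclidean_space n\<close>, also for n = 0 and with n a variable.
\<close>

definition frechet_space :: "'v::real_vector topology \<Rightarrow> bool"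
  where "frechet_space E \<longleftrightarrow>
    subspace (topspace E) \<and>
    (\<exists>p. (\<forall>k. seminorm_on (topspace E) (p k)) \<and>
         E = seminorm_topology (topspace E) p \<and>
         (\<forall>x\<in>topspace E. (\<forall>k. p k x = 0) \<longrightarrow> x = 0) \<and>
         (\<forall>X. range X \<subseteq> topspace E \<and>
              (\<forall>k. \<forall>e>0. \<exists>N. \<forall>m\<ge>N. \<forall>n\<ge>N. p k (X m - X n) < e) \<longrightarrow>
              (\<exists>l\<in>topspace E. \<forall>k. (\<lambda>n. p k (X n - l)) \<longlonglongrightarrow> 0)))"

text \<open>
  The difference quotients are restricted to \<open>S\<close>, so that one-sided derivatives are taken at
  boundary points of, e.g., \<open>S = [0,1] \<times> R\<close>.
\<close>

definition has_dir_deriv ::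
    "'w::real_vector topology \<Rightarrow> 'v::real_vector set \<Rightarrow> ('v \<Rightarrow> 'w) \<Rightarrow> 'v \<Rightarrow> 'v \<Rightarrow> 'w \<Rightarrow> bool"
  where "has_dir_deriv F S f x v w \<longleftrightarrow>
    limitin F (\<lambda>h::real. (f (x + h *\<^sub>R v) - f x) /\<^sub>R h) w (at 0 within {h. x + h *\<^sub>R v \<in> S})"

definition dir_deriv ::
    "'w::real_vector topology \<Rightarrow> 'v::real_vector set \<Rightarrow> ('v \<Rightarrow> 'w) \<Rightarrow> 'v \<Rightarrow> 'v \<Rightarrow> 'w"
  where "dir_deriv F S f x v = (THE w. has_dir_deriv F S f x v w)"

primrec iter_dir_deriv ::
    "'w::real_vector topology \<Rightarrow> 'v::real_vector set \<Rightarrow> ('v \<Rightarrow> 'w) \<Rightarrow> 'v list \<Rightarrow> 'v \<Rightarrow> 'w"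
  where
    "iter_dir_deriv F S f [] = f"
  | "iter_dir_deriv F S f (v # vs) = (\<lambda>x. dir_deriv F S (iter_dir_deriv F S f vs) x v)"

text \<open>
  Smoothness in the usual sense for Fr\'echet spaces: all iterated directional derivatives
  \<open>D^k f(x){v_0,...,v_(k-1)}\<close> exist and are jointly continuous in \<open>(x, v_0, ..., v_(k-1))\<close>.
\<close>

definition smooth_on ::
    "'v::real_vector topology \<Rightarrow> 'w::real_vector topology \<Rightarrow> 'v set \<Rightarrow> ('v \<Rightarrow> 'w) \<Rightarrow> bool"
  where "smooth_on E F U f \<longleftrightarrow> openin E U \<and>
    (\<forall>vs\<in>lists (topspace E). \<forall>v\<in>topspace E. \<forall>x\<in>U.
       \<exists>w. has_dir_deriv F U (iter_dir_deriv F U f vs) x v w) \<and>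
    (\<forall>k. continuous_map
       (prod_topology (subtopology E U) (product_topology (\<lambda>_. E) {..<k})) F
       (\<lambda>(x, v). iter_dir_deriv F U f (map v [0..<k]) x))"


section \<open>Manifolds\<close>

record ('a, 'v) mfd =
  points :: "'a set"
  model :: "'v topology"
  charts :: "('a set \<times> ('a \<Rightarrow> 'v)) set"

definition mfd_topology :: "('a, 'v) mfd \<Rightarrow> 'a topology"
  where "mfd_topology M = topology (\<lambda>V. V \<subseteq> points M \<and>
    (\<forall>(W, \<phi>)\<in>charts M. openin (model M) (\<phi> ` (V \<inter> W))))"

definition frechet_manifold :: "('a, 'v::real_vector) mfd \<Rightarrow> bool"
  where "frechet_manifold M \<longleftrightarrow>
    frechet_space (model M) \<and>
    \<Union>(fst ` charts M) = points M \<and>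
    (\<forall>(W, \<phi>)\<in>charts M. inj_on \<phi> W) \<and>
    (\<forall>(W, \<phi>)\<in>charts M. \<forall>(W', \<phi>')\<in>charts M.
       smooth_on (model M) (model M) (\<phi> ` (W \<inter> W')) (\<phi>' \<circ> the_inv_into W \<phi>)) \<and>
    Hausdorff_space (mfd_topology M)"

lemma openin_mfd_topology:
  assumes "frechet_manifold M"
  shows "openin (mfd_topology M) V \<longleftrightarrow>
    V \<subseteq> points M \<and> (\<forall>(W, \<phi>)\<in>charts M. openin (model M) (\<phi> ` (V \<inter> W)))"
proof -
  have inj: "inj_on \<phi> W" if "(W, \<phi>) \<in> charts M" for W \<phi>
    using assms that by (auto simp: frechet_manifold_def)
  have "istopology (\<lambda>V. V \<subseteq> points M \<and> (\<forall>(W, \<phi>)\<in>charts M. openin (model M) (\<phi> ` (V \<inter> W))))"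
    unfolding istopology_def
  proof (intro conjI allI impI)
    fix U V
    assume U: "U \<subseteq> points M \<and> (\<forall>(W, \<phi>)\<in>charts M. openin (model M) (\<phi> ` (U \<inter> W)))"
      and V: "V \<subseteq> points M \<and> (\<forall>(W, \<phi>)\<in>charts M. openin (model M) (\<phi> ` (V \<inter> W)))"
    show "U \<inter> V \<subseteq> points M" using U by blast
    show "\<forall>(W, \<phi>)\<in>charts M. openin (model M) (\<phi> ` (U \<inter> V \<inter> W))"
    proof clarify
      fix W \<phi> assume c: "(W, \<phi>) \<in> charts M"
      have "\<phi> ` (U \<inter> V \<inter> W) = \<phi> ` (U \<inter> W) \<inter> \<phi> ` (V \<inter> W)"
        using inj[OF c] unfolding inj_on_def by blast
      then show "openin (model M) (\<phi> ` (U \<inter> V \<inter> W))"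
        using U V c by (auto intro!: openin_Int)
    qed
  next
    fix K assume K: "\<forall>V\<in>K. V \<subseteq> points M \<and> (\<forall>(W, \<phi>)\<in>charts M. openin (model M) (\<phi> ` (V \<inter> W)))"
    show "\<Union>K \<subseteq> points M" using K by blast
    show "\<forall>(W, \<phi>)\<in>charts M. openin (model M) (\<phi> ` (\<Union>K \<inter> W))"
    proof clarify
      fix W \<phi> assume c: "(W, \<phi>) \<in> charts M"
      have "\<phi> ` (\<Union>K \<inter> W) = \<Union>((\<lambda>V. \<phi> ` (V \<inter> W)) ` K)" by blast
      then show "openin (model M) (\<phi> ` (\<Union>K \<inter> W))"
        using K c by (auto intro!: openin_Union)
    qed
  qed
  then show ?thesis
    by (simp add: mfd_topology_def topology_inverse')
qed

definition prod_mfd :: "('a, 'v) mfd \<Rightarrow> ('b, 'w) mfd \<Rightarrow> ('a \<times> 'b, 'v \<times> 'w) mfd"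
  where "prod_mfd M N = \<lparr>points = points M \<times> points N,
    model = prod_topology (model M) (model N),
    charts = {(W \<times> W', map_prod \<phi> \<psi>) | W \<phi> W' \<psi>. (W, \<phi>) \<in> charts M \<and> (W', \<psi>) \<in> charts N}\<rparr>"

definition restrict_mfd :: "('a, 'v) mfd \<Rightarrow> 'a set \<Rightarrow> ('a, 'v) mfd"
  where "restrict_mfd M V = \<lparr>points = points M \<inter> V, model = model M,
    charts = {(W \<inter> V, \<phi>) | W \<phi>. (W, \<phi>) \<in> charts M}\<rparr>"

text \<open>
  Smoothness on an arbitrary subset \<open>S\<close> of a Fr\'echet space \<open>E\<close> means existence of local smooth
  extensions to open subsets of \<open>E\<close> (in a chart of the target). It is used for \<open>S\<close> open and for
  products of open sets with \<open>[0,1]\<close>.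
\<close>

definition smooth_into ::
    "'u::real_vector topology \<Rightarrow> 'u set \<Rightarrow> ('a, 'v::real_vector) mfd \<Rightarrow> ('u \<Rightarrow> 'a) \<Rightarrow> bool"
  where "smooth_into E S M f \<longleftrightarrow> S \<subseteq> topspace E \<and>
    (\<forall>x\<in>S. \<exists>A. openin E A \<and> x \<in> A \<and>
       (\<exists>(W, \<phi>)\<in>charts M. \<exists>g. smooth_on E (model M) A g \<and>
          (\<forall>y\<in>A \<inter> S. f y \<in> W \<and> \<phi> (f y) = g y)))"

definition smooth_map ::
    "('a, 'v::real_vector) mfd \<Rightarrow> ('b, 'w::real_vector) mfd \<Rightarrow> ('a \<Rightarrow> 'b) \<Rightarrow> bool"
  where "smooth_map M N f \<longleftrightarrow>
    (\<forall>(W, \<phi>)\<in>charts M. smooth_into (model M) (\<phi> ` W) N (f \<circ> the_inv_into W \<phi>))"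

definition diffeo ::
    "('a, 'v::real_vector) mfd \<Rightarrow> ('b, 'w::real_vector) mfd \<Rightarrow> ('a \<Rightarrow> 'b) \<Rightarrow> bool"
  where "diffeo M N f \<longleftrightarrow> bij_betw f (points M) (points N) \<and> smooth_map M N f \<and>
    smooth_map N M (the_inv_into (points M) f)"

definition frechet_lie_group :: "'a monoid \<Rightarrow> ('a, 'v::real_vector) mfd \<Rightarrow> bool"
  where "frechet_lie_group G M \<longleftrightarrow> group G \<and> frechet_manifold M \<and> points M = carrier G \<and>
    smooth_map (prod_mfd M M) M (\<lambda>(x, y). x \<otimes>\<^bsub>G\<^esub> y) \<and>
    smooth_map M M (\<lambda>x. inv\<^bsub>G\<^esub> x)"

definition lie_group :: "nat \<Rightarrow> 'g monoid \<Rightarrow> ('g, nat \<Rightarrow> real) mfd \<Rightarrow> bool"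
  where "lie_group n G M \<longleftrightarrow> frechet_lie_group G M \<and> model M = Euclidean_space n \<and>
    (\<exists>B. countable B \<and> (\<forall>V\<in>B. openin (mfd_topology M) V) \<and>
         (\<forall>U. openin (mfd_topology M) U \<longrightarrow> (\<exists>C\<subseteq>B. \<Union>C = U)))"

abbreviation circle :: "complex set"
  where "circle \<equiv> sphere 0 1"

definition U1 :: "complex monoid"
  where "U1 = \<lparr>carrier = circle, monoid.mult = (*), one = 1\<rparr>"

definition U1_mfd :: "(complex, real) mfd"
  where "U1_mfd = \<lparr>points = circle, model = euclideanreal,
    charts = {(cis ` {a<..<a + 2 * pi}, the_inv_into {a<..<a + 2 * pi} cis) | a. True}\<rparr>"


section \<open>Loops and paths\<close>

text \<open>
  A function on the circle is smooth iff its composition with the angular coordinate \<open>cis\<close> is.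
\<close>

definition loops :: "('a, 'v::real_vector) mfd \<Rightarrow> (complex \<Rightarrow> 'a) set"
  where "loops X = {\<tau> \<in> circle \<rightarrow>\<^sub>E points X. smooth_into euclideanreal UNIV X (\<lambda>\<theta>. \<tau> (cis \<theta>))}"

definition loop_group :: "'g monoid \<Rightarrow> ('g, 'v::real_vector) mfd \<Rightarrow> (complex \<Rightarrow> 'g) monoid"
  where "loop_group G M = (product_group circle (\<lambda>_. G))\<lparr>carrier := loops M\<rparr>"

text \<open>
  The Fr\'echet space of smooth maps from the circle to R^n, with the topology of uniform
  convergence of all derivatives.
\<close>

definition loop_model :: "nat \<Rightarrow> (complex \<Rightarrow> nat \<Rightarrow> real) topology"
  where "loop_model n = seminorm_topology
    {f. (\<forall>z. z \<notin> circle \<longrightarrow> f z = 0) \<and>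
        smooth_on euclideanreal (Euclidean_space n) UNIV (\<lambda>\<theta>. f (cis \<theta>))}
    (\<lambda>k f. SUP \<theta>. \<Sum>i<n. \<bar>(deriv ^^ k) (\<lambda>t. f (cis t) i) \<theta>\<bar>)"

text \<open>
  Charts of the loop group around \<open>\<tau>\<close> are obtained by right translation from a chart \<open>\<phi>\<close> of the
  group around the unit, applied pointwise.
\<close>

definition loop_group_mfd ::
    "nat \<Rightarrow> 'g monoid \<Rightarrow> ('g, nat \<Rightarrow> real) mfd \<Rightarrow> (complex \<Rightarrow> 'g, complex \<Rightarrow> nat \<Rightarrow> real) mfd"
  where "loop_group_mfd n G M = \<lparr>points = loops M, model = loop_model n,
    charts = {({\<sigma> \<in> loops M. \<forall>z\<in>circle. \<sigma> z \<otimes>\<^bsub>G\<^esub> inv\<^bsub>G\<^esub> (\<tau> z) \<in> W},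
               \<lambda>\<sigma> z. if z \<in> circle then \<phi> (\<sigma> z \<otimes>\<^bsub>G\<^esub> inv\<^bsub>G\<^esub> (\<tau> z)) else 0) | \<tau> W \<phi>.
              \<tau> \<in> loops M \<and> (W, \<phi>) \<in> charts M \<and> \<one>\<^bsub>G\<^esub> \<in> W}\<rparr>"

definition supported_on :: "'g monoid \<Rightarrow> (complex \<Rightarrow> 'g) \<Rightarrow> complex set \<Rightarrow> bool"
  where "supported_on G \<tau> I \<longleftrightarrow> (\<forall>z\<in>circle - I. \<tau> z = \<one>\<^bsub>G\<^esub>)"

definition circle_interval :: "complex set \<Rightarrow> bool"
  where "circle_interval I \<longleftrightarrow> (\<exists>J. is_interval (J :: real set) \<and> I = cis ` J)"

definition paths :: "('a, 'v::real_vector) mfd \<Rightarrow> (real \<Rightarrow> 'a) set"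
  where "paths X = {\<gamma> \<in> {0..1} \<rightarrow>\<^sub>E points X. smooth_into euclideanreal {0..1} X \<gamma> \<and>
    (\<exists>e>0. \<forall>t\<in>{0..1}. (t < e \<longrightarrow> \<gamma> t = \<gamma> 0) \<and> (1 - e < t \<longrightarrow> \<gamma> t = \<gamma> 1))}"

text \<open>
  \<open>(\<gamma>\<^sub>1, ..., \<gamma>\<^sub>k)\<close> is an element of the k-fold fibre product of the path space over the end point
  evaluation iff \<open>coterminal X {\<gamma>\<^sub>1, ..., \<gamma>\<^sub>k}\<close>.
\<close>

definition coterminal :: "('a, 'v::real_vector) mfd \<Rightarrow> (real \<Rightarrow> 'a) set \<Rightarrow> bool"
  where "coterminal X \<Gamma> \<longleftrightarrow> \<Gamma> \<subseteq> paths X \<and> (\<forall>\<gamma>\<in>\<Gamma>. \<forall>\<gamma>'\<in>\<Gamma>. \<gamma> 0 = \<gamma>' 0 \<and> \<gamma> 1 = \<gamma>' 1)"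

definition path_rev :: "(real \<Rightarrow> 'a) \<Rightarrow> real \<Rightarrow> 'a"
  where "path_rev \<gamma> = (\<lambda>t\<in>{0..1}. \<gamma> (1 - t))"

text \<open>\<open>path_comp \<gamma>\<^sub>2 \<gamma>\<^sub>1\<close> runs through \<open>\<gamma>\<^sub>1\<close> first.\<close>

definition path_comp :: "(real \<Rightarrow> 'a) \<Rightarrow> (real \<Rightarrow> 'a) \<Rightarrow> real \<Rightarrow> 'a"
  where "path_comp \<gamma>\<^sub>2 \<gamma>\<^sub>1 = (\<lambda>t\<in>{0..1}. if t \<le> 1/2 then \<gamma>\<^sub>1 (2 * t) else \<gamma>\<^sub>2 (2 * t - 1))"

definition path_mult :: "'g monoid \<Rightarrow> (real \<Rightarrow> 'g) \<Rightarrow> (real \<Rightarrow> 'g) \<Rightarrow> real \<Rightarrow> 'g"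
  where "path_mult G \<gamma> \<gamma>' = (\<lambda>t\<in>{0..1}. \<gamma> t \<otimes>\<^bsub>G\<^esub> \<gamma>' t)"

text \<open>A closed path is viewed as a loop via \<open>t \<mapsto> exp(2\<pi>it)\<close>.\<close>

definition path_cup :: "(real \<Rightarrow> 'a) \<Rightarrow> (real \<Rightarrow> 'a) \<Rightarrow> complex \<Rightarrow> 'a" (infixl "\<squnion>\<^sub>p" 70)
  where "\<gamma>\<^sub>1 \<squnion>\<^sub>p \<gamma>\<^sub>2 = (\<lambda>z\<in>circle. path_comp (path_rev \<gamma>\<^sub>2) \<gamma>\<^sub>1 (Arg2pi z / (2 * pi)))"


section \<open>Diffeological spaces\<close>

text \<open>
  A diffeology is given by its plots: \<open>P m U c\<close> means that \<open>c\<close> restricted to the open set \<open>U\<close> of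
  R^m is a plot.
\<close>

type_synonym 'a diffeology = "nat \<Rightarrow> (nat \<Rightarrow> real) set \<Rightarrow> ((nat \<Rightarrow> real) \<Rightarrow> 'a) \<Rightarrow> bool"

definition dsmooth :: "'a diffeology \<Rightarrow> 'b diffeology \<Rightarrow> ('a \<Rightarrow> 'b) \<Rightarrow> bool"
  where "dsmooth P Q f \<longleftrightarrow> (\<forall>m U c. P m U c \<longrightarrow> Q m U (f \<circ> c))"

definition mfd_diff :: "('a, 'v::real_vector) mfd \<Rightarrow> 'a diffeology"
  where "mfd_diff M m U c \<longleftrightarrow>
    openin (Euclidean_space m) U \<and> smooth_into (Euclidean_space m) U M c"

definition path_diff :: "('a, 'v::real_vector) mfd \<Rightarrow> (real \<Rightarrow> 'a) diffeology"
  where "path_diff X m U c \<longleftrightarrow> openin (Euclidean_space m) U \<and> (\<forall>u\<in>U. c u \<in> paths X) \<and>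
    smooth_into (prod_topology (Euclidean_space m) euclideanreal) (U \<times> {0..1}) X (\<lambda>(u, t). c u t)"

text \<open>
  For the loop space of a manifold, the diffeology of the Fr\'echet manifold is the functional one.
\<close>

definition loop_diff :: "('a, 'v::real_vector) mfd \<Rightarrow> (complex \<Rightarrow> 'a) diffeology"
  where "loop_diff X m U c \<longleftrightarrow> openin (Euclidean_space m) U \<and> (\<forall>u\<in>U. c u \<in> loops X) \<and>
    smooth_into (prod_topology (Euclidean_space m) euclideanreal) (U \<times> UNIV) X
      (\<lambda>(u, \<theta>). c u (cis \<theta>))"

definition thin_path :: "('a, 'v::real_vector) mfd \<Rightarrow> (real \<Rightarrow> complex \<Rightarrow> 'a) \<Rightarrow> bool"
  where "thin_path X \<gamma> \<longleftrightarrow>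
    (let F = (\<lambda>(t, \<theta>). \<gamma> t (cis \<theta>)); S = {0..1} \<times> UNIV in
      (\<forall>t\<in>{0..1}. \<gamma> t \<in> loops X) \<and>
      smooth_into (prod_topology euclideanreal euclideanreal) S X F \<and>
      (\<forall>x\<in>S. \<forall>(W, \<phi>)\<in>charts X. F x \<in> W \<longrightarrow>
         dim (range (\<lambda>v. dir_deriv (model X) S (\<phi> \<circ> F) x v)) \<le> 1))"

definition thin_pairs :: "('a, 'v::real_vector) mfd \<Rightarrow> ((complex \<Rightarrow> 'a) \<times> (complex \<Rightarrow> 'a)) set"
  where "thin_pairs X = {(\<tau>\<^sub>0, \<tau>\<^sub>1). \<exists>\<gamma>. thin_path X \<gamma> \<and> \<gamma> 0 = \<tau>\<^sub>0 \<and> \<gamma> 1 = \<tau>\<^sub>1}"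

definition thin_diff ::
    "('a, 'v::real_vector) mfd \<Rightarrow> ((complex \<Rightarrow> 'a) \<times> (complex \<Rightarrow> 'a)) diffeology"
  where "thin_diff X m U c \<longleftrightarrow>
    loop_diff X m U (fst \<circ> c) \<and> loop_diff X m U (snd \<circ> c) \<and> (\<forall>u\<in>U. c u \<in> thin_pairs X) \<and>
    (\<forall>u\<^sub>0\<in>U. \<exists>V h. openin (Euclidean_space m) V \<and> u\<^sub>0 \<in> V \<and> V \<subseteq> U \<and>
       smooth_into (prod_topology (Euclidean_space m) (prod_topology euclideanreal euclideanreal))
         (V \<times> ({0..1} \<times> UNIV)) X (\<lambda>(u, t, \<theta>). h u t (cis \<theta>)) \<and>
       (\<forall>u\<in>V. thin_path X (h u) \<and> h u 0 = fst (c u) \<and> h u 1 = snd (c u)))"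


section \<open>Central extensions of the loop group\<close>

record ('g, 'l, 'w) extension =
  ext_group :: "'l monoid"
  ext_mfd :: "('l, 'w) mfd"
  incl :: "complex \<Rightarrow> 'l"
  proj :: "'l \<Rightarrow> complex \<Rightarrow> 'g"

definition fibre :: "('g, 'l, 'w) extension \<Rightarrow> (complex \<Rightarrow> 'g) \<Rightarrow> 'l set"
  where "fibre E \<tau> = {p \<in> carrier (ext_group E). proj E p = \<tau>}"

text \<open>
  The last conjunct states that \<open>proj E\<close> is a principal U(1)-bundle, i.e.\ that it is locally
  trivial.
\<close>

definition central_extension ::
    "nat \<Rightarrow> 'g monoid \<Rightarrow> ('g, nat \<Rightarrow> real) mfd \<Rightarrow> ('g, 'l, 'w::real_vector) extension \<Rightarrow> bool"
  where "central_extension n G M E \<longleftrightarrow>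
    frechet_lie_group (ext_group E) (ext_mfd E) \<and>
    incl E \<in> hom U1 (ext_group E) \<and> inj_on (incl E) circle \<and>
    smooth_map U1_mfd (ext_mfd E) (incl E) \<and>
    proj E \<in> hom (ext_group E) (loop_group G M) \<and> proj E ` carrier (ext_group E) = loops M \<and>
    smooth_map (ext_mfd E) (loop_group_mfd n G M) (proj E) \<and>
    incl E ` circle = kernel (ext_group E) (loop_group G M) (proj E) \<and>
    (\<forall>z\<in>circle. \<forall>p\<in>carrier (ext_group E). incl E z \<otimes>\<^bsub>ext_group E\<^esub> p = p \<otimes>\<^bsub>ext_group E\<^esub> incl E z) \<and>
    (\<forall>\<tau>\<in>loops M. \<exists>V s. openin (mfd_topology (loop_group_mfd n G M)) V \<and> \<tau> \<in> V \<and>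
       (\<forall>\<sigma>\<in>V. s \<sigma> \<in> fibre E \<sigma>) \<and>
       diffeo (prod_mfd (restrict_mfd (loop_group_mfd n G M) V) U1_mfd)
              (restrict_mfd (ext_mfd E) {p. proj E p \<in> V})
              (\<lambda>(\<sigma>, z). s \<sigma> \<otimes>\<^bsub>ext_group E\<^esub> incl E z))"


section \<open>Fusion products\<close>

text \<open>
  \<open>lam \<gamma>\<^sub>1 \<gamma>\<^sub>2 \<gamma>\<^sub>3 p q\<close> is the image of \<open>p \<otimes> q\<close>. A bundle morphism out of the tensor product of two
  principal U(1)-bundles (the quotient of the fibre product by the antidiagonal action) is
  the same as a smooth map out of the fibre product that is equivariant in both arguments.
\<close>

type_synonym ('g, 'l) fusion =
  "(real \<Rightarrow> 'g) \<Rightarrow> (real \<Rightarrow> 'g) \<Rightarrow> (real \<Rightarrow> 'g) \<Rightarrow> 'l \<Rightarrow> 'l \<Rightarrow> 'l"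

definition fusion_diff ::
    "('g, nat \<Rightarrow> real) mfd \<Rightarrow> ('g, 'l, 'w::real_vector) extension \<Rightarrow>
     (((real \<Rightarrow> 'g) \<times> (real \<Rightarrow> 'g) \<times> (real \<Rightarrow> 'g)) \<times> 'l \<times> 'l) diffeology"
  where "fusion_diff M E m U c \<longleftrightarrow>
    path_diff M m U (\<lambda>u. fst (fst (c u))) \<and>
    path_diff M m U (\<lambda>u. fst (snd (fst (c u)))) \<and>
    path_diff M m U (\<lambda>u. snd (snd (fst (c u)))) \<and>
    mfd_diff (ext_mfd E) m U (\<lambda>u. fst (snd (c u))) \<and>
    mfd_diff (ext_mfd E) m U (\<lambda>u. snd (snd (c u))) \<and>
    (\<forall>u\<in>U. case c u of ((\<gamma>\<^sub>1, \<gamma>\<^sub>2, \<gamma>\<^sub>3), p, q) \<Rightarrow> coterminal M {\<gamma>\<^sub>1, \<gamma>\<^sub>2, \<gamma>\<^sub>3} \<and>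
       p \<in> fibre E (\<gamma>\<^sub>1 \<squnion>\<^sub>p \<gamma>\<^sub>2) \<and> q \<in> fibre E (\<gamma>\<^sub>2 \<squnion>\<^sub>p \<gamma>\<^sub>3))"

definition fusion_product ::
    "('g, nat \<Rightarrow> real) mfd \<Rightarrow> ('g, 'l, 'w::real_vector) extension \<Rightarrow> ('g, 'l) fusion \<Rightarrow> bool"
  where "fusion_product M E lam \<longleftrightarrow>
    (\<forall>\<gamma>\<^sub>1 \<gamma>\<^sub>2 \<gamma>\<^sub>3. coterminal M {\<gamma>\<^sub>1, \<gamma>\<^sub>2, \<gamma>\<^sub>3} \<longrightarrow>
      (\<forall>p\<in>fibre E (\<gamma>\<^sub>1 \<squnion>\<^sub>p \<gamma>\<^sub>2). \<forall>q\<in>fibre E (\<gamma>\<^sub>2 \<squnion>\<^sub>p \<gamma>\<^sub>3).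
         lam \<gamma>\<^sub>1 \<gamma>\<^sub>2 \<gamma>\<^sub>3 p q \<in> fibre E (\<gamma>\<^sub>1 \<squnion>\<^sub>p \<gamma>\<^sub>3) \<and>
         (\<forall>z\<in>circle.
            lam \<gamma>\<^sub>1 \<gamma>\<^sub>2 \<gamma>\<^sub>3 (p \<otimes>\<^bsub>ext_group E\<^esub> incl E z) q = lam \<gamma>\<^sub>1 \<gamma>\<^sub>2 \<gamma>\<^sub>3 p q \<otimes>\<^bsub>ext_group E\<^esub> incl E z \<and>
            lam \<gamma>\<^sub>1 \<gamma>\<^sub>2 \<gamma>\<^sub>3 p (q \<otimes>\<^bsub>ext_group E\<^esub> incl E z) = lam \<gamma>\<^sub>1 \<gamma>\<^sub>2 \<gamma>\<^sub>3 p q \<otimes>\<^bsub>ext_group E\<^esub> incl E z))) \<and>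
    dsmooth (fusion_diff M E) (mfd_diff (ext_mfd E))
      (\<lambda>((\<gamma>\<^sub>1, \<gamma>\<^sub>2, \<gamma>\<^sub>3), p, q). lam \<gamma>\<^sub>1 \<gamma>\<^sub>2 \<gamma>\<^sub>3 p q) \<and>
    (\<forall>\<gamma>\<^sub>1 \<gamma>\<^sub>2 \<gamma>\<^sub>3 \<gamma>\<^sub>4. coterminal M {\<gamma>\<^sub>1, \<gamma>\<^sub>2, \<gamma>\<^sub>3, \<gamma>\<^sub>4} \<longrightarrow>
      (\<forall>p\<in>fibre E (\<gamma>\<^sub>1 \<squnion>\<^sub>p \<gamma>\<^sub>2). \<forall>q\<in>fibre E (\<gamma>\<^sub>2 \<squnion>\<^sub>p \<gamma>\<^sub>3). \<forall>r\<in>fibre E (\<gamma>\<^sub>3 \<squnion>\<^sub>p \<gamma>\<^sub>4).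
         lam \<gamma>\<^sub>1 \<gamma>\<^sub>3 \<gamma>\<^sub>4 (lam \<gamma>\<^sub>1 \<gamma>\<^sub>2 \<gamma>\<^sub>3 p q) r = lam \<gamma>\<^sub>1 \<gamma>\<^sub>2 \<gamma>\<^sub>4 p (lam \<gamma>\<^sub>2 \<gamma>\<^sub>3 \<gamma>\<^sub>4 q r)))"

definition multiplicative_fusion ::
    "'g monoid \<Rightarrow> ('g, nat \<Rightarrow> real) mfd \<Rightarrow> ('g, 'l, 'w::real_vector) extension \<Rightarrow>
     ('g, 'l) fusion \<Rightarrow> bool"
  where "multiplicative_fusion G M E lam \<longleftrightarrow>
    (\<forall>\<gamma>\<^sub>1 \<gamma>\<^sub>2 \<gamma>\<^sub>3 \<gamma>\<^sub>1' \<gamma>\<^sub>2' \<gamma>\<^sub>3'. coterminal M {\<gamma>\<^sub>1, \<gamma>\<^sub>2, \<gamma>\<^sub>3} \<and> coterminal M {\<gamma>\<^sub>1', \<gamma>\<^sub>2', \<gamma>\<^sub>3'} \<longrightarrow>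
      (\<forall>p\<in>fibre E (\<gamma>\<^sub>1 \<squnion>\<^sub>p \<gamma>\<^sub>2). \<forall>q\<in>fibre E (\<gamma>\<^sub>2 \<squnion>\<^sub>p \<gamma>\<^sub>3).
       \<forall>p'\<in>fibre E (\<gamma>\<^sub>1' \<squnion>\<^sub>p \<gamma>\<^sub>2'). \<forall>q'\<in>fibre E (\<gamma>\<^sub>2' \<squnion>\<^sub>p \<gamma>\<^sub>3').
         lam \<gamma>\<^sub>1 \<gamma>\<^sub>2 \<gamma>\<^sub>3 p q \<otimes>\<^bsub>ext_group E\<^esub> lam \<gamma>\<^sub>1' \<gamma>\<^sub>2' \<gamma>\<^sub>3' p' q' =
         lam (path_mult G \<gamma>\<^sub>1 \<gamma>\<^sub>1') (path_mult G \<gamma>\<^sub>2 \<gamma>\<^sub>2') (path_mult G \<gamma>\<^sub>3 \<gamma>\<^sub>3')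
           (p \<otimes>\<^bsub>ext_group E\<^esub> p') (q \<otimes>\<^bsub>ext_group E\<^esub> q')))"


section \<open>Thin homotopy equivariant structures\<close>

definition pullback_total ::
    "('g, 'l, 'w) extension \<Rightarrow> 'b set \<Rightarrow> ('b \<Rightarrow> complex \<Rightarrow> 'g) \<Rightarrow> ('b \<times> 'l) set"
  where "pullback_total E B f = {(b, p). b \<in> B \<and> p \<in> fibre E (f b)}"

definition pullback_diff ::
    "('g, 'l, 'w::real_vector) extension \<Rightarrow> 'b diffeology \<Rightarrow> ('b \<Rightarrow> complex \<Rightarrow> 'g) \<Rightarrow>
     ('b \<times> 'l) diffeology"
  where "pullback_diff E P f m U c \<longleftrightarrow> P m U (fst \<circ> c) \<and>
    mfd_diff (ext_mfd E) m U (snd \<circ> c) \<and> (\<forall>u\<in>U. snd (c u) \<in> fibre E (f (fst (c u))))"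

type_synonym ('g, 'l) thin_transport = "(complex \<Rightarrow> 'g) \<Rightarrow> (complex \<Rightarrow> 'g) \<Rightarrow> 'l \<Rightarrow> 'l"

definition thin_structure ::
    "('g, nat \<Rightarrow> real) mfd \<Rightarrow> ('g, 'l, 'w::real_vector) extension \<Rightarrow> ('g, 'l) thin_transport \<Rightarrow> bool"
  where "thin_structure M E d \<longleftrightarrow>
    (let D = (\<lambda>((\<tau>\<^sub>0, \<tau>\<^sub>1), p). ((\<tau>\<^sub>0, \<tau>\<^sub>1), d \<tau>\<^sub>0 \<tau>\<^sub>1 p));
         A = pullback_total E (thin_pairs M) fst; B = pullback_total E (thin_pairs M) snd in
      bij_betw D A B \<and>
      dsmooth (pullback_diff E (thin_diff M) fst) (pullback_diff E (thin_diff M) snd) D \<and>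
      dsmooth (pullback_diff E (thin_diff M) snd) (pullback_diff E (thin_diff M) fst)
        (the_inv_into A D)) \<and>
    (\<forall>(\<tau>\<^sub>0, \<tau>\<^sub>1)\<in>thin_pairs M. \<forall>p\<in>fibre E \<tau>\<^sub>0. \<forall>z\<in>circle.
       d \<tau>\<^sub>0 \<tau>\<^sub>1 (p \<otimes>\<^bsub>ext_group E\<^esub> incl E z) = d \<tau>\<^sub>0 \<tau>\<^sub>1 p \<otimes>\<^bsub>ext_group E\<^esub> incl E z) \<and>
    (\<forall>\<tau>\<^sub>1 \<tau>\<^sub>2 \<tau>\<^sub>3. (\<tau>\<^sub>1, \<tau>\<^sub>2) \<in> thin_pairs M \<and> (\<tau>\<^sub>2, \<tau>\<^sub>3) \<in> thin_pairs M \<and> (\<tau>\<^sub>1, \<tau>\<^sub>3) \<in> thin_pairs M \<longrightarrow>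
       (\<forall>p\<in>fibre E \<tau>\<^sub>1. d \<tau>\<^sub>2 \<tau>\<^sub>3 (d \<tau>\<^sub>1 \<tau>\<^sub>2 p) = d \<tau>\<^sub>1 \<tau>\<^sub>3 p))"

definition loop_pair :: "(complex \<Rightarrow> 'a) \<Rightarrow> (complex \<Rightarrow> 'b) \<Rightarrow> complex \<Rightarrow> 'a \<times> 'b"
  where "loop_pair \<tau> \<gamma> = (\<lambda>z\<in>circle. (\<tau> z, \<gamma> z))"

definition multiplicative_thin ::
    "'g monoid \<Rightarrow> ('g, nat \<Rightarrow> real) mfd \<Rightarrow> ('g, 'l, 'w::real_vector) extension \<Rightarrow>
     ('g, 'l) thin_transport \<Rightarrow> bool"
  where "multiplicative_thin G M E d \<longleftrightarrow>
    (\<forall>\<tau>\<^sub>0\<in>loops M. \<forall>\<gamma>\<^sub>0\<in>loops M. \<forall>\<tau>\<^sub>1\<in>loops M. \<forall>\<gamma>\<^sub>1\<in>loops M.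
      (loop_pair \<tau>\<^sub>0 \<gamma>\<^sub>0, loop_pair \<tau>\<^sub>1 \<gamma>\<^sub>1) \<in> thin_pairs (prod_mfd M M) \<longrightarrow>
      (\<forall>p\<in>fibre E \<tau>\<^sub>0. \<forall>q\<in>fibre E \<gamma>\<^sub>0.
         d (\<tau>\<^sub>0 \<otimes>\<^bsub>loop_group G M\<^esub> \<gamma>\<^sub>0) (\<tau>\<^sub>1 \<otimes>\<^bsub>loop_group G M\<^esub> \<gamma>\<^sub>1) (p \<otimes>\<^bsub>ext_group E\<^esub> q) =
         d \<tau>\<^sub>0 \<tau>\<^sub>1 p \<otimes>\<^bsub>ext_group E\<^esub> d \<gamma>\<^sub>0 \<gamma>\<^sub>1 q))"

definition compatible_thin ::
    "('g, nat \<Rightarrow> real) mfd \<Rightarrow> ('g, 'l, 'w::real_vector) extension \<Rightarrow>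
     ('g, 'l) fusion \<Rightarrow> ('g, 'l) thin_transport \<Rightarrow> bool"
  where "compatible_thin M E lam d \<longleftrightarrow>
    (\<forall>\<gamma>\<^sub>1 \<gamma>\<^sub>2 \<gamma>\<^sub>3.
      (\<forall>t\<in>{0..1}. coterminal M {\<gamma>\<^sub>1 t, \<gamma>\<^sub>2 t, \<gamma>\<^sub>3 t}) \<and>
      (\<forall>\<gamma>\<in>{\<gamma>\<^sub>1, \<gamma>\<^sub>2, \<gamma>\<^sub>3}.
         smooth_into (prod_topology euclideanreal euclideanreal) ({0..1} \<times> {0..1}) M
           (\<lambda>(t, s). \<gamma> t s)) \<and>
      thin_path M (\<lambda>t. \<gamma>\<^sub>1 t \<squnion>\<^sub>p \<gamma>\<^sub>2 t) \<and> thin_path M (\<lambda>t. \<gamma>\<^sub>2 t \<squnion>\<^sub>p \<gamma>\<^sub>3 t) \<and>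
      thin_path M (\<lambda>t. \<gamma>\<^sub>1 t \<squnion>\<^sub>p \<gamma>\<^sub>3 t) \<longrightarrow>
      (\<forall>p\<in>fibre E (\<gamma>\<^sub>1 0 \<squnion>\<^sub>p \<gamma>\<^sub>2 0). \<forall>q\<in>fibre E (\<gamma>\<^sub>2 0 \<squnion>\<^sub>p \<gamma>\<^sub>3 0).
         d (\<gamma>\<^sub>1 0 \<squnion>\<^sub>p \<gamma>\<^sub>3 0) (\<gamma>\<^sub>1 1 \<squnion>\<^sub>p \<gamma>\<^sub>3 1) (lam (\<gamma>\<^sub>1 0) (\<gamma>\<^sub>2 0) (\<gamma>\<^sub>3 0) p q) =
         lam (\<gamma>\<^sub>1 1) (\<gamma>\<^sub>2 1) (\<gamma>\<^sub>3 1)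
           (d (\<gamma>\<^sub>1 0 \<squnion>\<^sub>p \<gamma>\<^sub>2 0) (\<gamma>\<^sub>1 1 \<squnion>\<^sub>p \<gamma>\<^sub>2 1) p)
           (d (\<gamma>\<^sub>2 0 \<squnion>\<^sub>p \<gamma>\<^sub>3 0) (\<gamma>\<^sub>2 1 \<squnion>\<^sub>p \<gamma>\<^sub>3 1) q)))"

definition symmetrizes ::
    "('g, nat \<Rightarrow> real) mfd \<Rightarrow> ('g, 'l, 'w::real_vector) extension \<Rightarrow>
     ('g, 'l) fusion \<Rightarrow> ('g, 'l) thin_transport \<Rightarrow> bool"
  where "symmetrizes M E lam d \<longleftrightarrow>
    (\<forall>\<gamma>\<^sub>1 \<gamma>\<^sub>2 \<gamma>\<^sub>3. coterminal M {\<gamma>\<^sub>1, \<gamma>\<^sub>2, \<gamma>\<^sub>3} \<longrightarrow>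
      (\<forall>p\<in>fibre E (\<gamma>\<^sub>1 \<squnion>\<^sub>p \<gamma>\<^sub>2). \<forall>p'\<in>fibre E (\<gamma>\<^sub>2 \<squnion>\<^sub>p \<gamma>\<^sub>3).
         d (\<gamma>\<^sub>1 \<squnion>\<^sub>p \<gamma>\<^sub>3) (path_rev \<gamma>\<^sub>3 \<squnion>\<^sub>p path_rev \<gamma>\<^sub>1) (lam \<gamma>\<^sub>1 \<gamma>\<^sub>2 \<gamma>\<^sub>3 p p') =
         lam (path_rev \<gamma>\<^sub>3) (path_rev \<gamma>\<^sub>2) (path_rev \<gamma>\<^sub>1)
           (d (\<gamma>\<^sub>2 \<squnion>\<^sub>p \<gamma>\<^sub>3) (path_rev \<gamma>\<^sub>3 \<squnion>\<^sub>p path_rev \<gamma>\<^sub>2) p')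
           (d (\<gamma>\<^sub>1 \<squnion>\<^sub>p \<gamma>\<^sub>2) (path_rev \<gamma>\<^sub>2 \<squnion>\<^sub>p path_rev \<gamma>\<^sub>1) p)))"

definition fusive ::
    "('g, nat \<Rightarrow> real) mfd \<Rightarrow> ('g, 'l, 'w::real_vector) extension \<Rightarrow>
     ('g, 'l) fusion \<Rightarrow> ('g, 'l) thin_transport \<Rightarrow> bool"
  where "fusive M E lam d \<longleftrightarrow> compatible_thin M E lam d \<and> symmetrizes M E lam d"

end

theory Submission
  imports Defs
begin

text \<open>
  The heart of the matter is an Eckmann--Hilton argument. Write \<open>1\<close> for the constant path at the
  unit of \<open>G\<close>, and let \<open>\<gamma>\<^sub>1\<close>, \<open>\<gamma>\<^sub>2\<close> be closed paths at the unit, \<open>p\<close> an element over \<open>\<gamma>\<^sub>1 \<squnion> 1\<close> and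
  \<open>q\<close> an element over \<open>1 \<squnion> \<gamma>\<^sub>2\<close>. Multiplicativity of the fusion product evaluates both
  \<open>\<lambda>(p \<otimes> 1) \<cdot> \<lambda>(1 \<otimes> q)\<close> and \<open>\<lambda>(1 \<otimes> q) \<cdot> \<lambda>(p \<otimes> 1)\<close> to \<open>\<lambda>(p \<otimes> q)\<close>, where the last fusion is over
  the triple \<open>(\<gamma>\<^sub>1, 1, \<gamma>\<^sub>2)\<close>. The unit of the extension is neutral for fusion with the constant path
  (\<open>lam_unit_right\<close>, \<open>lam_unit_left\<close>), so this says \<open>p \<cdot> q = q \<cdot> p\<close> (\<open>half_loops_commute\<close>).

  Two loops with disjoint supports need not have this form: their supports can lie anywhere on the
  circle, and if the intervals touch, the loops need not be constant near the common end point,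
  as elements of the path space have to be. Both defects are removed by one reparametrization
  \<open>f\<close> of the circle that is homotopic to the identity: it maps the upper and the lower half circle to
  two arcs on which \<open>\<tau>\<^sub>2\<close> and \<open>\<tau>\<^sub>1\<close>, respectively, are trivial, and it is constant near \<open>0\<close> and \<open>\<pi>\<close> (\<open>circle_reparametrization\<close>). The homotopy from
  the identity to \<open>f\<close>, applied to both loops simultaneously, moves every point along the image of the
  single curve \<open>(\<tau>\<^sub>1, \<tau>\<^sub>2)\<close> in \<open>G \<times> G\<close>, so it is thin there (\<open>thin_pair_reparam_pair\<close>), and the
  multiplicative structure \<open>d\<close> carries \<open>p\<^sub>1 \<cdot> p\<^sub>2\<close> to \<open>d p\<^sub>1 \<cdot> d p\<^sub>2\<close>. Since \<open>\<tau>\<^sub>1 \<tau>\<^sub>2 = \<tau>\<^sub>2 \<tau>\<^sub>1\<close>, the two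
  products lie in the same fibre, on which \<open>d\<close> is injective; hence they agree because their images
  do.

  Most of the text proves that this homotopy is smooth and of rank at most one in the sense of
  Fr\'echet calculus. Smoothness is reduced to existence and continuity of partial derivatives
  (\<open>smooth_onI\<close>, \<open>Ck_of_smooth_on\<close>), a condition that is stable under the chain rule
  (\<open>Ck_compose_real\<close>). The rank has to be computed in all charts, so it has to be known that a smooth
  curve is differentiable in every chart that it meets (\<open>chain_rule_curve\<close>,
  \<open>chartwise_differentiable_smooth\<close>). Both use that the model spaces \<open>R\<^sup>n\<close> and \<open>R\<^sup>n \<times> R\<^sup>n\<close> carry the
  weak topology of a separating set of linear functionals, whence limits are computed
  coordinatewise.
\<close>


section \<open>Spaces whose topology is given by linear coordinates\<close>

text \<open>
  The functionals in \<open>L\<close> play the role of coordinates: they separate points, and finitely many of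
  them determine the neighbourhoods of a point. Calculus in \<open>F\<close> thereby reduces to calculus of real
  functions.
\<close>
locale coordinates =
  fixes F :: "'w::real_vector topology" and L :: "('w \<Rightarrow> real) set"
  assumes subspace_topspace: "subspace (topspace F)"
    and linear_coord: "\<And>l. l \<in> L \<Longrightarrow> linear l"
    and continuous_coord: "\<And>l. l \<in> L \<Longrightarrow> continuous_map F euclideanreal l"
    and coord_separate: "\<And>x. x \<in> topspace F \<Longrightarrow> (\<And>l. l \<in> L \<Longrightarrow> l x = 0) \<Longrightarrow> x = 0"
    and coord_nbhd: "\<And>U x. openin F U \<Longrightarrow> x \<in> U \<Longrightarrow>
      \<exists>K e. finite K \<and> K \<subseteq> L \<and> e > 0 \<and> (\<forall>y\<in>topspace F. (\<forall>l\<in>K. \<bar>l y - l x\<bar> < e) \<longrightarrow> y \<in> U)"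
begin

lemma zero_in_topspace: "0 \<in> topspace F"
  using subspace_topspace by (rule subspace_0)

lemma limitin_iff:
  "limitin F f w net \<longleftrightarrow> w \<in> topspace F \<and> (\<forall>\<^sub>F x in net. f x \<in> topspace F) \<and>
    (\<forall>l\<in>L. ((\<lambda>x. l (f x)) \<longlongrightarrow> l w) net)" (is "?lhs \<longleftrightarrow> ?rhs")
proof
  assume lim: ?lhs
  have "((\<lambda>x. l (f x)) \<longlongrightarrow> l w) net" if "l \<in> L" for l
    using continuous_map_limit[OF continuous_coord[OF that] lim] by (simp add: o_def)
  with lim show ?rhs by (simp add: limitin_def)
next
  assume r: ?rhs
  show ?lhs
    unfolding limitin_def
  proof (intro conjI allI impI)
    show "w \<in> topspace F" using r by blast
    fix U assume U: "openin F U \<and> w \<in> U"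
    obtain K e where K: "finite K" "K \<subseteq> L" "e > 0"
      "\<forall>y\<in>topspace F. (\<forall>l\<in>K. \<bar>l y - l w\<bar> < e) \<longrightarrow> y \<in> U"
      using coord_nbhd[of U w] U by metis
    have "\<forall>\<^sub>F x in net. \<forall>l\<in>K. \<bar>l (f x) - l w\<bar> < e"
      using K r by (intro eventually_ball_finite ballI) (auto simp: tendsto_iff dist_real_def)
    moreover have "\<forall>\<^sub>F x in net. f x \<in> topspace F" using r by blast
    ultimately show "\<forall>\<^sub>F x in net. f x \<in> U"
      by eventually_elim (use K in blast)
  qed
qed

lemma continuous_map_coordinates:
  "continuous_map X F f \<longleftrightarrow> f \<in> topspace X \<rightarrow> topspace F \<and> (\<forall>l\<in>L. continuous_map X euclideanreal (\<lambda>x. l (f x)))"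
  (is "?lhs \<longleftrightarrow> ?rhs")
proof
  assume c: ?lhs
  then show ?rhs
    using continuous_map_compose[OF c continuous_coord] by (auto simp: o_def continuous_map_def)
next
  assume r: ?rhs
  have "limitin F f (f x) (atin X x)" if x: "x \<in> topspace X" for x
  proof -
    have "\<forall>\<^sub>F y in atin X x. f y \<in> topspace F"
      using x r by (auto simp: eventually_atin Pi_iff intro!: exI[of _ "topspace X"])
    moreover have "((\<lambda>y. l (f y)) \<longlongrightarrow> l (f x)) (atin X x)" if "l \<in> L" for l
      using r that x by (simp add: continuous_map_atin)
    ultimately show ?thesis using x r by (auto simp: limitin_iff)
  qed
  then show ?lhs by (simp add: continuous_map_atin)
qed

lemma coord_eqI:
  assumes "x \<in> topspace F" "y \<in> topspace F" "\<And>l. l \<in> L \<Longrightarrow> l x = l y"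
  shows "x = y"
proof -
  have "x - y \<in> topspace F" using subspace_topspace assms by (simp add: subspace_diff)
  moreover have "l (x - y) = 0" if "l \<in> L" for l
    using assms(3)[OF that] linear_diff[OF linear_coord[OF that]] by simp
  ultimately show ?thesis using coord_separate by fastforce
qed

text \<open>
  Each coordinate of a directional derivative is an ordinary derivative of a real function. The
  quotients must moreover lie in \<open>F\<close> eventually, as \<open>F\<close> may be a proper subspace of the ambient
  vector space.
\<close>
lemma has_dir_deriv_iff:
  "has_dir_deriv F S f x v w \<longleftrightarrow> w \<in> topspace F \<and>
    (\<forall>\<^sub>F h in at 0 within {h. x + h *\<^sub>R v \<in> S}. (f (x + h *\<^sub>R v) - f x) /\<^sub>R h \<in> topspace F) \<and>
    (\<forall>l\<in>L. ((\<lambda>h. l (f (x + h *\<^sub>R v))) has_real_derivative l w) (at 0 within {h. x + h *\<^sub>R v \<in> S}))"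
proof -
  have "((\<lambda>h. l ((f (x + h *\<^sub>R v) - f x) /\<^sub>R h)) \<longlongrightarrow> l w) (at 0 within T) \<longleftrightarrow>
    ((\<lambda>h. l (f (x + h *\<^sub>R v))) has_real_derivative l w) (at 0 within T)" if "l \<in> L" for l T
    using linear_coord[OF that]
    by (simp add: has_field_derivative_iff linear_diff linear_scale divide_inverse mult.commute)
  then show ?thesis by (simp add: has_dir_deriv_def limitin_iff)
qed

lemma quotient_in_topspace:
  assumes "f \<in> S \<rightarrow> topspace F" "x \<in> S"
  shows "\<forall>\<^sub>F h in at 0 within {h. x + h *\<^sub>R v \<in> S}. (f (x + h *\<^sub>R v) - f x) /\<^sub>R h \<in> topspace F"
proof -
  have "(f (x + h *\<^sub>R v) - f x) /\<^sub>R h \<in> topspace F" if "x + h *\<^sub>R v \<in> S" for h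
    using that assms subspace_topspace by (intro subspace_scale subspace_diff) auto
  then show ?thesis by (simp add: eventually_at_filter)
qed

lemma dir_deriv_eq:
  assumes "has_dir_deriv F S f x v w" and "at 0 within {h. x + h *\<^sub>R v \<in> S} \<noteq> bot"
  shows "dir_deriv F S f x v = w"
  unfolding dir_deriv_def
proof (rule the_equality)
  show "has_dir_deriv F S f x v w" by fact
  fix w' assume w': "has_dir_deriv F S f x v w'"
  show "w' = w"
  proof (rule coord_eqI)
    fix l assume "l \<in> L"
    have "((\<lambda>h. l ((f (x + h *\<^sub>R v) - f x) /\<^sub>R h)) \<longlongrightarrow> l w) (at 0 within {h. x + h *\<^sub>R v \<in> S})"
      "((\<lambda>h. l ((f (x + h *\<^sub>R v) - f x) /\<^sub>R h)) \<longlongrightarrow> l w') (at 0 within {h. x + h *\<^sub>R v \<in> S})"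
      using assms(1) w' \<open>l \<in> L\<close> by (simp_all add: has_dir_deriv_def limitin_iff)
    then show "l w' = l w" using assms(2) tendsto_unique by blast
  qed (use assms(1) w' in \<open>auto simp: has_dir_deriv_iff\<close>)
qed

end

lemma open_line_preimage:
  fixes x v :: "'v::real_normed_vector"
  assumes "open U"
  shows "open {h. x + h *\<^sub>R v \<in> U}"
  using open_vimage[OF assms, of "\<lambda>h. x + h *\<^sub>R v"]
  by (simp add: vimage_def continuous_on_add continuous_on_scaleR)

lemma at_line_open:
  fixes x v :: "'v::real_normed_vector"
  assumes "open U" "x \<in> U"
  shows "at 0 within {h. x + h *\<^sub>R v \<in> U} = at 0"
  using open_line_preimage[OF assms(1)] assms(2) by (intro at_within_open) auto

lemma has_dir_deriv_cong:
  assumes "\<And>y. y \<in> S \<Longrightarrow> f y = g y" "x \<in> S"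
  shows "has_dir_deriv F S f x v w \<longleftrightarrow> has_dir_deriv F S g x v w"
proof -
  have "\<forall>\<^sub>F h in at 0 within {h. x + h *\<^sub>R v \<in> S}.
      (f (x + h *\<^sub>R v) - f x) /\<^sub>R h = (g (x + h *\<^sub>R v) - g x) /\<^sub>R h"
    using assms by (simp add: eventually_at_filter)
  then have "(\<forall>\<^sub>F h in at 0 within {h. x + h *\<^sub>R v \<in> S}. (f (x + h *\<^sub>R v) - f x) /\<^sub>R h \<in> U) \<longleftrightarrow>
      (\<forall>\<^sub>F h in at 0 within {h. x + h *\<^sub>R v \<in> S}. (g (x + h *\<^sub>R v) - g x) /\<^sub>R h \<in> U)" for U
    by (rule eventually_cong) auto
  then show ?thesis by (simp add: has_dir_deriv_def limitin_def)
qed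

lemma dir_deriv_cong:
  assumes "\<And>y. y \<in> S \<Longrightarrow> f y = g y" "x \<in> S"
  shows "dir_deriv F S f x v = dir_deriv F S g x v"
  using has_dir_deriv_cong[of S f g x F v] assms by (simp add: dir_deriv_def)

lemma iter_dir_deriv_cong:
  assumes "\<And>y. y \<in> S \<Longrightarrow> f y = g y" "x \<in> S"
  shows "iter_dir_deriv F S f vs x = iter_dir_deriv F S g vs x"
  using assms(2)
proof (induction vs arbitrary: x)
  case (Cons v vs)
  then show ?case
    using dir_deriv_cong[of S "iter_dir_deriv F S f vs" "iter_dir_deriv F S g vs" x F v] by simp
qed (use assms in simp)

lemma iter_dir_deriv_snoc:
  "iter_dir_deriv F S f (vs @ [v]) = iter_dir_deriv F S (\<lambda>x. dir_deriv F S f x v) vs"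
  by (induction vs) auto

context coordinates
begin

lemma has_dir_deriv_open_iff:
  fixes x v :: "'v::real_normed_vector"
  assumes "open U" "x \<in> U" "f \<in> U \<rightarrow> topspace F"
  shows "has_dir_deriv F U f x v w \<longleftrightarrow>
    w \<in> topspace F \<and> (\<forall>l\<in>L. ((\<lambda>h. l (f (x + h *\<^sub>R v))) has_real_derivative l w) (at 0))"
  using quotient_in_topspace[OF assms(3,2), of v] at_line_open[OF assms(1,2), of v]
  by (simp add: has_dir_deriv_iff)

lemma dir_deriv_eq_open:
  fixes x v :: "'v::real_normed_vector"
  assumes "open U" "x \<in> U" "has_dir_deriv F U f x v w"
  shows "dir_deriv F U f x v = w"
  using assms at_line_open[OF assms(1,2), of v] by (intro dir_deriv_eq) auto

end


section \<open>Functions that are k times continuously differentiable\<close>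

text \<open>
  \<open>Ck F U k f\<close> states that \<open>f\<close> is \<open>k\<close> times continuously differentiable on the subset \<open>U\<close> of a Euclidean
  space. The continuous partial derivatives \<open>D b\<close> are required to span all directional derivatives.
  In calculus this follows from the mean value theorem; as a part of the definition it is
  inherited by sums, products and compositions, and it makes the dependence on the directions
  explicit, from which joint continuity is read off.
\<close>
primrec Ck :: "'w::real_vector topology \<Rightarrow> 'v::euclidean_space set \<Rightarrow> nat \<Rightarrow> ('v \<Rightarrow> 'w) \<Rightarrow> bool"
  where
    "Ck F U 0 f \<longleftrightarrow> continuous_map (top_of_set U) F f"
  | "Ck F U (Suc k) f \<longleftrightarrow> continuous_map (top_of_set U) F f \<and>
      (\<exists>D. (\<forall>b\<in>Basis. Ck F U k (D b)) \<and>
           (\<forall>x\<in>U. \<forall>v. has_dir_deriv F U f x v (\<Sum>b\<in>Basis. (v \<bullet> b) *\<^sub>R D b x)))"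

lemma Ck_continuous: "Ck F U k f \<Longrightarrow> continuous_map (top_of_set U) F f"
  by (cases k) auto

lemma Ck_pred: "Ck F U (Suc k) f \<Longrightarrow> Ck F U k f"
proof (induction k arbitrary: f)
  case (Suc k)
  obtain D where "\<forall>b\<in>Basis. Ck F U (Suc k) (D b)"
      "\<forall>x\<in>U. \<forall>v. has_dir_deriv F U f x v (\<Sum>b\<in>Basis. (v \<bullet> b) *\<^sub>R D b x)"
    using Suc.prems unfolding Ck.simps(2)[of F U "Suc k" f] by blast
  then have "\<exists>D. (\<forall>b\<in>Basis. Ck F U k (D b)) \<and>
      (\<forall>x\<in>U. \<forall>v. has_dir_deriv F U f x v (\<Sum>b\<in>Basis. (v \<bullet> b) *\<^sub>R D b x))"
    using Suc.IH by blast
  then show ?case using Ck_continuous[OF Suc.prems] by simp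
qed simp

lemma Ck_cong:
  assumes "\<And>y. y \<in> U \<Longrightarrow> f y = g y" and "Ck F U k f"
  shows "Ck F U k g"
proof -
  have cont: "continuous_map (top_of_set U) F g"
    using Ck_continuous[OF assms(2)] assms(1) by (auto intro: continuous_map_eq)
  have deriv: "has_dir_deriv F U g x v w" if "has_dir_deriv F U f x v w" "x \<in> U" for x v w
    using that has_dir_deriv_cong[of U f g x] assms(1) by blast
  show ?thesis
  proof (cases k)
    case (Suc j)
    then obtain D where "\<forall>b\<in>Basis. Ck F U j (D b)"
        "\<forall>x\<in>U. \<forall>v. has_dir_deriv F U f x v (\<Sum>b\<in>Basis. (v \<bullet> b) *\<^sub>R D b x)"
      using assms(2) by auto
    then show ?thesis using cont deriv Suc by auto
  qed (use cont in simp)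
qed

lemma Ck_subset:
  assumes "Ck F U k f" "V \<subseteq> U"
  shows "Ck F V k f"
  using assms(1)
proof (induction k arbitrary: f)
  case 0
  then show ?case using assms(2) continuous_map_from_subtopology_mono by auto
next
  case (Suc k)
  have "has_dir_deriv F V f x v w" if "has_dir_deriv F U f x v w" for x v w
    using that assms(2) unfolding has_dir_deriv_def limitin_def
    by (auto elim!: filter_leD[OF at_le, rotated])
  note deriv = this
  obtain D where D: "\<forall>b\<in>Basis. Ck F U k (D b)"
      "\<forall>x\<in>U. \<forall>v. has_dir_deriv F U f x v (\<Sum>b\<in>Basis. (v \<bullet> b) *\<^sub>R D b x)"
    using Suc.prems by auto
  have "\<exists>D. (\<forall>b\<in>Basis. Ck F V k (D b)) \<and>
      (\<forall>x\<in>V. \<forall>v. has_dir_deriv F V f x v (\<Sum>b\<in>Basis. (v \<bullet> b) *\<^sub>R D b x))"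
    using D Suc.IH deriv assms(2) by (intro exI[of _ D]) blast
  moreover have "continuous_map (top_of_set V) F f"
    using Ck_continuous[OF Suc.prems] assms(2) continuous_map_from_subtopology_mono by blast
  ultimately show ?case by simp
qed

context coordinates
begin

lemma continuous_map_add:
  assumes "continuous_map X F f" "continuous_map X F g"
  shows "continuous_map X F (\<lambda>x. f x + g x)"
proof -
  have "continuous_map X euclideanreal (\<lambda>x. l (f x) + l (g x))" if "l \<in> L" for l
    using assms that by (intro continuous_map_add) (auto simp: continuous_map_coordinates)
  then show ?thesis
    using assms subspace_topspace
    by (auto simp: continuous_map_coordinates Pi_iff subspace_add linear_add[OF linear_coord])
qed

lemma continuous_map_scaleR:
  assumes "continuous_map X euclideanreal c" "continuous_map X F f"
  shows "continuous_map X F (\<lambda>x. c x *\<^sub>R f x)"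
proof -
  have "continuous_map X euclideanreal (\<lambda>x. c x * l (f x))" if "l \<in> L" for l
    using assms that by (intro continuous_map_real_mult) (auto simp: continuous_map_coordinates)
  then show ?thesis
    using assms subspace_topspace
    by (auto simp: continuous_map_coordinates Pi_iff subspace_scale linear_scale[OF linear_coord])
qed

lemma continuous_map_sum:
  assumes "\<And>i. i \<in> I \<Longrightarrow> continuous_map X F (f i)"
  shows "continuous_map X F (\<lambda>x. \<Sum>i\<in>I. f i x)"
proof (cases "finite I")
  case True
  then show ?thesis using assms
    by (induction I) (auto intro!: continuous_map_add simp: zero_in_topspace)
qed (simp add: zero_in_topspace)

end

interpretation real_coords: coordinates euclideanreal "{\<lambda>x. x}"
proof
  fix U :: "real set" and x assume "openin euclideanreal U" "x \<in> U"
  then obtain e where "e > 0" "ball x e \<subseteq> U" by (metis open_contains_ball open_openin)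
  then have "e > 0 \<and> (\<forall>y. (\<forall>l\<in>{\<lambda>x. x}. \<bar>l y - l x\<bar> < e) \<longrightarrow> y \<in> U)"
    by (auto simp: subset_iff dist_real_def abs_minus_commute)
  then show "\<exists>K e. finite K \<and> K \<subseteq> {\<lambda>x. x} \<and> e > 0 \<and>
      (\<forall>y\<in>topspace euclideanreal. (\<forall>l\<in>K. \<bar>l y - l x\<bar> < e) \<longrightarrow> y \<in> U)"
    by (intro exI[of _ "{\<lambda>x. x}"] exI[of _ e]) auto
qed (auto simp: linear_ident)

lemma has_dir_deriv_real_iff:
  fixes x v :: "'v::real_normed_vector"
  assumes "open U" "x \<in> U"
  shows "has_dir_deriv euclideanreal U f x v w \<longleftrightarrow> ((\<lambda>h. f (x + h *\<^sub>R v)) has_real_derivative w) (at 0)"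
  using real_coords.has_dir_deriv_open_iff[OF assms, of f v w] by simp

context coordinates
begin

lemma Ck_maps: "Ck F U k f \<Longrightarrow> f \<in> U \<rightarrow> topspace F"
  using Ck_continuous by (fastforce simp: continuous_map_def)

lemma Ck_const:
  assumes "open U" "c \<in> topspace F"
  shows "Ck F U k (\<lambda>_. c)"
  using assms(2)
proof (induction k arbitrary: c)
  case (Suc k)
  have "has_dir_deriv F U (\<lambda>_. c) x v (\<Sum>b\<in>Basis. (v \<bullet> b) *\<^sub>R 0)" if "x \<in> U" for x v
    using that assms(1) Suc.prems by (subst has_dir_deriv_open_iff)
      (auto simp: zero_in_topspace linear_0[OF linear_coord])
  then show ?case
    using Suc.IH[OF zero_in_topspace] Suc.prems by (auto intro!: exI[of _ "\<lambda>_ _. 0"])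
qed simp

lemma Ck_add:
  assumes "open U" "Ck F U k f" "Ck F U k g"
  shows "Ck F U k (\<lambda>x. f x + g x)"
  using assms(2,3)
proof (induction k arbitrary: f g)
  case 0
  then show ?case by (simp add: continuous_map_add)
next
  case (Suc k)
  obtain D where D: "\<And>b. b \<in> Basis \<Longrightarrow> Ck F U k (D b)"
      "\<And>x v. x \<in> U \<Longrightarrow> has_dir_deriv F U f x v (\<Sum>b\<in>Basis. (v \<bullet> b) *\<^sub>R D b x)"
    using Suc.prems(1) by auto
  obtain D' where D': "\<And>b. b \<in> Basis \<Longrightarrow> Ck F U k (D' b)"
      "\<And>x v. x \<in> U \<Longrightarrow> has_dir_deriv F U g x v (\<Sum>b\<in>Basis. (v \<bullet> b) *\<^sub>R D' b x)"
    using Suc.prems(2) by auto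
  have cont: "continuous_map (top_of_set U) F (\<lambda>x. f x + g x)"
    using Suc.prems by (intro continuous_map_add Ck_continuous)
  have "has_dir_deriv F U (\<lambda>x. f x + g x) x v (\<Sum>b\<in>Basis. (v \<bullet> b) *\<^sub>R (D b x + D' b x))"
    if x: "x \<in> U" for x v
  proof -
    have "has_dir_deriv F U (\<lambda>x. f x + g x) x v
        ((\<Sum>b\<in>Basis. (v \<bullet> b) *\<^sub>R D b x) + (\<Sum>b\<in>Basis. (v \<bullet> b) *\<^sub>R D' b x))"
      using D(2)[OF x, of v] D'(2)[OF x, of v] x assms(1) Ck_maps[OF Suc.prems(1)]
        Ck_maps[OF Suc.prems(2)] subspace_topspace
      by (auto simp: has_dir_deriv_open_iff Pi_iff subspace_add linear_add[OF linear_coord]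
        intro: DERIV_add)
    then show ?thesis by (simp add: scaleR_add_right sum.distrib)
  qed
  then show ?case
    using cont D(1) D'(1) Suc.IH by (auto intro!: exI[of _ "\<lambda>b x. D b x + D' b x"])
qed

lemma Ck_sum:
  assumes "open U" "\<And>i. i \<in> I \<Longrightarrow> Ck F U k (f i)"
  shows "Ck F U k (\<lambda>x. \<Sum>i\<in>I. f i x)"
proof (cases "finite I")
  case True
  then show ?thesis using assms(2)
    by (induction I) (auto intro!: Ck_add Ck_const assms(1) simp: zero_in_topspace)
qed (simp add: zero_in_topspace Ck_const assms(1))

lemma Ck_scaleR:
  assumes "open U" "Ck euclideanreal U k c" "Ck F U k f"
  shows "Ck F U k (\<lambda>x. c x *\<^sub>R f x)"
  using assms(2,3)
proof (induction k arbitrary: c f)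
  case 0
  then show ?case by (simp add: continuous_map_scaleR)
next
  case (Suc k)
  obtain C where C: "\<And>b. b \<in> Basis \<Longrightarrow> Ck euclideanreal U k (C b)"
      "\<And>x v. x \<in> U \<Longrightarrow> has_dir_deriv euclideanreal U c x v (\<Sum>b\<in>Basis. (v \<bullet> b) *\<^sub>R C b x)"
    using Suc.prems(1) by auto
  obtain D where D: "\<And>b. b \<in> Basis \<Longrightarrow> Ck F U k (D b)"
      "\<And>x v. x \<in> U \<Longrightarrow> has_dir_deriv F U f x v (\<Sum>b\<in>Basis. (v \<bullet> b) *\<^sub>R D b x)"
    using Suc.prems(2) by auto
  have cont: "continuous_map (top_of_set U) F (\<lambda>x. c x *\<^sub>R f x)"
    using Suc.prems by (intro continuous_map_scaleR Ck_continuous)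
  have "has_dir_deriv F U (\<lambda>x. c x *\<^sub>R f x) x v
      (\<Sum>b\<in>Basis. (v \<bullet> b) *\<^sub>R (C b x *\<^sub>R f x + c x *\<^sub>R D b x))" if x: "x \<in> U" for x v
  proof -
    let ?C = "\<Sum>b\<in>Basis. (v \<bullet> b) *\<^sub>R C b x" and ?D = "\<Sum>b\<in>Basis. (v \<bullet> b) *\<^sub>R D b x"
    have dc: "((\<lambda>h. c (x + h *\<^sub>R v)) has_real_derivative ?C) (at 0)"
      using C(2)[OF x] has_dir_deriv_real_iff[OF assms(1) x] by blast
    have df: "?D \<in> topspace F"
        "\<And>l. l \<in> L \<Longrightarrow> ((\<lambda>h. l (f (x + h *\<^sub>R v))) has_real_derivative l ?D) (at 0)"
      using D(2)[OF x, of v] has_dir_deriv_open_iff[OF assms(1) x Ck_maps[OF Suc.prems(2)]] by blast+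
    have "((\<lambda>h. c (x + h *\<^sub>R v) * l (f (x + h *\<^sub>R v))) has_real_derivative
        ?C * l (f x) + l ?D * c x) (at 0)" if "l \<in> L" for l
      using DERIV_mult[OF dc df(2)[OF that]] by simp
    moreover have "(\<lambda>x. c x *\<^sub>R f x) \<in> U \<rightarrow> topspace F" "?C *\<^sub>R f x + c x *\<^sub>R ?D \<in> topspace F"
      using subspace_topspace Ck_maps[OF Suc.prems(2)] df(1) x
      by (auto intro!: subspace_add subspace_scale)
    ultimately have "has_dir_deriv F U (\<lambda>x. c x *\<^sub>R f x) x v (?C *\<^sub>R f x + c x *\<^sub>R ?D)"
      using has_dir_deriv_open_iff[OF assms(1) x, of "\<lambda>x. c x *\<^sub>R f x"]
      by (simp add: linear_add[OF linear_coord] linear_scale[OF linear_coord] mult.commute)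
    also have "?C *\<^sub>R f x + c x *\<^sub>R ?D = (\<Sum>b\<in>Basis. (v \<bullet> b) *\<^sub>R (C b x *\<^sub>R f x + c x *\<^sub>R D b x))"
      by (simp add: scaleR_add_right sum.distrib scaleR_sum_right scaleR_sum_left mult.commute)
    finally show ?thesis .
  qed
  moreover have "Ck F U k (\<lambda>x. C b x *\<^sub>R f x + c x *\<^sub>R D b x)" if "b \<in> Basis" for b
    using C(1)[OF that] D(1)[OF that] Suc.prems[THEN Ck_pred]
    by (intro Ck_add[OF assms(1)] Suc.IH)
  ultimately show ?case
    using cont by (auto intro!: exI[of _ "\<lambda>b x. C b x *\<^sub>R f x + c x *\<^sub>R D b x"])
qed

text \<open>
  One variable suffices for \<open>g\<close>, because all curves to be reparametrized are functions of the
  angle. By the chain rule the partial derivatives are products \<open>C b x *\<^sub>R D 1 (u x)\<close>, which are again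
  of the form covered by the induction hypothesis and \<open>Ck_scaleR\<close>.
\<close>
lemma Ck_compose_real:
  fixes g :: "real \<Rightarrow> 'w"
  assumes "open A" "open U" "Ck F A k g" "Ck euclideanreal U k u" "u \<in> U \<rightarrow> A"
  shows "Ck F U k (\<lambda>x. g (u x))"
  using assms(3,4)
proof (induction k arbitrary: g)
  case 0
  have "continuous_map (top_of_set U) (top_of_set A) u"
    using 0(2) assms(5) by (auto simp: continuous_map_in_subtopology)
  then show ?case using continuous_map_compose[OF _ 0(1)[simplified], of _ u] by (simp add: o_def)
next
  case (Suc k)
  obtain C where C: "\<And>b. b \<in> Basis \<Longrightarrow> Ck euclideanreal U k (C b)"
      "\<And>x v. x \<in> U \<Longrightarrow> has_dir_deriv euclideanreal U u x v (\<Sum>b\<in>Basis. (v \<bullet> b) *\<^sub>R C b x)"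
    using Suc.prems(2) by auto
  obtain D where D: "Ck F A k (D 1)"
      "\<And>x v. x \<in> A \<Longrightarrow> has_dir_deriv F A g x v (v *\<^sub>R D 1 x)"
    using Suc.prems(1) by auto
  have "continuous_map (top_of_set U) (top_of_set A) u"
    using Ck_continuous[OF Suc.prems(2)] assms(5) by (auto simp: continuous_map_in_subtopology)
  then have cont: "continuous_map (top_of_set U) F (\<lambda>x. g (u x))"
    using continuous_map_compose[OF _ Ck_continuous[OF Suc.prems(1)], of _ u] by (simp add: o_def)
  have "has_dir_deriv F U (\<lambda>x. g (u x)) x v (\<Sum>b\<in>Basis. (v \<bullet> b) *\<^sub>R (C b x *\<^sub>R D 1 (u x)))"
    if x: "x \<in> U" for x v
  proof -
    let ?C = "\<Sum>b\<in>Basis. (v \<bullet> b) *\<^sub>R C b x"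
    have ux: "u x \<in> A" using x assms(5) by blast
    have du: "((\<lambda>h. u (x + h *\<^sub>R v)) has_real_derivative ?C) (at 0)"
      using C(2)[OF x] has_dir_deriv_real_iff[OF assms(2) x] by blast
    have dg: "D 1 (u x) \<in> topspace F"
        "\<And>l. l \<in> L \<Longrightarrow> ((\<lambda>h. l (g (u x + h))) has_real_derivative l (D 1 (u x))) (at 0)"
      using D(2)[OF ux, of 1] has_dir_deriv_open_iff[OF assms(1) ux Ck_maps[OF Suc.prems(1)], of 1]
      by auto
    have "((\<lambda>h. l (g (u (x + h *\<^sub>R v)))) has_real_derivative l (D 1 (u x)) * ?C) (at 0)"
      if "l \<in> L" for l
      using DERIV_chain2[OF _ du, of "\<lambda>y. l (g y)"] dg(2)[OF that] DERIV_shift[of "\<lambda>y. l (g y)" _ 0 "u x"]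
      by (simp add: add.commute)
    moreover have "(\<lambda>x. g (u x)) \<in> U \<rightarrow> topspace F" "?C *\<^sub>R D 1 (u x) \<in> topspace F"
      using subspace_topspace Ck_maps[OF Suc.prems(1)] dg(1) assms(5)
      by (auto intro!: subspace_scale)
    ultimately have "has_dir_deriv F U (\<lambda>x. g (u x)) x v (?C *\<^sub>R D 1 (u x))"
      using has_dir_deriv_open_iff[OF assms(2) x, of "\<lambda>x. g (u x)"]
      by (simp add: linear_scale[OF linear_coord] mult.commute)
    then show ?thesis by (simp add: scaleR_sum_left)
  qed
  moreover have "Ck F U k (\<lambda>x. C b x *\<^sub>R D 1 (u x))" if "b \<in> Basis" for b
    using Suc.IH[OF D(1) Ck_pred[OF Suc.prems(2)]] C(1)[OF that] by (intro Ck_scaleR assms(2))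
  ultimately show ?case
    using cont by (auto intro!: exI[of _ "\<lambda>b x. C b x *\<^sub>R D 1 (u x)"])
qed

end

lemma Ck_inner:
  fixes b :: "'v::euclidean_space"
  assumes "open U"
  shows "Ck euclideanreal U k (\<lambda>x. x \<bullet> b)"
proof (cases k)
  case 0
  then show ?thesis by (auto intro!: continuous_intros)
next
  case (Suc j)
  have "has_dir_deriv euclideanreal U (\<lambda>x. x \<bullet> b) x v (\<Sum>b'\<in>Basis. (v \<bullet> b') *\<^sub>R (b' \<bullet> b))"
    if "x \<in> U" for x v
  proof -
    have "(\<Sum>b'\<in>Basis. (v \<bullet> b') *\<^sub>R (b' \<bullet> b)) = v \<bullet> b"
      unfolding euclidean_inner[of v b] by (simp add: inner_commute[of b])
    moreover have "((\<lambda>h. (x + h *\<^sub>R v) \<bullet> b) has_real_derivative v \<bullet> b) (at 0)"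
      by (auto intro!: derivative_eq_intros simp: inner_add_left)
    ultimately show ?thesis using has_dir_deriv_real_iff[OF assms that] by simp
  qed
  then show ?thesis using Suc real_coords.Ck_const[OF assms]
    by (auto intro!: continuous_intros exI[of _ "\<lambda>b' x. b' \<bullet> b"])
qed

lemma Ck_id: "Ck euclideanreal UNIV k (\<lambda>x::real. x)"
  using Ck_inner[of UNIV k "1::real"] by simp

lemma Ck_real_SucI:
  fixes f :: "real \<Rightarrow> real"
  assumes "open U" "\<And>x. x \<in> U \<Longrightarrow> (f has_real_derivative f' x) (at x)" "Ck euclideanreal U k f'"
  shows "Ck euclideanreal U (Suc k) f"
proof -
  have "has_dir_deriv euclideanreal U f x v (v * f' x)" if x: "x \<in> U" for x v
  proof -
    have "((\<lambda>h. f (x + h * v)) has_real_derivative f' x * v) (at 0)"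
      using assms(2)[OF x]
      by (intro DERIV_chain2[of f]) (auto intro!: derivative_eq_intros)
    then show ?thesis using has_dir_deriv_real_iff[OF assms(1) x] by (simp add: mult.commute)
  qed
  moreover have "continuous_on U f"
    using assms(2) by (meson DERIV_isCont continuous_at_imp_continuous_on)
  ultimately show ?thesis using assms(3) by (auto intro!: exI[of _ "\<lambda>_. f'"])
qed

lemma Ck_sin_cos: "Ck euclideanreal UNIV k (sin :: real \<Rightarrow> real) \<and> Ck euclideanreal UNIV k (cos :: real \<Rightarrow> real)"
proof (induction k)
  case (Suc k)
  have "Ck euclideanreal UNIV k (\<lambda>x::real. - sin x)"
    using real_coords.Ck_scaleR[of UNIV k "\<lambda>_. -1" sin] Suc real_coords.Ck_const[of UNIV "-1" k] by simp
  then show ?case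
    using Suc by (auto intro!: Ck_real_SucI derivative_eq_intros simp del: Ck.simps)
qed (auto intro!: continuous_intros)


section \<open>Comparison with smoothness in the sense of iterated directional derivatives\<close>

context coordinates
begin

lemma has_dir_deriv_sum:
  fixes x v :: "'v::real_normed_vector"
  assumes "open U" "x \<in> U" "\<And>i. i \<in> I \<Longrightarrow> f i \<in> U \<rightarrow> topspace F"
    and "\<And>i. i \<in> I \<Longrightarrow> has_dir_deriv F U (f i) x v (w i)"
  shows "has_dir_deriv F U (\<lambda>y. \<Sum>i\<in>I. c i *\<^sub>R f i y) x v (\<Sum>i\<in>I. c i *\<^sub>R w i)"
proof -
  have "(\<lambda>y. \<Sum>i\<in>I. c i *\<^sub>R f i y) \<in> U \<rightarrow> topspace F"
    using assms(3) subspace_topspace by (auto intro!: subspace_sum subspace_scale)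
  moreover have "(\<Sum>i\<in>I. c i *\<^sub>R w i) \<in> topspace F"
    using assms(4) subspace_topspace by (auto simp: has_dir_deriv_iff intro!: subspace_sum subspace_scale)
  moreover have "((\<lambda>h. \<Sum>i\<in>I. c i * l (f i (x + h *\<^sub>R v))) has_real_derivative (\<Sum>i\<in>I. c i * l (w i))) (at 0)"
    if "l \<in> L" for l
    using assms(3,4) that by (intro DERIV_sum DERIV_cmult) (simp add: has_dir_deriv_open_iff[OF assms(1,2)])
  ultimately show ?thesis
    by (simp add: has_dir_deriv_open_iff[OF assms(1,2)] linear_sum[OF linear_coord] linear_scale[OF linear_coord])
qed

text \<open>
  The partial derivatives provided by \<open>Ck\<close> for different orders coincide, as directional derivatives
  are unique. So a function that is differentiable to every order has partial derivatives that are.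
\<close>
lemma partials:
  fixes U :: "'v::euclidean_space set"
  assumes "open U" "\<And>k. Ck F U k f"
  obtains D where "\<And>b k. b \<in> Basis \<Longrightarrow> Ck F U k (D b)"
    and "\<And>x v. x \<in> U \<Longrightarrow> has_dir_deriv F U f x v (\<Sum>b\<in>Basis. (v \<bullet> b) *\<^sub>R D b x)"
proof -
  have partial: "dir_deriv F U f x b = D b x"
    if "\<And>x v. x \<in> U \<Longrightarrow> has_dir_deriv F U f x v (\<Sum>b\<in>Basis. (v \<bullet> b) *\<^sub>R D b x)" "x \<in> U" "b \<in> Basis"
    for D x b
  proof -
    have "(\<Sum>b'\<in>Basis. (b \<bullet> b') *\<^sub>R D b' x) = (\<Sum>b'\<in>Basis. if b' = b then D b x else 0)"
      using that(3) by (intro sum.cong) (auto simp: inner_Basis)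
    then show ?thesis
      using dir_deriv_eq_open[OF assms(1) that(2) that(1)[OF that(2), of b]] that(3) by simp
  qed
  obtain D where D: "\<And>x v. x \<in> U \<Longrightarrow> has_dir_deriv F U f x v (\<Sum>b\<in>Basis. (v \<bullet> b) *\<^sub>R D b x)"
    using assms(2)[of "Suc 0"] by auto
  have "Ck F U k (D b)" if "b \<in> Basis" for b k
  proof -
    obtain D' where D': "Ck F U k (D' b)"
      "\<And>x v. x \<in> U \<Longrightarrow> has_dir_deriv F U f x v (\<Sum>b\<in>Basis. (v \<bullet> b) *\<^sub>R D' b x)"
      using assms(2)[of "Suc k"] \<open>b \<in> Basis\<close> by auto
    show ?thesis
      using D'(1) by (rule Ck_cong[rotated]) (metis partial[OF D _ that] partial[OF D'(2) _ that])
  qed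
  then show thesis using D by (rule that)
qed

lemma Ck_dir_deriv:
  fixes U :: "'v::euclidean_space set"
  assumes "open U" "\<And>k. Ck F U k f"
  shows "Ck F U k (\<lambda>x. dir_deriv F U f x v)"
proof -
  obtain D where D: "\<And>b k. b \<in> Basis \<Longrightarrow> Ck F U k (D b)"
    "\<And>x v. x \<in> U \<Longrightarrow> has_dir_deriv F U f x v (\<Sum>b\<in>Basis. (v \<bullet> b) *\<^sub>R D b x)"
    using partials[OF assms] by metis
  have "Ck F U k (\<lambda>x. \<Sum>b\<in>Basis. (v \<bullet> b) *\<^sub>R D b x)"
    using D(1) by (intro Ck_sum Ck_scaleR assms(1) real_coords.Ck_const) auto
  then show ?thesis
    by (rule Ck_cong[rotated]) (use dir_deriv_eq_open[OF assms(1) _ D(2)] in simp)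
qed

lemma Ck_iter_dir_deriv:
  fixes U :: "'v::euclidean_space set"
  assumes "open U" "\<And>k. Ck F U k f"
  shows "Ck F U k (iter_dir_deriv F U f vs)"
  by (induction vs arbitrary: k) (auto intro: assms(2) Ck_dir_deriv[OF assms(1)])

lemma has_dir_deriv_dir_deriv:
  fixes U :: "'v::euclidean_space set"
  assumes "open U" "\<And>k. Ck F U k f" "x \<in> U"
  shows "has_dir_deriv F U f x v (dir_deriv F U f x v)"
  using partials[OF assms(1,2)] dir_deriv_eq_open[OF assms(1,3)] assms(3) by metis

lemma iter_dir_deriv_sum:
  fixes U :: "'v::euclidean_space set"
  assumes "open U" "\<And>i k. i \<in> I \<Longrightarrow> Ck F U k (f i)" "x \<in> U"
  shows "iter_dir_deriv F U (\<lambda>x. \<Sum>i\<in>I. c i *\<^sub>R f i x) vs x = (\<Sum>i\<in>I. c i *\<^sub>R iter_dir_deriv F U (f i) vs x)"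
  using assms(3)
proof (induction vs arbitrary: x)
  case (Cons v vs)
  have "dir_deriv F U (iter_dir_deriv F U (\<lambda>x. \<Sum>i\<in>I. c i *\<^sub>R f i x) vs) x v
      = dir_deriv F U (\<lambda>x. \<Sum>i\<in>I. c i *\<^sub>R iter_dir_deriv F U (f i) vs x) x v"
    using Cons by (intro dir_deriv_cong) auto
  also have "\<dots> = (\<Sum>i\<in>I. c i *\<^sub>R dir_deriv F U (iter_dir_deriv F U (f i) vs) x v)"
    using assms(1,2) Cons.prems
    by (intro dir_deriv_eq_open has_dir_deriv_sum has_dir_deriv_dir_deriv Ck_iter_dir_deriv
        Ck_maps[of U 0]) auto
  finally show ?case by simp
qed simp

text \<open>
  The iterated derivative is multilinear in the directions, so it is a finite sum of products of
  components of the directions with iterated partial derivatives. The induction splits off the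
  direction in which \<open>f\<close> is differentiated first, which is the last one of the list: expanding it
  in the standard basis replaces \<open>f\<close> by its partial derivatives.
\<close>
lemma continuous_iter_dir_deriv:
  fixes U :: "'v::euclidean_space set"
  assumes "open U" "\<And>k. Ck F U k f"
  shows "continuous_map (prod_topology (top_of_set U) (product_topology (\<lambda>_. euclidean) {..<n})) F
    (\<lambda>(x, v). iter_dir_deriv F U f (map v [0..<n]) x)"
  using assms(2)
proof (induction n arbitrary: f)
  case 0
  have "continuous_map (prod_topology (top_of_set U) (product_topology (\<lambda>_. euclidean) {..<0::nat})) F (f \<circ> fst)"
    by (intro continuous_map_compose[OF continuous_map_fst] Ck_continuous[OF "0.prems"])
  then show ?case by (simp add: case_prod_unfold o_def)
next
  case (Suc n)
  let ?X = "prod_topology (top_of_set U) (product_topology (\<lambda>_. euclidean :: 'v topology) {..<Suc n})"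
  obtain D where D: "\<And>b k. b \<in> Basis \<Longrightarrow> Ck F U k (D b)"
    "\<And>x v. x \<in> U \<Longrightarrow> has_dir_deriv F U f x v (\<Sum>b\<in>Basis. (v \<bullet> b) *\<^sub>R D b x)"
    using partials[OF assms(1) Suc.prems] by metis
  have "continuous_map ?X F (\<lambda>z. iter_dir_deriv F U (D b) (map (snd z) [0..<n]) (fst z))"
    if b: "b \<in> Basis" for b
  proof -
    have "continuous_map ?X (product_topology (\<lambda>_. euclidean) {..<n}) (\<lambda>z. restrict (snd z) {..<n})"
      by (auto simp: continuous_map_componentwise extensional_def
          intro!: continuous_map_compose[OF continuous_map_snd continuous_map_product_projection, unfolded o_def])
    then have "continuous_map ?X (prod_topology (top_of_set U) (product_topology (\<lambda>_. euclidean) {..<n}))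
        (\<lambda>z. (fst z, restrict (snd z) {..<n}))"
      by (intro continuous_map_pairedI continuous_map_fst)
    from continuous_map_compose[OF this Suc.IH[OF D(1)[OF b]]]
    have "continuous_map ?X F (\<lambda>z. iter_dir_deriv F U (D b) (map (restrict (snd z) {..<n}) [0..<n]) (fst z))"
      by (simp only: o_def case_prod_unfold fst_conv snd_conv)
    moreover have "map (restrict v {..<n}) [0..<n] = map v [0..<n]" for v :: "nat \<Rightarrow> 'v"
      by (intro map_cong) auto
    ultimately show ?thesis by (simp only:)
  qed
  then have "continuous_map ?X F (\<lambda>z. \<Sum>b\<in>Basis. (snd z n \<bullet> b) *\<^sub>R
      iter_dir_deriv F U (D b) (map (snd z) [0..<n]) (fst z))"
  proof (intro continuous_map_sum continuous_map_scaleR)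
    fix b :: 'v
    have "continuous_map ?X euclidean (\<lambda>z. snd z n)"
      by (intro continuous_map_compose[OF continuous_map_snd continuous_map_product_projection, unfolded o_def]) simp
    from continuous_map_compose[OF this, of euclideanreal "\<lambda>v. v \<bullet> b"]
    show "continuous_map ?X euclideanreal (\<lambda>z. snd z n \<bullet> b)"
      by (simp add: o_def continuous_intros)
  qed
  moreover have "iter_dir_deriv F U f (map v [0..<Suc n]) x =
      (\<Sum>b\<in>Basis. (v n \<bullet> b) *\<^sub>R iter_dir_deriv F U (D b) (map v [0..<n]) x)" if x: "x \<in> U" for x v
  proof -
    have "iter_dir_deriv F U f (map v [0..<Suc n]) x
        = iter_dir_deriv F U (\<lambda>x. \<Sum>b\<in>Basis. (v n \<bullet> b) *\<^sub>R D b x) (map v [0..<n]) x"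
      using dir_deriv_eq_open[OF assms(1) _ D(2)] x
      by (auto simp: iter_dir_deriv_snoc intro!: iter_dir_deriv_cong)
    then show ?thesis using iter_dir_deriv_sum[OF assms(1) D(1) x] by simp
  qed
  ultimately show ?case
    by (auto intro!: continuous_map_eq[of ?X F "\<lambda>z. \<Sum>b\<in>Basis. (snd z n \<bullet> b) *\<^sub>R
      iter_dir_deriv F U (D b) (map (snd z) [0..<n]) (fst z)"] simp del: upt_Suc)
qed

lemma smooth_onI:
  fixes U :: "'v::euclidean_space set"
  assumes "open U" "\<And>k. Ck F U k f"
  shows "smooth_on euclidean F U f"
proof -
  have "has_dir_deriv F U (iter_dir_deriv F U f vs) x v
      (dir_deriv F U (iter_dir_deriv F U f vs) x v)" if "x \<in> U" for vs x v
    using assms that by (intro has_dir_deriv_dir_deriv Ck_iter_dir_deriv)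
  then show ?thesis
    using assms(1) continuous_iter_dir_deriv[OF assms] unfolding smooth_on_def
    by simp blast
qed

text \<open>
  In one variable, the derivative in direction \<open>v\<close> is \<open>v\<close> times the derivative in direction \<open>1\<close>, so
  the iterated derivatives in direction \<open>1\<close> can serve as the partial derivatives.
\<close>
lemma Ck_of_smooth_on:
  fixes A :: "real set"
  assumes "smooth_on euclideanreal F A g"
  shows "Ck F A k g"
proof -
  have A: "open A" using assms by (simp add: smooth_on_def)
  let ?g = "\<lambda>j. iter_dir_deriv F A g (replicate j 1)"
  have cont: "continuous_map (top_of_set A) F (?g j)" for j
  proof -
    let ?P = "product_topology (\<lambda>_. euclideanreal) {..<j}"
    have "continuous_map (top_of_set A) (prod_topology (top_of_set A) ?P) (\<lambda>x. (x, \<lambda>i\<in>{..<j}. 1))"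
      by (intro continuous_map_pairedI continuous_map_id[unfolded id_def]) (simp add: PiE_def)
    moreover have "continuous_map (prod_topology (top_of_set A) ?P) F
        (\<lambda>(x, v). iter_dir_deriv F A g (map v [0..<j]) x)"
      using assms by (simp add: smooth_on_def)
    ultimately have "continuous_map (top_of_set A) F
      ((\<lambda>(x, v). iter_dir_deriv F A g (map v [0..<j]) x) \<circ> (\<lambda>x. (x, \<lambda>i\<in>{..<j}. 1)))"
      by (rule continuous_map_compose)
    moreover have "map (\<lambda>i\<in>{..<j}. 1) [0..<j] = replicate j (1::real)"
      by (rule nth_equalityI) auto
    ultimately show ?thesis by (simp add: o_def)
  qed
  have deriv: "has_dir_deriv F A (?g j) x v (v *\<^sub>R ?g (Suc j) x)" if x: "x \<in> A" for j x v
  proof -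
    have maps: "?g j \<in> A \<rightarrow> topspace F" using cont[of j] by (auto simp: continuous_map_def)
    have "\<exists>w. has_dir_deriv F A (?g j) x 1 w"
      using assms x by (simp add: smooth_on_def)
    then obtain w where w: "has_dir_deriv F A (?g j) x 1 w" by blast
    then have "?g (Suc j) x = w" using dir_deriv_eq_open[OF A x w] by simp
    with w have "((\<lambda>h. l (?g j (x + h))) has_real_derivative l (?g (Suc j) x)) (at 0)"
      if "l \<in> L" for l
      using that has_dir_deriv_open_iff[OF A x maps] by simp
    then have "((\<lambda>h. l (?g j (x + h * v))) has_real_derivative l (?g (Suc j) x) * v) (at 0)"
      if "l \<in> L" for l
      using that by (intro DERIV_chain2[of "\<lambda>h. l (?g j (x + h))"]) (auto intro!: derivative_eq_intros)
    moreover have "v *\<^sub>R ?g (Suc j) x \<in> topspace F"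
      using cont[of "Suc j"] x subspace_topspace by (auto simp: continuous_map_def intro!: subspace_scale)
    ultimately show ?thesis
      using has_dir_deriv_open_iff[OF A x maps]
      by (simp add: linear_scale[OF linear_coord] mult.commute)
  qed
  have "Ck F A k (?g j)" for j
  proof (induction k arbitrary: j)
    case (Suc k)
    show ?case using cont[of j] deriv[of _ j] Suc[of "Suc j"]
      by (auto simp del: iter_dir_deriv.simps intro!: exI[of _ "\<lambda>_. ?g (Suc j)"])
  qed (use cont in simp)
  from this[of 0] show ?thesis by simp
qed

end


section \<open>Euclidean spaces and products\<close>

lemma coordinates_Euclidean_space: "coordinates (Euclidean_space n) (range (\<lambda>i x. x i))"
proof (rule coordinates.intro)
  show "subspace (topspace (Euclidean_space n))"
    by (auto simp: subspace_def topspace_Euclidean_space zero_fun_def plus_fun_def scaleR_fun_def)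
next
  fix l :: "(nat \<Rightarrow> real) \<Rightarrow> real" assume "l \<in> range (\<lambda>i x. x i)"
  then obtain i where l: "l = (\<lambda>x. x i)" by blast
  show "linear l"
    unfolding l by (rule linearI) (auto simp: plus_fun_def scaleR_fun_def)
  show "continuous_map (Euclidean_space n) euclideanreal l"
    unfolding l Euclidean_space_def
    by (intro continuous_map_from_subtopology continuous_map_product_projection) simp
next
  fix x :: "nat \<Rightarrow> real" assume "\<And>l. l \<in> range (\<lambda>i x. x i) \<Longrightarrow> l x = 0"
  then show "x = 0" by (auto simp: zero_fun_def)
next
  fix U and x :: "nat \<Rightarrow> real" assume U: "openin (Euclidean_space n) U" "x \<in> U"
  then obtain T where T: "openin (powertop_real UNIV) T" "U = T \<inter> topspace (Euclidean_space n)"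
    by (auto simp: Euclidean_space_def openin_subtopology)
  then obtain V where V: "finite {i. V i \<noteq> UNIV}" "\<And>i. open (V i)" "x \<in> Pi\<^sub>E UNIV V" "Pi\<^sub>E UNIV V \<subseteq> T"
    using U(2) by (fastforce simp: openin_product_topology_alt)
  have "\<exists>e>0. \<forall>y. \<bar>y - x i\<bar> < e \<longrightarrow> y \<in> V i" for i
    using V(2)[of i] V(3) by (auto simp: open_dist dist_real_def PiE_iff)
  then obtain e where e: "\<And>i. e i > 0" "\<And>i y. \<bar>y - x i\<bar> < e i \<Longrightarrow> y \<in> V i" by metis
  define d where "d = Min (insert 1 (e ` {i. V i \<noteq> UNIV}))"
  have d: "d > 0" "\<And>i. V i \<noteq> UNIV \<Longrightarrow> d \<le> e i"
    using V(1) e(1) by (auto simp: d_def)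
  show "\<exists>K e. finite K \<and> K \<subseteq> range (\<lambda>i x. x i) \<and> e > 0 \<and>
      (\<forall>y\<in>topspace (Euclidean_space n). (\<forall>l\<in>K. \<bar>l y - l x\<bar> < e) \<longrightarrow> y \<in> U)"
  proof (intro exI conjI ballI impI)
    show "finite ((\<lambda>i x. x i) ` {i. V i \<noteq> UNIV})" using V(1) by simp
    show "d > 0" by (rule d)
    fix y assume y: "y \<in> topspace (Euclidean_space n)"
      "\<forall>l\<in>(\<lambda>i x. x i) ` {i. V i \<noteq> UNIV}. \<bar>l y - l x\<bar> < d"
    have "y i \<in> V i" for i
    proof (cases "V i = UNIV")
      case False
      then have "\<bar>y i - x i\<bar> < d" using y(2) by auto
      then show ?thesis using d(2)[OF False] e(2)[of "y i" i] by linarith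
    qed simp
    then show "y \<in> U" using T(2) V(4) y(1) by (auto simp: PiE_iff)
  qed auto
qed

lemma coordinates_prod:
  assumes "coordinates F L" "coordinates F' L'"
  shows "coordinates (prod_topology F F') ((\<lambda>l. l \<circ> fst) ` L \<union> (\<lambda>l. l \<circ> snd) ` L')"
proof -
  interpret F: coordinates F L by fact
  interpret F': coordinates F' L' by fact
  show ?thesis
  proof (rule coordinates.intro)
    show "subspace (topspace (prod_topology F F'))"
      using F.subspace_topspace F'.subspace_topspace by (simp add: subspace_Times)
  next
    fix l assume "l \<in> (\<lambda>l. l \<circ> fst) ` L \<union> (\<lambda>l. l \<circ> snd) ` L'"
    then show "linear l" "continuous_map (prod_topology F F') euclideanreal l"
      using F.linear_coord F'.linear_coord F.continuous_coord F'.continuous_coord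
      by (auto intro!: linear_compose linear_fst linear_snd
          intro: continuous_map_compose[OF continuous_map_fst] continuous_map_compose[OF continuous_map_snd])
  next
    fix x assume x: "x \<in> topspace (prod_topology F F')"
      "\<And>l. l \<in> (\<lambda>l. l \<circ> fst) ` L \<union> (\<lambda>l. l \<circ> snd) ` L' \<Longrightarrow> l x = 0"
    have "fst x = 0" using x(1) x(2)[of "l \<circ> fst" for l] by (intro F.coord_separate) auto
    moreover have "snd x = 0" using x(1) x(2)[of "l \<circ> snd" for l] by (intro F'.coord_separate) auto
    ultimately show "x = 0" by (simp add: prod_eq_iff)
  next
    fix U x assume U: "openin (prod_topology F F') U" "x \<in> U"
    then obtain V V' where V: "openin F V" "openin F' V'" "fst x \<in> V" "snd x \<in> V'" "V \<times> V' \<subseteq> U"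
      unfolding openin_prod_topology_alt by (metis prod.collapse)
    obtain K e where K: "finite K" "K \<subseteq> L" "e > 0"
      "\<forall>y\<in>topspace F. (\<forall>l\<in>K. \<bar>l y - l (fst x)\<bar> < e) \<longrightarrow> y \<in> V"
      using F.coord_nbhd[OF V(1,3)] by metis
    obtain K' e' where K': "finite K'" "K' \<subseteq> L'" "e' > 0"
      "\<forall>y\<in>topspace F'. (\<forall>l\<in>K'. \<bar>l y - l (snd x)\<bar> < e') \<longrightarrow> y \<in> V'"
      using F'.coord_nbhd[OF V(2,4)] by metis
    show "\<exists>K e. finite K \<and> K \<subseteq> (\<lambda>l. l \<circ> fst) ` L \<union> (\<lambda>l. l \<circ> snd) ` L' \<and> e > 0 \<and>
        (\<forall>y\<in>topspace (prod_topology F F'). (\<forall>l\<in>K. \<bar>l y - l x\<bar> < e) \<longrightarrow> y \<in> U)"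
    proof (intro exI conjI ballI impI)
      show "finite ((\<lambda>l. l \<circ> fst) ` K \<union> (\<lambda>l. l \<circ> snd) ` K')" using K K' by simp
      show "(\<lambda>l. l \<circ> fst) ` K \<union> (\<lambda>l. l \<circ> snd) ` K' \<subseteq> (\<lambda>l. l \<circ> fst) ` L \<union> (\<lambda>l. l \<circ> snd) ` L'"
        using K K' by blast
      show "min e e' > 0" using K K' by simp
      fix y assume y: "y \<in> topspace (prod_topology F F')"
        "\<forall>l\<in>(\<lambda>l. l \<circ> fst) ` K \<union> (\<lambda>l. l \<circ> snd) ` K'. \<bar>l y - l x\<bar> < min e e'"
      have "\<bar>l (fst y) - l (fst x)\<bar> < e" if "l \<in> K" for l
        using that y(2)[rule_format, of "l \<circ> fst"] by simp
      then have "fst y \<in> V" using y(1) K(4) by auto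
      moreover have "\<bar>l (snd y) - l (snd x)\<bar> < e'" if "l \<in> K'" for l
        using that y(2)[rule_format, of "l \<circ> snd"] by simp
      then have "snd y \<in> V'" using y(1) K'(4) by auto
      ultimately show "y \<in> U" using V(5) by (metis SigmaI prod.collapse subsetD)
    qed
  qed
qed

lemma has_dir_deriv_pair:
  "has_dir_deriv (prod_topology F F') S (\<lambda>x. (f x, g x)) x v w \<longleftrightarrow>
    has_dir_deriv F S f x v (fst w) \<and> has_dir_deriv F' S g x v (snd w)"
  by (simp add: has_dir_deriv_def limitin_pairwise o_def)

lemma Ck_pair:
  assumes "Ck F U k f" "Ck F' U k g"
  shows "Ck (prod_topology F F') U k (\<lambda>x. (f x, g x))"
  using assms
proof (induction k arbitrary: f g)
  case 0
  then show ?case by (simp add: continuous_map_pairedI)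
next
  case (Suc k)
  obtain D where D: "\<And>b. b \<in> Basis \<Longrightarrow> Ck F U k (D b)"
      "\<And>x v. x \<in> U \<Longrightarrow> has_dir_deriv F U f x v (\<Sum>b\<in>Basis. (v \<bullet> b) *\<^sub>R D b x)"
    using Suc.prems(1) by auto
  obtain D' where D': "\<And>b. b \<in> Basis \<Longrightarrow> Ck F' U k (D' b)"
      "\<And>x v. x \<in> U \<Longrightarrow> has_dir_deriv F' U g x v (\<Sum>b\<in>Basis. (v \<bullet> b) *\<^sub>R D' b x)"
    using Suc.prems(2) by auto
  have "has_dir_deriv (prod_topology F F') U (\<lambda>x. (f x, g x)) x v
      (\<Sum>b\<in>Basis. (v \<bullet> b) *\<^sub>R (D b x, D' b x))" if "x \<in> U" for x v
    using D(2) D'(2) that by (simp add: has_dir_deriv_pair fst_sum snd_sum)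
  moreover have "continuous_map (top_of_set U) (prod_topology F F') (\<lambda>x. (f x, g x))"
    using Suc.prems by (intro continuous_map_pairedI Ck_continuous)
  ultimately show ?case
    using D(1) D'(1) Suc.IH by (auto intro!: exI[of _ "\<lambda>b x. (D b x, D' b x)"])
qed


section \<open>Smooth curves in manifolds\<close>

lemma has_dir_deriv_local:
  fixes x v :: "'v::real_normed_vector"
  assumes "open A" "x \<in> A"
  shows "has_dir_deriv F A f x v w \<longleftrightarrow> has_dir_deriv F UNIV f x v w"
  using at_line_open[OF assms, of v] by (simp add: has_dir_deriv_def)

context coordinates
begin

lemma open_line_in:
  assumes "openin F U" "x \<in> topspace F" "v \<in> topspace F"
  shows "open {h. x + h *\<^sub>R v \<in> U}"
proof -
  have "continuous_map euclideanreal F (\<lambda>h. x + h *\<^sub>R v)"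
    using assms by (intro continuous_map_add continuous_map_scaleR) auto
  from openin_continuous_map_preimage[OF this assms(1)] show ?thesis by simp
qed

text \<open>
  The points \<open>c (y + h)\<close> and \<open>c y\<close> differ by \<open>h *\<^sub>R q h\<close>, where \<open>q h\<close> is the difference quotient of \<open>c\<close>.
  By the mean value theorem, each coordinate of the difference quotient of \<open>T \<circ> c\<close> equals that of the
  derivative of \<open>T\<close> at an intermediate point in direction \<open>q h\<close>. As \<open>h\<close> tends to \<open>0\<close>, this
  point tends to \<open>c y\<close> and the direction to \<open>v\<close>, and the derivative of \<open>T\<close> is jointly continuous in
  point and direction.
\<close>
lemma chain_rule_curve:
  assumes T: "smooth_on F F U T" and A: "open A" "y \<in> A" and c: "c \<in> A \<rightarrow> U"
    and dc: "has_dir_deriv F A c y (1::real) v"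
  shows "\<exists>w. has_dir_deriv F A (T \<circ> c) y 1 w"
proof -
  have U: "openin F U" using T by (simp add: smooth_on_def)
  then have UF: "U \<subseteq> topspace F" by (rule openin_subset)
  have cy: "c y \<in> U" using c A by blast
  have maps: "T \<in> U \<rightarrow> topspace F"
  proof -
    have "continuous_map (prod_topology (subtopology F U) (product_topology (\<lambda>_. F) {..<0})) F
        (\<lambda>(x, v). iter_dir_deriv F U T (map v [0..<0]) x)"
      using T unfolding smooth_on_def by blast
    from continuous_map_funspace[OF this] show ?thesis
      using UF by (auto simp: Pi_iff)
  qed
  define DT where "DT = dir_deriv F U T"
  have dT: "has_dir_deriv F U T x p (DT x p)" if "x \<in> U" "p \<in> topspace F" for x p
  proof -
    have "\<forall>vs\<in>lists (topspace F). \<forall>v\<in>topspace F. \<forall>x\<in>U. \<exists>w. has_dir_deriv F U (iter_dir_deriv F U T vs) x v w"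
      using T unfolding smooth_on_def by blast
    from bspec[OF this, of "[]"] have "\<exists>w. has_dir_deriv F U T x p w" using that by simp
    then obtain w where w: "has_dir_deriv F U T x p w" ..
    have "at 0 within {h. x + h *\<^sub>R p \<in> U} = at 0"
      using that UF by (intro at_within_open open_line_in[OF U]) auto
    then show ?thesis using dir_deriv_eq[OF w] w by (simp add: DT_def)
  qed
  have contDT: "continuous_map (prod_topology (subtopology F U) F) F (\<lambda>(x, p). DT x p)"
  proof -
    have "continuous_map (prod_topology (subtopology F U) F)
        (prod_topology (subtopology F U) (product_topology (\<lambda>_. F) {..<1}))
        (\<lambda>z. (fst z, \<lambda>i\<in>{..<1::nat}. snd z))"
      by (intro continuous_map_pairedI continuous_map_fst)
        (auto simp: continuous_map_componentwise continuous_map_snd)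
    moreover have "continuous_map (prod_topology (subtopology F U) (product_topology (\<lambda>_. F) {..<1})) F
        (\<lambda>(x, v). iter_dir_deriv F U T (map v [0..<1]) x)"
      using T unfolding smooth_on_def by blast
    ultimately have "continuous_map (prod_topology (subtopology F U) F) F
        ((\<lambda>(x, v). iter_dir_deriv F U T (map v [0..<1]) x) \<circ> (\<lambda>z. (fst z, \<lambda>i\<in>{..<1::nat}. snd z)))"
      by (rule continuous_map_compose)
    then show ?thesis by (simp add: o_def DT_def case_prod_unfold)
  qed
  have v: "v \<in> topspace F" using dc by (simp add: has_dir_deriv_iff)
  define q where "q h = (c (y + h) - c y) /\<^sub>R h" for h
  have q: "limitin F q v (at 0)"
    using dc at_line_open[OF A, of 1] by (simp add: has_dir_deriv_def q_def[abs_def])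
  have "((\<lambda>h. l (T (c (y + h)))) has_real_derivative l (DT (c y) v)) (at 0)" if l: "l \<in> L" for l
    unfolding has_field_derivative_iff
  proof (rule tendstoI)
    fix e :: real assume e: "e > 0"
    let ?P = "prod_topology euclideanreal F"
    let ?dom = "{z \<in> topspace ?P. c y + fst z *\<^sub>R snd z \<in> U}"
    let ?near = "{z \<in> topspace (subtopology ?P ?dom). l (DT (c y + fst z *\<^sub>R snd z) (snd z)) \<in> ball (l (DT (c y) v)) e}"
    have cont: "continuous_map ?P F (\<lambda>z. c y + fst z *\<^sub>R snd z)"
      using cy UF by (intro continuous_map_add continuous_map_scaleR continuous_map_fst continuous_map_snd) auto
    have N0: "openin ?P ?dom"
      using openin_continuous_map_preimage[OF cont U] .
    have "continuous_map (subtopology ?P ?dom) (prod_topology (subtopology F U) F)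
        (\<lambda>z. (c y + fst z *\<^sub>R snd z, snd z))"
      by (intro continuous_map_pairedI continuous_map_into_subtopology
          continuous_map_from_subtopology cont continuous_map_snd) auto
    from continuous_map_compose[OF this continuous_map_compose[OF contDT continuous_coord[OF l]]]
    have "continuous_map (subtopology ?P ?dom) euclideanreal (\<lambda>z. l (DT (c y + fst z *\<^sub>R snd z) (snd z)))"
      by (simp add: o_def)
    then have "openin (subtopology ?P ?dom) ?near"
      by (rule openin_continuous_map_preimage) simp
    then have N: "openin ?P ?near"
      using N0 openin_trans_full by blast
    have "(0, v) \<in> ?near" using v cy e by simp
    \<comment> \<open>A product neighbourhood of \<open>(0, v)\<close> controls all intermediate points simultaneously.\<close>
    from N[unfolded openin_prod_topology_alt, rule_format, OF this]
    obtain B V where B: "open B" "openin F V" "0 \<in> B" "v \<in> V" "B \<times> V \<subseteq> ?near"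
      by (elim exE conjE) simp
    obtain d where d: "d > 0" "ball 0 d \<subseteq> B" using B(1,3) open_contains_ball by metis
    have "\<forall>\<^sub>F h in at 0. q h \<in> V" using q B(2,4) by (simp add: limitin_def)
    moreover have "\<forall>\<^sub>F h in at 0. h \<in> ball 0 d - {0::real}"
      using d(1) by (auto simp: eventually_at intro!: exI[of _ d])
    ultimately show "\<forall>\<^sub>F h in at 0. dist ((l (T (c (y + h))) - l (T (c (y + 0)))) / (h - 0)) (l (DT (c y) v)) < e"
    proof eventually_elim
      case (elim h)
      define \<zeta> where "\<zeta> r = l (T (c y + r *\<^sub>R q h))" for r
      have inN: "(r, q h) \<in> ?near" if "\<bar>r\<bar> \<le> \<bar>h\<bar>" for r
        using elim that d(2) B(5) by (auto simp: subset_iff)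
      have qF: "q h \<in> topspace F" using inN[of 0] by simp
      have deriv: "(\<zeta> has_real_derivative l (DT (c y + r *\<^sub>R q h) (q h))) (at r)" if r: "\<bar>r\<bar> \<le> \<bar>h\<bar>" for r
      proof -
        let ?x = "c y + r *\<^sub>R q h"
        have x: "?x \<in> U" using inN[OF r] by simp
        have "at 0 within {h'. ?x + h' *\<^sub>R q h \<in> U} = at 0"
          using x UF qF by (intro at_within_open open_line_in[OF U]) auto
        then have "((\<lambda>h'. l (T (?x + h' *\<^sub>R q h))) has_real_derivative l (DT ?x (q h))) (at 0)"
          using dT[OF x qF] l by (simp add: has_dir_deriv_iff)
        then show ?thesis
          using DERIV_shift[of \<zeta> "l (DT ?x (q h))" 0 r] by (simp add: \<zeta>_def scaleR_add_left add.assoc add.commute[of _ r])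
      qed
      have "\<exists>z. \<bar>z\<bar> \<le> \<bar>h\<bar> \<and> \<zeta> h - \<zeta> 0 = h * l (DT (c y + z *\<^sub>R q h) (q h))"
      proof (cases "h > 0")
        case True
        then obtain z where "0 < z" "z < h" "\<zeta> h - \<zeta> 0 = (h - 0) * l (DT (c y + z *\<^sub>R q h) (q h))"
          using MVT2[of 0 h \<zeta> "\<lambda>r. l (DT (c y + r *\<^sub>R q h) (q h))"] deriv by force
        then show ?thesis by (intro exI[of _ z]) auto
      next
        case False
        then have "h < 0" using elim by auto
        then obtain z where "h < z" "z < 0" "\<zeta> 0 - \<zeta> h = (0 - h) * l (DT (c y + z *\<^sub>R q h) (q h))"
          using MVT2[of h 0 \<zeta> "\<lambda>r. l (DT (c y + r *\<^sub>R q h) (q h))"] deriv by force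
        then show ?thesis by (intro exI[of _ z]) (auto simp: algebra_simps)
      qed
      then obtain z where z: "\<bar>z\<bar> \<le> \<bar>h\<bar>" "\<zeta> h - \<zeta> 0 = h * l (DT (c y + z *\<^sub>R q h) (q h))" by blast
      have "h \<noteq> 0" using elim by simp
      then have "\<zeta> h = l (T (c (y + h)))" by (simp add: \<zeta>_def q_def)
      then have "(l (T (c (y + h))) - l (T (c y))) / h = l (DT (c y + z *\<^sub>R q h) (q h))"
        using z(2) \<open>h \<noteq> 0\<close> by (simp add: \<zeta>_def)
      then show ?case using inN[OF z(1)] by (simp add: dist_commute)
    qed
  qed
  moreover have "T \<circ> c \<in> A \<rightarrow> topspace F" using maps c by auto
  moreover have "DT (c y) v \<in> topspace F" using dT[OF cy v] by (simp add: has_dir_deriv_iff)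
  ultimately show ?thesis
    using has_dir_deriv_open_iff[OF A, of "T \<circ> c" 1] by auto
qed

end

lemma smooth_intoE:
  fixes x :: "'v::euclidean_space"
  assumes "smooth_into euclidean S X f" "x \<in> S"
  obtains A W \<phi> g where "open A" "x \<in> A" "(W, \<phi>) \<in> charts X" "smooth_on euclidean (model X) A g"
    "\<And>y. y \<in> A \<inter> S \<Longrightarrow> f y \<in> W \<and> \<phi> (f y) = g y"
proof -
  have "\<exists>A. openin euclidean A \<and> x \<in> A \<and> (\<exists>(W, \<phi>)\<in>charts X. \<exists>g. smooth_on euclidean (model X) A g \<and>
          (\<forall>y\<in>A \<inter> S. f y \<in> W \<and> \<phi> (f y) = g y))"
    using assms by (simp only: smooth_into_def)
  then obtain A c g where "open A" "x \<in> A" "c \<in> charts X" "smooth_on euclidean (model X) A g"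
    "\<forall>y\<in>A \<inter> S. f y \<in> fst c \<and> snd c (f y) = g y"
    by (auto simp: case_prod_unfold)
  then show thesis using that[of A "fst c" "snd c" g] by simp
qed

lemma smooth_into_compose:
  fixes \<sigma> :: "real \<Rightarrow> 'a" and u :: "'v::euclidean_space \<Rightarrow> real"
  assumes "coordinates (model X) L" "smooth_into euclideanreal T X \<sigma>"
    and "\<And>k. Ck euclideanreal UNIV k u" "u ` S \<subseteq> T"
  shows "smooth_into euclidean S X (\<lambda>x. \<sigma> (u x))"
  unfolding smooth_into_def
proof (intro conjI ballI)
  interpret coordinates "model X" L by fact
  fix x assume x: "x \<in> S"
  have ux: "u x \<in> T" using x assms(4) by blast
  obtain A W \<phi> g where A: "open A" "u x \<in> A" "(W, \<phi>) \<in> charts X"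
    "smooth_on euclideanreal (model X) A g" "\<And>y. y \<in> A \<inter> T \<Longrightarrow> \<sigma> y \<in> W \<and> \<phi> (\<sigma> y) = g y"
    using smooth_intoE[OF assms(2) ux] by metis
  have "continuous_on UNIV u" using Ck_continuous[OF assms(3)] by simp
  then have A': "open (u -` A)" using A(1) by (simp add: open_vimage)
  have "smooth_on euclidean (model X) (u -` A) (\<lambda>x. g (u x))"
    using Ck_compose_real[OF A(1) A' Ck_of_smooth_on[OF A(4)] Ck_subset[OF assms(3)]]
    by (intro smooth_onI A') auto
  moreover have "\<forall>y\<in>u -` A \<inter> S. \<sigma> (u y) \<in> W \<and> \<phi> (\<sigma> (u y)) = g (u y)"
    using A(5) assms(4) by blast
  ultimately show "\<exists>A. openin euclidean A \<and> x \<in> A \<and> (\<exists>(W, \<phi>)\<in>charts X. \<exists>g.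
      smooth_on euclidean (model X) A g \<and> (\<forall>y\<in>A \<inter> S. \<sigma> (u y) \<in> W \<and> \<phi> (\<sigma> (u y)) = g y))"
    using A' A(2,3) by (intro exI[of _ "u -` A"]) auto
qed simp

lemma smooth_into_pair:
  fixes f :: "real \<Rightarrow> 'a"
  assumes "coordinates (model X) L" "coordinates (model Y) L'"
    and "smooth_into euclideanreal S X f" "smooth_into euclideanreal S Y g"
  shows "smooth_into euclideanreal S (prod_mfd X Y) (\<lambda>x. (f x, g x))"
  unfolding smooth_into_def
proof (intro conjI ballI)
  interpret X: coordinates "model X" L by fact
  interpret Y: coordinates "model Y" L' by fact
  let ?L = "(\<lambda>l. l \<circ> fst) ` L \<union> (\<lambda>l. l \<circ> snd) ` L'"
  interpret XY: coordinates "prod_topology (model X) (model Y)" ?L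
    using assms(1,2) by (rule coordinates_prod)
  fix x assume x: "x \<in> S"
  obtain A W \<phi> a where A: "open A" "x \<in> A" "(W, \<phi>) \<in> charts X"
    "smooth_on euclideanreal (model X) A a" "\<And>y. y \<in> A \<inter> S \<Longrightarrow> f y \<in> W \<and> \<phi> (f y) = a y"
    using smooth_intoE[OF assms(3) x] by metis
  obtain B W' \<psi> b where B: "open B" "x \<in> B" "(W', \<psi>) \<in> charts Y"
    "smooth_on euclideanreal (model Y) B b" "\<And>y. y \<in> B \<inter> S \<Longrightarrow> g y \<in> W' \<and> \<psi> (g y) = b y"
    using smooth_intoE[OF assms(4) x] by metis
  have "Ck (model X) (A \<inter> B) k a" "Ck (model Y) (A \<inter> B) k b" for k
    using Ck_subset[OF X.Ck_of_smooth_on[OF A(4)]] Ck_subset[OF Y.Ck_of_smooth_on[OF B(4)]] by auto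
  then have "smooth_on euclideanreal (prod_topology (model X) (model Y)) (A \<inter> B) (\<lambda>y. (a y, b y))"
    using A(1) B(1) by (intro XY.smooth_onI Ck_pair) auto
  moreover have "\<forall>y\<in>A \<inter> B \<inter> S. (f y, g y) \<in> W \<times> W' \<and> map_prod \<phi> \<psi> (f y, g y) = (a y, b y)"
    using A(5) B(5) by auto
  moreover have "(W \<times> W', map_prod \<phi> \<psi>) \<in> charts (prod_mfd X Y)"
    using A(3) B(3) by (auto simp: prod_mfd_def)
  moreover have "model (prod_mfd X Y) = prod_topology (model X) (model Y)"
    by (simp add: prod_mfd_def)
  ultimately show "\<exists>A. openin euclideanreal A \<and> x \<in> A \<and> (\<exists>(W, \<phi>)\<in>charts (prod_mfd X Y). \<exists>h.
      smooth_on euclideanreal (model (prod_mfd X Y)) A h \<and>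
      (\<forall>y\<in>A \<inter> S. (f y, g y) \<in> W \<and> \<phi> (f y, g y) = h y))"
    using A(1,2) B(1,2)
    by (intro exI[of _ "A \<inter> B"] conjI bexI[of _ "(W \<times> W', map_prod \<phi> \<psi>)"]) auto
qed simp

lemma smooth_into_cong:
  assumes "\<And>x. x \<in> S \<Longrightarrow> f x = g x" "smooth_into E S X f"
  shows "smooth_into E S X g"
proof -
  have eq: "(\<forall>y\<in>A \<inter> S. f y \<in> W \<and> \<phi> (f y) = h y) = (\<forall>y\<in>A \<inter> S. g y \<in> W \<and> \<phi> (g y) = h y)" for A W \<phi> h
    using assms(1) by auto
  have "smooth_into E S X f \<longleftrightarrow> smooth_into E S X g" by (simp only: smooth_into_def eq)
  with assms(2) show ?thesis by simp
qed

text \<open>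
  Smoothness into a manifold is witnessed by one chart at each point, whereas the rank in the
  definition of thin paths refers to all charts.
\<close>
definition chartwise_differentiable :: "('a, 'v::real_vector) mfd \<Rightarrow> (real \<Rightarrow> 'a) \<Rightarrow> bool"
  where "chartwise_differentiable X \<sigma> \<longleftrightarrow>
    (\<forall>y. \<forall>(W, \<phi>)\<in>charts X. \<sigma> y \<in> W \<longrightarrow> (\<exists>w. has_dir_deriv (model X) UNIV (\<phi> \<circ> \<sigma>) y 1 w))"

lemma chartwise_differentiable_smooth:
  assumes "frechet_manifold X" "coordinates (model X) L" "smooth_into euclideanreal UNIV X \<sigma>"
  shows "chartwise_differentiable X \<sigma>"
  unfolding chartwise_differentiable_def
proof clarify
  interpret coordinates "model X" L by fact
  fix y W \<phi> assume W: "(W, \<phi>) \<in> charts X" "\<sigma> y \<in> W"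
  obtain A W' \<phi>' g where A: "open A" "y \<in> A" "(W', \<phi>') \<in> charts X"
    "smooth_on euclideanreal (model X) A g" "\<And>t. t \<in> A \<Longrightarrow> \<sigma> t \<in> W' \<and> \<phi>' (\<sigma> t) = g t"
    using smooth_intoE[OF assms(3) UNIV_I] by (metis IntI UNIV_I)
  have inj: "inj_on \<phi>' W'" using assms(1) A(3) by (auto simp: frechet_manifold_def)
  let ?O = "\<phi>' ` (W' \<inter> W)" and ?T = "\<phi> \<circ> the_inv_into W' \<phi>'"
  have T: "smooth_on (model X) (model X) ?O ?T"
    using assms(1) A(3) W(1) unfolding frechet_manifold_def by blast
  have Ck: "Ck (model X) A k g" for k by (rule Ck_of_smooth_on[OF A(4)])
  let ?A = "{t \<in> A. g t \<in> ?O}"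
  have "openin (top_of_set A) ?A"
    using openin_continuous_map_preimage[OF Ck_continuous[OF Ck], of ?O] T by (simp add: smooth_on_def)
  then have openA: "open ?A" using A(1) by (metis open_openin openin_open_trans)
  have "\<sigma> y \<in> W' \<inter> W" "g y = \<phi>' (\<sigma> y)" using A(5)[OF A(2)] W(2) by auto
  then have y: "y \<in> ?A" using A(2) by (simp only: mem_Collect_eq imageI)
  obtain D where D: "\<And>x v. x \<in> A \<Longrightarrow> has_dir_deriv (model X) A g x v (\<Sum>b\<in>Basis. (v \<bullet> b) *\<^sub>R D b x)"
    using Ck[of "Suc 0"] by auto
  have "has_dir_deriv (model X) A g y 1 (D 1 y)"
    using D[OF A(2), of 1] by simp
  then have "has_dir_deriv (model X) UNIV g y 1 (D 1 y)"
    by (rule iffD1[OF has_dir_deriv_local[OF A(1,2)]])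
  then have "has_dir_deriv (model X) ?A g y 1 (D 1 y)"
    by (rule iffD2[OF has_dir_deriv_local[OF openA y]])
  from chain_rule_curve[OF T openA y _ this]
  obtain w where "has_dir_deriv (model X) ?A (?T \<circ> g) y 1 w" by auto
  moreover have "(?T \<circ> g) t = (\<phi> \<circ> \<sigma>) t" if t: "t \<in> ?A" for t
  proof -
    have "g t = \<phi>' (\<sigma> t)" "\<sigma> t \<in> W'" using A(5) t by auto
    then show ?thesis by (simp add: the_inv_into_f_f[OF inj])
  qed
  ultimately have "has_dir_deriv (model X) ?A (\<phi> \<circ> \<sigma>) y 1 w"
    using has_dir_deriv_cong[of ?A "?T \<circ> g" "\<phi> \<circ> \<sigma>"] y by blast
  then show "\<exists>w. has_dir_deriv (model X) UNIV (\<phi> \<circ> \<sigma>) y 1 w"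
    using has_dir_deriv_local[OF openA y] by blast
qed

text \<open>
  Differentiability is transferred to the product directly, without transition maps of the product
  atlas.
\<close>
lemma chartwise_differentiable_pair:
  assumes "chartwise_differentiable X \<sigma>" "chartwise_differentiable Y \<tau>"
  shows "chartwise_differentiable (prod_mfd X Y) (\<lambda>t. (\<sigma> t, \<tau> t))"
  unfolding chartwise_differentiable_def
proof clarify
  fix y W \<phi> assume "(W, \<phi>) \<in> charts (prod_mfd X Y)" and y: "(\<sigma> y, \<tau> y) \<in> W"
  then obtain W1 \<phi>1 W2 \<phi>2 where c: "W = W1 \<times> W2" "\<phi> = map_prod \<phi>1 \<phi>2"
    "(W1, \<phi>1) \<in> charts X" "(W2, \<phi>2) \<in> charts Y"
    by (auto simp: prod_mfd_def)
  obtain w1 where w1: "has_dir_deriv (model X) UNIV (\<phi>1 \<circ> \<sigma>) y 1 w1"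
    using assms(1) c y unfolding chartwise_differentiable_def by blast
  obtain w2 where w2: "has_dir_deriv (model Y) UNIV (\<phi>2 \<circ> \<tau>) y 1 w2"
    using assms(2) c y unfolding chartwise_differentiable_def by blast
  have "has_dir_deriv (model (prod_mfd X Y)) UNIV (\<phi> \<circ> (\<lambda>t. (\<sigma> t, \<tau> t))) y 1 (w1, w2)"
    using w1 w2 by (simp add: prod_mfd_def c(2) o_def has_dir_deriv_pair)
  then show "\<exists>w. has_dir_deriv (model (prod_mfd X Y)) UNIV (\<phi> \<circ> (\<lambda>t. (\<sigma> t, \<tau> t))) y 1 w" ..
qed


section \<open>A smooth map of the circle that stops at two points\<close>

text \<open>
  The classical function \<open>exp (- 1 / x)\<close>, extended by \<open>0\<close>, together with its quotients by powers of
  \<open>x\<close>, so that the family is closed under differentiation up to linear combinations.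
\<close>
definition flat :: "nat \<Rightarrow> real \<Rightarrow> real"
  where "flat n x = (if x > 0 then exp (- (1 / x)) / x ^ n else 0)"

lemma flat_tendsto_0: "(flat n \<longlongrightarrow> 0) (at 0)"
proof (rule filterlim_split_at)
  have "\<forall>\<^sub>F x in at_left 0. flat n x = 0"
    by (auto simp: eventually_at_filter flat_def intro!: always_eventually)
  then show "(flat n \<longlongrightarrow> 0) (at_left 0)" by (rule tendsto_eventually)
  have "((\<lambda>x. inverse x ^ n / exp (inverse x)) \<longlongrightarrow> (0::real)) (at_right 0)"
    by (rule filterlim_compose[OF tendsto_power_div_exp_0 filterlim_inverse_at_top_right])
  moreover have "\<forall>\<^sub>F x in at_right 0. inverse x ^ n / exp (inverse x) = flat n x"
    by (auto simp: eventually_at_filter flat_def exp_minus field_simps intro!: always_eventually)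
  ultimately show "(flat n \<longlongrightarrow> 0) (at_right 0)" by (rule Lim_transform_eventually)
qed

lemma DERIV_flat:
  "(flat n has_real_derivative flat (n + 2) x - real n * flat (n + 1) x) (at x)"
proof (cases "x = 0")
  case True
  have "\<forall>\<^sub>F h in at 0. flat (Suc n) h = (flat n (0 + h) - flat n 0) / h"
    by (auto simp: eventually_at_filter flat_def intro!: always_eventually)
  then have "((\<lambda>h. (flat n (0 + h) - flat n 0) / h) \<longlongrightarrow> 0) (at 0)"
    using flat_tendsto_0 by (rule Lim_transform_eventually[rotated])
  then show ?thesis using True by (simp add: DERIV_def flat_def)
next
  case False
  then consider "x > 0" | "x < 0" by linarith
  then show ?thesis
  proof cases
    case 1
    have "((\<lambda>x. exp (- (1 / x)) / x ^ n) has_real_derivative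
        (exp (- (1 / x)) * (1 / x\<^sup>2) * x ^ n - exp (- (1 / x)) * (real n * x ^ (n - 1))) / (x ^ n * x ^ n)) (at x)"
      using 1 by (auto intro!: derivative_eq_intros simp: power2_eq_square)
    also have "(exp (- (1 / x)) * (1 / x\<^sup>2) * x ^ n - exp (- (1 / x)) * (real n * x ^ (n - 1))) / (x ^ n * x ^ n)
        = flat (n + 2) x - real n * flat (n + 1) x"
      using 1 by (cases n) (auto simp: flat_def field_simps power2_eq_square)
    finally show ?thesis
      by (rule has_field_derivative_transform_within_open[of _ _ _ "{0<..}"]) (use 1 in \<open>auto simp: flat_def\<close>)
  next
    case 2
    have "((\<lambda>_. 0) has_real_derivative 0) (at x)" by simp
    then have "(flat n has_real_derivative 0) (at x)"
      by (rule has_field_derivative_transform_within_open[of _ _ _ "{..<0}"]) (use 2 in \<open>auto simp: flat_def\<close>)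
    then show ?thesis using 2 by (simp add: flat_def)
  qed
qed

lemma Ck_flat: "Ck euclideanreal UNIV k (flat n)"
proof (induction k arbitrary: n)
  case 0
  show ?case using DERIV_flat by (auto intro!: continuous_at_imp_continuous_on DERIV_isCont)
next
  case (Suc k)
  have "Ck euclideanreal UNIV k (\<lambda>x. flat (n + 2) x + (- real n) *\<^sub>R flat (n + 1) x)"
    by (intro real_coords.Ck_add real_coords.Ck_scaleR real_coords.Ck_const Suc) auto
  then show ?case using DERIV_flat by (intro Ck_real_SucI) auto
qed

lemma sin_le_half:
  assumes "- 7 * pi / 6 \<le> \<theta>" "\<theta> \<le> pi / 6"
  shows "sin \<theta> \<le> 1 / 2"
proof (cases "- pi / 2 \<le> \<theta>")
  case True
  then have "sin \<theta> \<le> sin (pi / 6)" using assms by (intro sin_monotone_2pi_le) auto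
  then show ?thesis by (simp add: sin_30)
next
  case False
  then have "sin (- pi - \<theta>) \<le> sin (pi / 6)" using assms by (intro sin_monotone_2pi_le) auto
  moreover have "sin (- pi - \<theta>) = sin \<theta>" by (simp add: sin_diff)
  ultimately show ?thesis by (simp add: sin_30)
qed

text \<open>
  The function is an antiderivative of a smooth nonnegative function of \<open>sin \<theta>\<close> that vanishes for
  \<open>sin \<theta> \<le> 1 / 2\<close>, normalized to increase by \<open>1\<close> over one period. It increases only where
  \<open>sin \<theta> > 1 / 2\<close>, in the middle of the upper half circle.
\<close>
lemma smooth_staircase:
  obtains s :: "real \<Rightarrow> real" where "\<And>k. Ck euclideanreal UNIV k s"
    and "\<And>\<theta>. s (\<theta> + 2 * pi) = s \<theta> + 1" and "mono s"
    and "\<And>\<theta>. - 7 * pi / 6 \<le> \<theta> \<Longrightarrow> \<theta> \<le> pi / 6 \<Longrightarrow> s \<theta> = 0"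
proof -
  define B where "B \<theta> = flat 0 (sin \<theta> + - 1 / 2)" for \<theta>
  have "Ck euclideanreal UNIV k (\<lambda>\<theta>. sin \<theta> + - 1 / 2)" for k
    by (intro real_coords.Ck_add real_coords.Ck_const conjunct1[OF Ck_sin_cos]) auto
  then have B: "Ck euclideanreal UNIV k B" for k
    unfolding B_def by (intro real_coords.Ck_compose_real[where A = UNIV, OF _ _ Ck_flat]) auto
  then have "continuous_on UNIV B" using Ck_continuous by fastforce
  then have "isCont B x" for x by (simp add: continuous_on_eq_continuous_at)
  then obtain P where P: "\<And>x. (P has_real_derivative B x) (at x)"
    using einterval_antiderivative[of "-\<infinity>" "\<infinity>" B] by (auto simp: has_real_derivative_iff_has_vector_derivative)
  have B0: "B x \<ge> 0" "sin x \<le> 1 / 2 \<Longrightarrow> B x = 0" "B (x + 2 * pi) = B x" for x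
    by (auto simp: B_def flat_def)
  have mono: "P x \<le> P y" if "x \<le> y" for x y
    using DERIV_nonneg_imp_nondecreasing[OF that] P B0(1) by blast
  define c where "c = P (2 * pi) - P 0"
  \<comment> \<open>Otherwise the monotone function \<open>P\<close> would be constant on a period, but \<open>B (pi / 2) > 0\<close>.\<close>
  have "c \<noteq> 0"
  proof
    assume "c = 0"
    then have "P x = P 0" if "0 < x" "x < 2 * pi" for x
      using mono[of 0 x] mono[of x "2 * pi"] that by (simp add: c_def)
    then have "(P has_real_derivative 0) (at (pi / 2))"
      using has_field_derivative_transform_within_open[of "\<lambda>_. P 0" 0 "pi / 2" "{0<..<2 * pi}" P] by simp
    then have "B (pi / 2) = 0" using P DERIV_unique by blast
    then show False by (simp add: B_def flat_def)
  qed
  moreover have "c \<ge> 0" using mono[of 0 "2 * pi"] by (simp add: c_def)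
  ultimately have c: "c > 0" by linarith
  define s where "s \<theta> = (P \<theta> - P 0) / c" for \<theta>
  have ds: "(s has_real_derivative B \<theta> / c) (at \<theta>)" for \<theta>
    unfolding s_def using c by (auto intro!: derivative_eq_intros P)
  have "Ck euclideanreal UNIV k s" for k
  proof -
    have "Ck euclideanreal UNIV k (\<lambda>\<theta>. inverse c *\<^sub>R B \<theta>)"
      by (intro real_coords.Ck_scaleR real_coords.Ck_const B) auto
    then have "Ck euclideanreal UNIV (Suc k) s"
      using ds by (intro Ck_real_SucI[where f' = "\<lambda>\<theta>. inverse c *\<^sub>R B \<theta>"]) (auto simp: divide_inverse mult.commute)
    then show ?thesis by (rule Ck_pred)
  qed
  moreover have "s (\<theta> + 2 * pi) = s \<theta> + 1" for \<theta>
  proof -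
    have "((\<lambda>\<theta>. s (\<theta> + 2 * pi) - s \<theta>) has_real_derivative 0) (at \<theta>)" for \<theta>
      using DERIV_diff[OF _ ds[of \<theta>], of "\<lambda>\<theta>. s (\<theta> + 2 * pi)" "B \<theta> / c"] ds[of "\<theta> + 2 * pi"]
      by (simp add: B0(3) DERIV_shift[symmetric])
    then have "s (\<theta> + 2 * pi) - s \<theta> = s (0 + 2 * pi) - s 0"
      by (intro DERIV_isconst_all) blast
    also have "\<dots> = 1" using c by (simp add: s_def c_def)
    finally show ?thesis by simp
  qed
  moreover have "mono s" using mono c by (auto simp: mono_def s_def divide_right_mono)
  moreover have "s \<theta> = 0" if \<theta>: "- 7 * pi / 6 \<le> \<theta>" "\<theta> \<le> pi / 6" for \<theta>
  proof -
    have const: "s x = s (- 7 * pi / 6)" if "- 7 * pi / 6 \<le> x" "x \<le> pi / 6" for x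
    proof (rule DERIV_isconst2[of "- 7 * pi / 6" "pi / 6" s])
      show "continuous_on {- 7 * pi / 6..pi / 6} s"
        using ds by (meson DERIV_isCont continuous_at_imp_continuous_on)
      show "(s has_real_derivative 0) (at x)" if "- 7 * pi / 6 < x" "x < pi / 6" for x
        using ds[of x] B0(2)[OF sin_le_half] that by simp
    qed (use that in auto)
    have "s \<theta> = s 0" using const[OF \<theta>] const[of 0] by simp
    then show ?thesis by (simp add: s_def)
  qed
  ultimately show thesis by (rule that)
qed

definition degree_one :: "(real \<Rightarrow> real) \<Rightarrow> bool"
  where "degree_one f \<longleftrightarrow> (\<forall>\<theta>. f (\<theta> + 2 * pi) = f \<theta> + 2 * pi)"

text \<open>
  One copy of the staircase moves from \<open>a\<close> to \<open>b\<close> while \<open>\<theta>\<close> traverses the upper half circle, a copy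
  shifted by \<open>\<pi>\<close> moves on to \<open>a + 2\<pi>\<close> on the lower half circle. The arcs
  may be degenerate, which covers supports reduced to a point or its complement.
\<close>
lemma circle_reparametrization:
  assumes "a \<le> b" "b \<le> a + 2 * pi"
  obtains f :: "real \<Rightarrow> real" where "\<And>k. Ck euclideanreal UNIV k f"
    and "degree_one f"
    and "\<And>\<theta>. 0 \<le> \<theta> \<Longrightarrow> \<theta> \<le> pi \<Longrightarrow> f \<theta> \<in> {a..b}"
    and "\<And>\<theta>. pi \<le> \<theta> \<Longrightarrow> \<theta> \<le> 2 * pi \<Longrightarrow> f \<theta> \<in> {b..a + 2 * pi}"
    and "\<And>\<theta>. 0 \<le> \<theta> \<Longrightarrow> \<theta> \<le> pi / 6 \<Longrightarrow> f \<theta> = a"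
    and "\<And>\<theta>. 5 * pi / 6 \<le> \<theta> \<Longrightarrow> \<theta> \<le> 7 * pi / 6 \<Longrightarrow> f \<theta> = b"
    and "\<And>\<theta>. 11 * pi / 6 \<le> \<theta> \<Longrightarrow> \<theta> \<le> 2 * pi \<Longrightarrow> f \<theta> = a + 2 * pi"
proof -
  obtain s :: "real \<Rightarrow> real" where s: "\<And>k. Ck euclideanreal UNIV k s"
    "\<And>\<theta>. s (\<theta> + 2 * pi) = s \<theta> + 1" "mono s"
    "\<And>\<theta>. - 7 * pi / 6 \<le> \<theta> \<Longrightarrow> \<theta> \<le> pi / 6 \<Longrightarrow> s \<theta> = 0"
    using smooth_staircase by blast
  have s1: "s \<theta> = 1" if "5 * pi / 6 \<le> \<theta>" "\<theta> \<le> 13 * pi / 6" for \<theta>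
    using s(2)[of "\<theta> - 2 * pi"] s(4)[of "\<theta> - 2 * pi"] that by simp
  have s01: "0 \<le> s \<theta>" "s \<theta> \<le> 1" if "0 \<le> \<theta>" "\<theta> \<le> pi" for \<theta>
    using monoD[OF s(3), of 0 \<theta>] monoD[OF s(3), of \<theta> pi] s(4)[of 0] s1[of pi] that by auto
  define f where "f \<theta> = (a + (b - a) * s \<theta>) + (a + 2 * pi - b) * s (\<theta> + - pi)" for \<theta>
  have "Ck euclideanreal UNIV k (\<lambda>\<theta>. s (\<theta> + - pi))" for k
    by (intro real_coords.Ck_compose_real[where A = UNIV, OF _ _ s(1)] real_coords.Ck_add
        real_coords.Ck_const Ck_id) auto
  then have "Ck euclideanreal UNIV k f" for k
    unfolding f_def real_scaleR_def[symmetric]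
    by (intro real_coords.Ck_add real_coords.Ck_scaleR real_coords.Ck_const s(1)) auto
  moreover have "f (\<theta> + 2 * pi) = f \<theta> + 2 * pi" for \<theta>
    using s(2)[of \<theta>] s(2)[of "\<theta> + - pi"] by (simp add: f_def algebra_simps)
  then have "degree_one f" by (simp add: degree_one_def)
  moreover have "f \<theta> \<in> {a..b}" if "0 \<le> \<theta>" "\<theta> \<le> pi" for \<theta>
  proof -
    have "0 \<le> (b - a) * s \<theta>" "(b - a) * s \<theta> \<le> b - a"
      using s01[OF that] assms by (auto intro: mult_left_le)
    moreover have "s (\<theta> + - pi) = 0" using that by (intro s(4)) auto
    ultimately show ?thesis by (simp only: f_def atLeastAtMost_iff) simp
  qed
  moreover have "f \<theta> \<in> {b..a + 2 * pi}" if "pi \<le> \<theta>" "\<theta> \<le> 2 * pi" for \<theta>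
  proof -
    have "0 \<le> (a + 2 * pi - b) * s (\<theta> + - pi)" "(a + 2 * pi - b) * s (\<theta> + - pi) \<le> a + 2 * pi - b"
      using s01[of "\<theta> + - pi"] that assms by (auto intro: mult_left_le)
    moreover have "s \<theta> = 1" using that by (intro s1) auto
    ultimately show ?thesis by (simp only: f_def atLeastAtMost_iff) simp
  qed
  moreover have "f \<theta> = a" if "0 \<le> \<theta>" "\<theta> \<le> pi / 6" for \<theta>
    using s(4)[of \<theta>] s(4)[of "\<theta> + - pi"] that by (simp add: f_def)
  moreover have "f \<theta> = b" if "5 * pi / 6 \<le> \<theta>" "\<theta> \<le> 7 * pi / 6" for \<theta>
    using s1[of \<theta>] s(4)[of "\<theta> + - pi"] that by (simp add: f_def)
  moreover have "f \<theta> = a + 2 * pi" if "11 * pi / 6 \<le> \<theta>" "\<theta> \<le> 2 * pi" for \<theta>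
    using s1[of \<theta>] s1[of "\<theta> + - pi"] that by (simp add: f_def)
  ultimately show thesis by (rule that)
qed


section \<open>Reparametrization is a thin homotopy\<close>

definition reparam :: "(complex \<Rightarrow> 'a) \<Rightarrow> (real \<Rightarrow> real) \<Rightarrow> complex \<Rightarrow> 'a"
  where "reparam \<tau> f = (\<lambda>z\<in>circle. \<tau> (cis (f (Arg2pi z))))"

lemma degree_one_of_int:
  assumes "degree_one f"
  shows "f (\<theta> + 2 * pi * of_int k) = f \<theta> + 2 * pi * of_int k"
proof (induction k rule: int_induct[of _ 0])
  case (step1 i)
  then show ?case using assms[unfolded degree_one_def, rule_format, of "\<theta> + 2 * pi * of_int i"] by (simp add: algebra_simps)
next
  case (step2 i)
  then show ?case using assms[unfolded degree_one_def, rule_format, of "\<theta> + 2 * pi * of_int (i - 1)"] by (simp add: algebra_simps)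
qed simp

lemma cis_eq_iff: "cis x = cis y \<longleftrightarrow> (\<exists>k::int. x = y + 2 * pi * of_int k)"
  using sin_cos_eq_iff[of x y] by (auto simp: complex_eq_iff)

lemma cis_Arg2pi_circle: "z \<in> circle \<Longrightarrow> cis (Arg2pi z) = z"
  using Arg2pi_eq[of z] by (simp add: cis_conv_exp)

lemma reparam_cis:
  assumes "degree_one f"
  shows "reparam \<tau> f (cis \<theta>) = \<tau> (cis (f \<theta>))"
proof -
  have "cis (Arg2pi (cis \<theta>)) = cis \<theta>" by (rule cis_Arg2pi_circle) simp
  then obtain k :: int where "Arg2pi (cis \<theta>) = \<theta> + 2 * pi * of_int k" using cis_eq_iff by blast
  then have "cis (f (Arg2pi (cis \<theta>))) = cis (f \<theta>)"
    using degree_one_of_int[OF assms] cis_eq_iff by auto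
  then show ?thesis by (simp add: reparam_def)
qed

lemma reparam_id: "\<tau> \<in> extensional circle \<Longrightarrow> reparam \<tau> (\<lambda>\<theta>. \<theta>) = \<tau>"
  by (auto simp: reparam_def fun_eq_iff extensional_def cis_Arg2pi_circle)

lemma Ck_affine:
  assumes "\<And>k. Ck euclideanreal UNIV k f"
  shows "Ck euclideanreal UNIV k (\<lambda>\<theta>. a * \<theta> + b * f \<theta> :: real)"
  unfolding real_scaleR_def[symmetric]
  by (intro real_coords.Ck_add real_coords.Ck_scaleR real_coords.Ck_const Ck_id assms) auto

lemma reparam_in_loops:
  assumes "coordinates (model X) L" "\<tau> \<in> loops X"
    and "\<And>k. Ck euclideanreal UNIV k f" "degree_one f"
  shows "reparam \<tau> f \<in> loops X"
proof -
  have \<tau>: "\<tau> \<in> circle \<rightarrow>\<^sub>E points X" "smooth_into euclideanreal UNIV X (\<lambda>\<theta>. \<tau> (cis \<theta>))"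
    using assms(2) by (auto simp: loops_def)
  have "smooth_into euclidean UNIV X (\<lambda>\<theta>. \<tau> (cis (f \<theta>)))"
    by (rule smooth_into_compose[OF assms(1) \<tau>(2) assms(3)]) simp
  moreover have "reparam \<tau> f \<in> circle \<rightarrow>\<^sub>E points X"
    using \<tau>(1) by (auto simp: reparam_def PiE_iff)
  ultimately show ?thesis by (simp add: loops_def reparam_cis[OF assms(4)])
qed

text \<open>This makes derivatives on the strip unique also at its boundary.\<close>
lemma at_line_strip:
  fixes x v :: "real \<times> real"
  assumes "x \<in> {0..1} \<times> UNIV"
  shows "at 0 within {h. x + h *\<^sub>R v \<in> {0..1} \<times> UNIV} \<noteq> bot"
proof -
  obtain t \<theta> a b where xv: "x = (t, \<theta>)" "v = (a, b)" by (metis prod.exhaust)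
  then have t: "0 \<le> t" "t \<le> 1" using assms by auto
  \<comment> \<open>The sign \<open>s\<close> points away from the nearer end of \<open>[0,1]\<close>, so a change of \<open>t\<close> by at most
    \<open>1/2\<close> in this direction stays inside.\<close>
  define s where "s = (if (t \<le> 1/2) = (a \<ge> 0) then 1 else -1 :: real)"
  have "0 islimpt {h. x + h *\<^sub>R v \<in> {0..1} \<times> UNIV}"
    unfolding islimpt_approachable
  proof (intro allI impI)
    fix e :: real assume e: "e > 0"
    define r where "r = min (e/2) (1 / (2 * (1 + \<bar>a\<bar>)))"
    have r: "r > 0" "r < e" using e by (auto simp: r_def)
    have "r * \<bar>a\<bar> \<le> 1 / (2 * (1 + \<bar>a\<bar>)) * \<bar>a\<bar>" by (intro mult_right_mono) (auto simp: r_def)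
    also have "\<dots> \<le> 1/2" by (simp add: field_simps)
    finally have "r * \<bar>a\<bar> \<le> 1/2" .
    moreover have "r * \<bar>a\<bar> \<ge> 0" using r by simp
    moreover have "(s * r) * a = (if t \<le> 1/2 then r * \<bar>a\<bar> else - (r * \<bar>a\<bar>))"
      by (auto simp: s_def)
    ultimately have "x + (s * r) *\<^sub>R v \<in> {0..1} \<times> UNIV"
      using t by (auto simp: xv split: if_splits)
    moreover have "s * r \<noteq> 0" "dist (s * r) 0 < e" using r by (auto simp: s_def)
    ultimately show "\<exists>h\<in>{h. x + h *\<^sub>R v \<in> {0..1} \<times> UNIV}. h \<noteq> 0 \<and> dist h 0 < e"
      by (intro bexI[of _ "s * r"] conjI CollectI)
  qed
  then show ?thesis by (simp add: trivial_limit_within)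
qed

text \<open>
  The set \<open>S\<close> may have a boundary, as \<open>[0,1] \<times> R\<close> has, so that the derivative on the left may be
  one-sided. It is nevertheless a multiple of the two-sided derivative of \<open>f\<close>.
\<close>
lemma (in coordinates) chain_rule_within:
  fixes u :: "'v::real_vector \<Rightarrow> real"
  assumes f: "has_dir_deriv F UNIV f (u x) 1 w"
    and u: "((\<lambda>h. u (x + h *\<^sub>R v)) has_real_derivative d) (at 0 within {h. x + h *\<^sub>R v \<in> S})"
  shows "has_dir_deriv F S (f \<circ> u) x v (d *\<^sub>R w)"
proof -
  let ?H = "{h. x + h *\<^sub>R v \<in> S}"
  have w: "w \<in> topspace F" and ev: "\<forall>\<^sub>F r in at 0. (f (u x + r) - f (u x)) /\<^sub>R r \<in> topspace F"
    and df: "\<And>l. l \<in> L \<Longrightarrow> ((\<lambda>r. l (f (u x + r))) has_real_derivative l w) (at 0)"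
    using f by (auto simp: has_dir_deriv_iff)
  have "((\<lambda>h. l (f (u (x + h *\<^sub>R v)))) has_real_derivative l w * d) (at 0 within ?H)" if "l \<in> L" for l
    using DERIV_chain2[OF _ u, of "\<lambda>y. l (f y)"] df[OF that] DERIV_shift[of "\<lambda>y. l (f y)" _ 0 "u x"]
    by (simp add: add.commute)
  moreover have "\<forall>\<^sub>F h in at 0 within ?H. (f (u (x + h *\<^sub>R v)) - f (u x)) /\<^sub>R h \<in> topspace F"
  proof -
    have quot: "f (u x + r) - f (u x) \<in> topspace F" if "r \<noteq> 0 \<longrightarrow> (f (u x + r) - f (u x)) /\<^sub>R r \<in> topspace F" for r
    proof (cases "r = 0")
      case False
      then show ?thesis using that subspace_scale[OF subspace_topspace, of "(f (u x + r) - f (u x)) /\<^sub>R r" r] by simp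
    qed (simp add: zero_in_topspace)
    have "\<forall>\<^sub>F r in nhds 0. r \<noteq> 0 \<longrightarrow> (f (u x + r) - f (u x)) /\<^sub>R r \<in> topspace F"
      using ev by (simp add: eventually_at_filter)
    moreover have "((\<lambda>h. u (x + h *\<^sub>R v) - u x) \<longlongrightarrow> 0) (at 0 within ?H)"
      using DERIV_continuous[OF u] by (auto simp: continuous_within intro: tendsto_eq_intros)
    ultimately have "\<forall>\<^sub>F h in at 0 within ?H. u (x + h *\<^sub>R v) - u x \<noteq> 0 \<longrightarrow>
        (f (u x + (u (x + h *\<^sub>R v) - u x)) - f (u x)) /\<^sub>R (u (x + h *\<^sub>R v) - u x) \<in> topspace F"
      by (rule eventually_compose_filterlim)
    then show ?thesis
    proof eventually_elim
      case (elim h)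
      from quot[OF elim] show ?case by (intro subspace_scale[OF subspace_topspace]) simp
    qed
  qed
  moreover have "d *\<^sub>R w \<in> topspace F" using w by (intro subspace_scale[OF subspace_topspace])
  ultimately show ?thesis
    by (simp add: has_dir_deriv_iff linear_scale[OF linear_coord] mult.commute)
qed

text \<open>
  Interpolating linearly between the identity and \<open>f\<close> gives \<open>\<tau> \<circ> cis \<circ> u\<close> for a function \<open>u\<close> of time and
  angle. All its directional derivatives are multiples of the velocity of the curve \<open>\<tau> \<circ> cis\<close>.
\<close>
lemma thin_pair_reparam:
  assumes X: "coordinates (model X) L" and \<tau>: "\<tau> \<in> loops X"
    and diff: "chartwise_differentiable X (\<lambda>\<theta>. \<tau> (cis \<theta>))"
    and f: "\<And>k. Ck euclideanreal UNIV k f" "degree_one f"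
  shows "(\<tau>, reparam \<tau> f) \<in> thin_pairs X"
proof -
  interpret coordinates "model X" L by fact
  define ft where "ft t \<theta> = (1 - t) * \<theta> + t * f \<theta>" for t \<theta>
  define u where "u = (\<lambda>(t, \<theta>). ft t \<theta>)"
  have ft: "Ck euclideanreal UNIV k (ft t)" "degree_one (ft t)" for k t
  proof -
    show "Ck euclideanreal UNIV k (ft t)" unfolding ft_def[abs_def] by (rule Ck_affine[OF f(1)])
    show "degree_one (ft t)" using f(2) by (simp add: ft_def degree_one_def algebra_simps)
  qed
  have fst: "Ck euclideanreal UNIV k (fst :: real \<times> real \<Rightarrow> real)" for k
    using Ck_inner[of UNIV k "(1, 0) :: real \<times> real"] by (simp add: inner_prod_def case_prod_unfold)
  have snd: "Ck euclideanreal UNIV k (snd :: real \<times> real \<Rightarrow> real)" for k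
    using Ck_inner[of UNIV k "(0, 1) :: real \<times> real"] by (simp add: inner_prod_def case_prod_unfold)
  have "Ck euclideanreal UNIV k (\<lambda>x. (1 + (-1) *\<^sub>R fst x) *\<^sub>R snd x + fst x *\<^sub>R f (snd x))" for k
    by (intro real_coords.Ck_add real_coords.Ck_scaleR real_coords.Ck_const fst snd
        real_coords.Ck_compose_real[where A = UNIV, OF _ _ f(1)]) auto
  then have u: "Ck euclideanreal UNIV k u" for k
    by (simp add: u_def ft_def case_prod_unfold)
  let ?S = "{0..1} \<times> UNIV :: (real \<times> real) set"
  let ?\<sigma> = "\<lambda>\<theta>. \<tau> (cis \<theta>)"
  have \<sigma>: "smooth_into euclideanreal UNIV X ?\<sigma>" using \<tau> by (simp add: loops_def)
  have F: "(\<lambda>(t, \<theta>). reparam \<tau> (ft t) (cis \<theta>)) = (\<lambda>x. ?\<sigma> (u x))"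
    by (simp add: reparam_cis[OF ft(2)] u_def fun_eq_iff)
  have "thin_path X (\<lambda>t. reparam \<tau> (ft t))"
    unfolding thin_path_def Let_def F prod_topology_euclidean
  proof (intro conjI ballI)
    show "reparam \<tau> (ft t) \<in> loops X" for t
      by (rule reparam_in_loops[OF X \<tau> ft])
    show "smooth_into euclidean ?S X (\<lambda>x. ?\<sigma> (u x))"
      by (rule smooth_into_compose[OF X \<sigma> u]) simp
    fix x c assume x: "x \<in> ?S" and c: "c \<in> charts X"
    obtain W \<phi> where c': "c = (W, \<phi>)" by (cases c)
    have "dim (range (\<lambda>v. dir_deriv (model X) ?S (\<phi> \<circ> (\<lambda>x. ?\<sigma> (u x))) x v)) \<le> 1"
      if "?\<sigma> (u x) \<in> W"
    proof -
      have "\<exists>w. has_dir_deriv (model X) UNIV (\<phi> \<circ> ?\<sigma>) (u x) 1 w"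
        using bspec[OF spec[OF diff[unfolded chartwise_differentiable_def], of "u x"] c] that
        by (simp add: c')
      then obtain w where w: "has_dir_deriv (model X) UNIV (\<phi> \<circ> ?\<sigma>) (u x) 1 w" ..
      have "\<exists>d. dir_deriv (model X) ?S (\<phi> \<circ> (\<lambda>x. ?\<sigma> (u x))) x v = d *\<^sub>R w" for v
      proof -
        obtain d where "has_dir_deriv euclideanreal UNIV u x v d"
          using u[of "Suc 0"] unfolding Ck.simps(2) by blast
        then have "((\<lambda>h. u (x + h *\<^sub>R v)) has_real_derivative d) (at 0 within {h. x + h *\<^sub>R v \<in> ?S})"
          using has_dir_deriv_real_iff[of UNIV x] by (auto intro: has_field_derivative_at_within)
        from dir_deriv_eq[OF chain_rule_within[OF w this] at_line_strip[OF x]]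
        show ?thesis by (auto simp: o_def)
      qed
      then have "range (\<lambda>v. dir_deriv (model X) ?S (\<phi> \<circ> (\<lambda>x. ?\<sigma> (u x))) x v) \<subseteq> span {w}"
        unfolding span_singleton image_subset_iff by (metis rangeI)
      then show ?thesis using dim_le_card[of _ "{w}"] by force
    qed
    then show "case c of (W, \<phi>) \<Rightarrow> ?\<sigma> (u x) \<in> W \<longrightarrow>
        dim (range (dir_deriv (model X) ?S (\<phi> \<circ> (\<lambda>x. ?\<sigma> (u x))) x)) \<le> 1"
      by (simp add: c')
  qed
  moreover have "ft 0 = (\<lambda>\<theta>. \<theta>)" "ft 1 = f" by (auto simp: ft_def)
  moreover have "\<tau> \<in> extensional circle" using \<tau> by (auto simp: loops_def PiE_def)
  ultimately show ?thesis
    unfolding thin_pairs_def using reparam_id by fastforce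
qed

text \<open>
  Thinness in \<open>G \<times> G\<close> is stronger than thinness in both factors. It holds because both loops are
  reparametrized in the same way.
\<close>
lemma thin_pair_reparam_pair:
  assumes M: "frechet_manifold M" "coordinates (model M) L" and \<tau>: "\<tau>\<^sub>1 \<in> loops M" "\<tau>\<^sub>2 \<in> loops M"
    and f: "\<And>k. Ck euclideanreal UNIV k f" "degree_one f"
  shows "(loop_pair \<tau>\<^sub>1 \<tau>\<^sub>2, loop_pair (reparam \<tau>\<^sub>1 f) (reparam \<tau>\<^sub>2 f)) \<in> thin_pairs (prod_mfd M M)"
proof -
  have smooth: "smooth_into euclideanreal UNIV M (\<lambda>\<theta>. \<tau>\<^sub>1 (cis \<theta>))"
      "smooth_into euclideanreal UNIV M (\<lambda>\<theta>. \<tau>\<^sub>2 (cis \<theta>))"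
    using \<tau> by (auto simp: loops_def)
  have pair: "loop_pair \<tau>\<^sub>1 \<tau>\<^sub>2 (cis \<theta>) = (\<tau>\<^sub>1 (cis \<theta>), \<tau>\<^sub>2 (cis \<theta>))" for \<theta>
    by (simp add: loop_pair_def)
  have "loop_pair \<tau>\<^sub>1 \<tau>\<^sub>2 \<in> circle \<rightarrow>\<^sub>E points (prod_mfd M M)"
    using \<tau> by (auto simp: loop_pair_def loops_def prod_mfd_def)
  then have "loop_pair \<tau>\<^sub>1 \<tau>\<^sub>2 \<in> loops (prod_mfd M M)"
    using smooth_into_pair[OF M(2,2) smooth] by (simp add: loops_def pair)
  moreover have "chartwise_differentiable (prod_mfd M M) (\<lambda>\<theta>. loop_pair \<tau>\<^sub>1 \<tau>\<^sub>2 (cis \<theta>))"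
    unfolding pair using smooth
    by (intro chartwise_differentiable_pair chartwise_differentiable_smooth[OF M])
  moreover have "coordinates (model (prod_mfd M M)) ((\<lambda>l. l \<circ> fst) ` L \<union> (\<lambda>l. l \<circ> snd) ` L)"
    using coordinates_prod[OF M(2,2)] by (simp add: prod_mfd_def)
  ultimately have "(loop_pair \<tau>\<^sub>1 \<tau>\<^sub>2, reparam (loop_pair \<tau>\<^sub>1 \<tau>\<^sub>2) f) \<in> thin_pairs (prod_mfd M M)"
    by (intro thin_pair_reparam[OF _ _ _ f])
  moreover have "reparam (loop_pair \<tau>\<^sub>1 \<tau>\<^sub>2) f = loop_pair (reparam \<tau>\<^sub>1 f) (reparam \<tau>\<^sub>2 f)"
    by (auto simp: reparam_def loop_pair_def)
  ultimately show ?thesis by simp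
qed


section \<open>Loops with disjoint supports\<close>

text \<open>
  Charts replace continuity of the loop for the topology of the manifold: near a parameter \<open>x\<close> with
  \<open>\<tau> (cis x) \<noteq> e\<close>, either the value \<open>e\<close> is not attained nearby, or \<open>e\<close> lies in the chart at \<open>x\<close> and a
  coordinate tells the two points apart.
\<close>
lemma closed_loop_fibre:
  assumes X: "frechet_manifold X" "coordinates (model X) L" and \<tau>: "\<tau> \<in> loops X"
  shows "closed {\<theta>. \<tau> (cis \<theta>) = e}"
proof -
  interpret coordinates "model X" L by fact
  have smooth: "smooth_into euclideanreal UNIV X (\<lambda>\<theta>. \<tau> (cis \<theta>))" using \<tau> by (simp add: loops_def)
  have "\<exists>T. open T \<and> x \<in> T \<and> T \<subseteq> - {\<theta>. \<tau> (cis \<theta>) = e}" if x: "\<tau> (cis x) \<noteq> e" for x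
  proof -
    obtain A W \<phi> g where A: "open A" "x \<in> A" "(W, \<phi>) \<in> charts X"
      "smooth_on euclideanreal (model X) A g"
      "\<And>t. t \<in> A \<inter> UNIV \<Longrightarrow> \<tau> (cis t) \<in> W \<and> \<phi> (\<tau> (cis t)) = g t"
      using smooth_intoE[OF smooth UNIV_I[of x]] by metis
    show ?thesis
    proof (cases "\<exists>y\<in>A. \<tau> (cis y) = e")
      case True
      then obtain y where y: "y \<in> A" "\<tau> (cis y) = e" by blast
      have cont: "continuous_map (top_of_set A) (model X) g"
        using Ck_of_smooth_on[OF A(4), of 0] by simp
      have gA: "g \<in> A \<rightarrow> topspace (model X)" using continuous_map_funspace[OF cont] by simp
      have "inj_on \<phi> W" using X(1) A(3) by (auto simp: frechet_manifold_def)
      then have "\<phi> (\<tau> (cis x)) \<noteq> \<phi> (\<tau> (cis y))"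
        using A(5)[of x] A(5)[of y] A(2) y x inj_onD[of \<phi> W "\<tau> (cis x)" "\<tau> (cis y)"] by auto
      then have "g x \<noteq> g y" using A(2,5) y(1) by simp
      then obtain l where l: "l \<in> L" "l (g x) \<noteq> l (g y)"
        using coord_eqI[of "g x" "g y"] gA A(2) y(1) by blast
      have "continuous_on A (\<lambda>t. l (g t))"
        using cont l(1) by (simp add: continuous_map_coordinates)
      then have "open ((\<lambda>t. l (g t)) -` (- {l (g y)}) \<inter> A)"
        using A(1) continuous_on_open_vimage[of A "\<lambda>t. l (g t)"] by (simp add: open_Compl)
      moreover have "g t = g y" if "t \<in> A" "\<tau> (cis t) = e" for t
        using A(5)[of t] A(5)[of y] y that by simp
      ultimately show ?thesis using A(2) l(2) by (intro exI[of _ "(\<lambda>t. l (g t)) -` (- {l (g y)}) \<inter> A"]) auto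
    next
      case False
      then show ?thesis using A(1,2) by blast
    qed
  qed
  then have "open (- {\<theta>. \<tau> (cis \<theta>) = e})" by (subst open_subopen) simp
  then show ?thesis by (simp add: closed_def)
qed

text \<open>
  Cutting the circle at a point of \<open>I\<^sub>2\<close> turns \<open>I\<^sub>1\<close> into an interval \<open>J\<close> of the line inside one period.
  Its end points \<open>a\<close> and \<open>b\<close> divide the circle into two arcs. Each loop is trivial on the
  interior of the arc that does not belong to it, hence on the closed arc by \<open>closed_loop_fibre\<close>; an arc
  that is reduced to a point is treated directly.
\<close>
lemma disjoint_supports_split_circle:
  assumes X: "frechet_manifold X" "coordinates (model X) L" and \<tau>: "\<tau>\<^sub>1 \<in> loops X" "\<tau>\<^sub>2 \<in> loops X"
    and I: "circle_interval I\<^sub>1" "circle_interval I\<^sub>2" "I\<^sub>1 \<inter> I\<^sub>2 = {}" "I\<^sub>1 \<noteq> {}" "I\<^sub>2 \<noteq> {}"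
    and supp: "supported_on G \<tau>\<^sub>1 I\<^sub>1" "supported_on G \<tau>\<^sub>2 I\<^sub>2"
  obtains a b where "a \<le> b" "b \<le> a + 2 * pi"
    "\<And>\<theta>. \<theta> \<in> {b..a + 2 * pi} \<Longrightarrow> \<tau>\<^sub>1 (cis \<theta>) = \<one>\<^bsub>G\<^esub>" "\<And>\<theta>. \<theta> \<in> {a..b} \<Longrightarrow> \<tau>\<^sub>2 (cis \<theta>) = \<one>\<^bsub>G\<^esub>"
proof -
  obtain J where J: "is_interval J" "I\<^sub>1 = cis ` J" using I(1) by (auto simp: circle_interval_def)
  obtain c0 where c0: "cis c0 \<in> I\<^sub>2" using I(2,5) by (auto simp: circle_interval_def)
  obtain \<theta>\<^sub>1 where \<theta>\<^sub>1: "\<theta>\<^sub>1 \<in> J" using I(4) J(2) by blast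
  \<comment> \<open>Choose the argument \<open>c\<close> of a point of \<open>I\<^sub>2\<close> such that \<open>\<theta>\<^sub>1\<close> lies in the period starting at \<open>c\<close>.\<close>
  define k where "k = \<lfloor>(\<theta>\<^sub>1 - c0) / (2 * pi)\<rfloor>"
  define c where "c = c0 + 2 * pi * of_int k"
  have "of_int k \<le> (\<theta>\<^sub>1 - c0) / (2 * pi)" "(\<theta>\<^sub>1 - c0) / (2 * pi) < of_int k + 1"
    by (auto simp: k_def)
  then have c\<theta>: "c \<le> \<theta>\<^sub>1" "\<theta>\<^sub>1 \<le> c + 2 * pi"
    by (auto simp: c_def field_simps)
  have "cis c = cis c0" using cis_eq_iff[of c c0] by (auto simp: c_def)
  then have c2: "cis c \<in> I\<^sub>2" "cis (c + 2 * pi) = cis c" using c0 cis_eq_iff[of "c + 2 * pi" c] by (auto intro: exI[of _ 1])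
  have cJ: "c \<notin> J" "c + 2 * pi \<notin> J" using c2 I(3) J(2) by (metis IntI empty_iff imageI)+
  have Jc: "c \<le> \<theta> \<and> \<theta> \<le> c + 2 * pi" if "\<theta> \<in> J" for \<theta>
    using mem_is_interval_1_I[OF J(1) that \<theta>\<^sub>1, of c] mem_is_interval_1_I[OF J(1) \<theta>\<^sub>1 that, of "c + 2 * pi"]
      cJ c\<theta> by linarith
  then have bdd: "bdd_below J" "bdd_above J" by (auto intro!: bdd_belowI[of _ c] bdd_aboveI[of _ "c + 2 * pi"])
  define a where "a = Inf J"
  define b where "b = Sup J"
  have ab: "a \<le> \<theta> \<and> \<theta> \<le> b" if "\<theta> \<in> J" for \<theta>
    using that bdd by (auto simp: a_def b_def intro: cInf_lower cSup_upper)
  have "a \<le> b" using ab[OF \<theta>\<^sub>1] by simp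
  have ca: "c \<le> a" and bc: "b \<le> c + 2 * pi"
    unfolding a_def b_def using Jc \<theta>\<^sub>1 by (auto intro!: cInf_greatest cSup_least)
  have one1: "\<tau>\<^sub>1 z = \<one>\<^bsub>G\<^esub>" if "z \<in> circle" "z \<notin> I\<^sub>1" for z
    using supp(1) that by (simp add: supported_on_def)
  have one2: "\<tau>\<^sub>2 z = \<one>\<^bsub>G\<^esub>" if "z \<in> I\<^sub>1" for z
  proof -
    have "z \<in> circle" "z \<notin> I\<^sub>2" using that I(3) J(2) by auto
    then show ?thesis using supp(2) by (simp add: supported_on_def)
  qed
  have closure: "\<tau> (cis \<theta>) = e" if "\<tau> \<in> loops X" "x < y" "\<And>\<theta>. x < \<theta> \<Longrightarrow> \<theta> < y \<Longrightarrow> \<tau> (cis \<theta>) = e" "\<theta> \<in> {x..y}"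
    for \<tau> x y e \<theta>
  proof -
    have "closure {x<..<y} \<subseteq> {\<theta>. \<tau> (cis \<theta>) = e}"
      using that by (intro closure_minimal closed_loop_fibre[OF X]) auto
    then show ?thesis using that closure_greaterThanLessThan[of x y] by auto
  qed
  have "\<tau>\<^sub>2 (cis \<theta>) = \<one>\<^bsub>G\<^esub>" if "\<theta> \<in> {a..b}" for \<theta>
  proof (cases "a < b")
    case True
    have "x \<in> J" if "a < x" "x < b" for x
    proof -
      have "J \<noteq> {}" using \<theta>\<^sub>1 by blast
      then have "\<exists>j\<in>J. j < x" "\<exists>j\<in>J. x < j"
        using that cInf_less_iff[OF _ bdd(1), of x] less_cSup_iff[OF _ bdd(2), of x]
        by (simp_all add: a_def b_def)
      then obtain j j' where "j \<in> J" "j < x" "j' \<in> J" "x < j'" by blast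
      then show ?thesis using mem_is_interval_1_I[OF J(1), of j j' x] by simp
    qed
    then show ?thesis
      using closure[OF \<tau>(2) True _ that, of "\<one>\<^bsub>G\<^esub>"] one2 J(2) by blast
  next
    case False
    then have "\<theta> = \<theta>\<^sub>1" using that ab[OF \<theta>\<^sub>1] by simp
    then show ?thesis using one2 J(2) \<theta>\<^sub>1 by blast
  qed
  moreover have "\<tau>\<^sub>1 (cis \<theta>) = \<one>\<^bsub>G\<^esub>" if "\<theta> \<in> {b..a + 2 * pi}" for \<theta>
  proof (cases "b < a + 2 * pi")
    case True
    have "cis x \<notin> I\<^sub>1" if x: "b < x" "x < a + 2 * pi" for x
    proof
      assume "cis x \<in> I\<^sub>1"
      then obtain j where j: "j \<in> J" "cis x = cis j" using J(2) by blast
      then obtain m :: int where m: "x = j + 2 * pi * of_int m" using cis_eq_iff by blast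
      have "0 < 2 * pi * of_int m" "2 * pi * of_int m < 2 * pi" using ab[OF j(1)] x m by linarith+
      then have "0 < m" "real_of_int m < 1"
        using mult_less_cancel_left_pos[of "2 * pi" "of_int m" 1] by (simp_all add: zero_less_mult_iff)
      then show False by simp
    qed
    then show ?thesis using closure[OF \<tau>(1) True _ that, of "\<one>\<^bsub>G\<^esub>"] one1 by simp
  next
    case False
    \<comment> \<open>Here \<open>I\<^sub>1\<close> is the complement of the cut point, and the other arc is reduced to that point.\<close>
    then have "\<theta> = c + 2 * pi" using that ca bc by simp
    then show ?thesis using one1[of "cis (c + 2 * pi)"] c2 I(3) by auto
  qed
  moreover have "b \<le> a + 2 * pi" using ca bc by simp
  ultimately show thesis using that \<open>a \<le> b\<close> by blast
qed


section \<open>Loops as pairs of paths\<close>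

lemma unit_interval_Arg2pi: "Arg2pi z / (2 * pi) \<in> {0..1}"
  using Arg2pi_ge_0[of z] Arg2pi_lt_2pi[of z] by (simp add: field_simps)

definition const_path :: "'g monoid \<Rightarrow> real \<Rightarrow> 'g"
  where "const_path G = (\<lambda>t\<in>{0..1}. \<one>\<^bsub>G\<^esub>)"

lemma path_cup_eqI:
  assumes "\<tau> \<in> extensional circle"
    and "\<And>s. 0 \<le> s \<Longrightarrow> s \<le> 1 \<Longrightarrow> \<gamma>\<^sub>1 s = \<tau> (cis (pi * s))"
    and "\<And>s. 0 \<le> s \<Longrightarrow> s \<le> 1 \<Longrightarrow> \<gamma>\<^sub>2 s = \<tau> (cis (2 * pi - pi * s))"
  shows "\<gamma>\<^sub>1 \<squnion>\<^sub>p \<gamma>\<^sub>2 = \<tau>"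
proof
  fix z show "(\<gamma>\<^sub>1 \<squnion>\<^sub>p \<gamma>\<^sub>2) z = \<tau> z"
  proof (cases "z \<in> circle")
    case True
    define x where "x = Arg2pi z / (2 * pi)"
    have x: "0 \<le> x" "x \<le> 1" using unit_interval_Arg2pi[of z] by (auto simp: x_def)
    have z: "cis (2 * pi * x) = z" using cis_Arg2pi_circle[OF True] by (simp add: x_def)
    have "path_comp (path_rev \<gamma>\<^sub>2) \<gamma>\<^sub>1 x = \<tau> (cis (2 * pi * x))"
    proof (cases "x \<le> 1 / 2")
      case True
      then show ?thesis using assms(2)[of "2 * x"] x by (simp add: path_comp_def mult_ac)
    next
      case False
      then have "\<gamma>\<^sub>2 (1 - (2 * x - 1)) = \<tau> (cis (2 * pi * x))"
        using assms(3)[of "1 - (2 * x - 1)"] x by (simp add: algebra_simps)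
      then show ?thesis using False x by (simp add: path_comp_def path_rev_def)
    qed
    then show ?thesis using True z by (simp add: path_cup_def x_def)
  next
    case False
    then show ?thesis using assms(1) by (simp add: path_cup_def extensional_def)
  qed
qed

lemma loop_segment_path:
  assumes "coordinates (model X) L" "\<tau> \<in> loops X" "\<And>k. Ck euclideanreal UNIV k u"
    and "\<And>t. 0 \<le> t \<Longrightarrow> t < 1 / 6 \<Longrightarrow> u t = u 0" "\<And>t. 5 / 6 < t \<Longrightarrow> t \<le> 1 \<Longrightarrow> u t = u 1"
  shows "(\<lambda>t\<in>{0..1}. \<tau> (cis (u t))) \<in> paths X"
proof -
  have \<tau>: "\<tau> \<in> circle \<rightarrow>\<^sub>E points X" "smooth_into euclideanreal UNIV X (\<lambda>\<theta>. \<tau> (cis \<theta>))"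
    using assms(2) by (auto simp: loops_def)
  have "smooth_into euclidean {0..1} X (\<lambda>t. \<tau> (cis (u t)))"
    by (rule smooth_into_compose[OF assms(1) \<tau>(2) assms(3)]) simp
  then have "smooth_into euclideanreal {0..1} X (\<lambda>t\<in>{0..1}. \<tau> (cis (u t)))"
    by (rule smooth_into_cong[rotated]) simp
  moreover have "(\<lambda>t\<in>{0..1}. \<tau> (cis (u t))) \<in> {0..1} \<rightarrow>\<^sub>E points X"
    using \<tau>(1) by (auto simp: PiE_iff)
  moreover have "\<exists>e>0. \<forall>t\<in>{0..1}.
      (t < e \<longrightarrow> (\<lambda>t\<in>{0..1}. \<tau> (cis (u t))) t = (\<lambda>t\<in>{0..1}. \<tau> (cis (u t))) 0) \<and>
      (1 - e < t \<longrightarrow> (\<lambda>t\<in>{0..1}. \<tau> (cis (u t))) t = (\<lambda>t\<in>{0..1}. \<tau> (cis (u t))) 1)"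
  proof (intro exI[of _ "1 / 6"] conjI ballI impI)
    fix t :: real assume t: "t \<in> {0..1}"
    {
      assume "t < 1 / 6"
      then have "u t = u 0" using assms(4)[of t] t by simp
      then show "(\<lambda>t\<in>{0..1}. \<tau> (cis (u t))) t = (\<lambda>t\<in>{0..1}. \<tau> (cis (u t))) 0" using t by simp
    next
      assume "1 - 1 / 6 < t"
      then have "u t = u 1" using assms(5)[of t] t by simp
      then show "(\<lambda>t\<in>{0..1}. \<tau> (cis (u t))) t = (\<lambda>t\<in>{0..1}. \<tau> (cis (u t))) 1" using t by simp
    }
  qed simp
  ultimately show ?thesis by (simp only: paths_def mem_Collect_eq simp_thms)
qed


section \<open>The unit of the extension is neutral for fusion\<close>

locale multiplicative_fusion_extension =
  fixes n :: nat and G :: "'g monoid" and M :: "('g, nat \<Rightarrow> real) mfd"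
    and E :: "('g, 'l, 'w::real_vector) extension" and lam :: "('g, 'l) fusion"
  assumes lie: "lie_group n G M" and ext: "central_extension n G M E"
    and fus: "fusion_product M E lam" and mult: "multiplicative_fusion G M E lam"
begin

abbreviation ext_mult (infixl "\<cdot>" 70) where "p \<cdot> q \<equiv> p \<otimes>\<^bsub>ext_group E\<^esub> q"
abbreviation triv where "triv \<equiv> const_path G"
abbreviation unit_loop :: "complex \<Rightarrow> 'g" where "unit_loop \<equiv> \<lambda>z\<in>circle. \<one>\<^bsub>G\<^esub>"

sublocale G: group G
  using lie by (simp add: lie_group_def frechet_lie_group_def)

sublocale L: group "ext_group E"
  using ext by (simp add: central_extension_def frechet_lie_group_def)

lemma mfd: "frechet_manifold M" "points M = carrier G"
  and coords: "coordinates (model M) (range (\<lambda>i x. x i))"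
  using lie coordinates_Euclidean_space by (auto simp: lie_group_def frechet_lie_group_def)

lemma loop_closed: "\<tau> \<in> loops M \<Longrightarrow> \<tau> \<in> circle \<rightarrow>\<^sub>E carrier G"
  using mfd(2) by (auto simp: loops_def)

lemma mult_loop: "\<tau> \<otimes>\<^bsub>loop_group G M\<^esub> \<sigma> = (\<lambda>z\<in>circle. \<tau> z \<otimes>\<^bsub>G\<^esub> \<sigma> z)"
  by (simp add: loop_group_def)

lemma one_loop: "\<one>\<^bsub>loop_group G M\<^esub> = unit_loop"
  by (simp add: loop_group_def)

lemma proj_mult:
  assumes "p \<in> carrier (ext_group E)" "q \<in> carrier (ext_group E)"
  shows "proj E (p \<cdot> q) = (\<lambda>z\<in>circle. proj E p z \<otimes>\<^bsub>G\<^esub> proj E q z)"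
proof -
  have "proj E \<in> hom (ext_group E) (loop_group G M)" using ext by (simp add: central_extension_def)
  from hom_mult[OF this assms] show ?thesis by (simp add: mult_loop)
qed

lemma proj_loops: "p \<in> carrier (ext_group E) \<Longrightarrow> proj E p \<in> loops M"
  using ext by (auto simp: central_extension_def)

lemma fibre_closed: "p \<in> fibre E \<tau> \<Longrightarrow> p \<in> carrier (ext_group E)"
  by (simp add: fibre_def)

lemma fibre_loop: "p \<in> fibre E \<tau> \<Longrightarrow> \<tau> \<in> loops M"
  using proj_loops by (auto simp: fibre_def)

lemma fibre_mult:
  assumes "p \<in> fibre E \<tau>" "q \<in> fibre E \<sigma>"
  shows "p \<cdot> q \<in> fibre E (\<tau> \<otimes>\<^bsub>loop_group G M\<^esub> \<sigma>)"
  using assms proj_mult[of p q] by (simp add: fibre_def mult_loop)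

lemma incl_closed: "z \<in> circle \<Longrightarrow> incl E z \<in> carrier (ext_group E)"
  using ext by (auto simp: central_extension_def U1_def hom_def)

lemma kernel_eq: "p \<in> fibre E unit_loop \<longleftrightarrow> (\<exists>z\<in>circle. p = incl E z)"
proof -
  have "incl E ` circle = kernel (ext_group E) (loop_group G M) (proj E)"
    using ext by (simp add: central_extension_def)
  then show ?thesis by (auto simp: fibre_def kernel_def one_loop)
qed

lemma unit_fibre_central:
  assumes "p \<in> fibre E unit_loop" "q \<in> carrier (ext_group E)"
  shows "p \<cdot> q = q \<cdot> p"
  using assms ext by (auto simp: kernel_eq central_extension_def)

lemma one_fibre: "\<one>\<^bsub>ext_group E\<^esub> \<in> fibre E unit_loop"
proof -
  have "incl E \<in> hom U1 (ext_group E)" using ext by (simp add: central_extension_def)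
  from hom_mult[OF this, of 1 1] have "incl E 1 \<cdot> incl E 1 = incl E 1"
    by (simp add: U1_def)
  then have "incl E 1 = \<one>\<^bsub>ext_group E\<^esub>"
    using incl_closed[of 1] L.l_cancel_one by simp
  then show ?thesis by (metis kernel_eq mem_sphere_0 norm_one)
qed

text \<open>
  By exactness: the quotient of two elements of a fibre lies in the kernel of the projection.
\<close>
lemma fibre_torsor:
  assumes p: "p \<in> fibre E \<tau>" and q: "q \<in> fibre E \<tau>"
  obtains z where "z \<in> circle" "q = p \<cdot> incl E z"
proof -
  define r where "r = inv\<^bsub>ext_group E\<^esub> p \<cdot> q"
  have r: "r \<in> carrier (ext_group E)" using p q by (simp add: r_def fibre_closed)
  have q_eq: "q = p \<cdot> r"
    using p q by (simp add: r_def fibre_closed L.m_assoc[symmetric])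
  have "proj E r z = \<one>\<^bsub>G\<^esub>" if z: "z \<in> circle" for z
  proof -
    have "\<tau> z = \<tau> z \<otimes>\<^bsub>G\<^esub> proj E r z"
      using proj_mult[OF fibre_closed[OF p] r] p q z by (simp add: fibre_def q_eq fun_eq_iff) metis
    moreover have "\<tau> z \<in> carrier G" "proj E r z \<in> carrier G"
      using loop_closed[OF fibre_loop[OF p]] loop_closed[OF proj_loops[OF r]] z by auto
    ultimately show ?thesis using G.l_cancel_one[of "\<tau> z" "proj E r z"] by simp
  qed
  then have "proj E r = unit_loop"
    using loop_closed[OF proj_loops[OF r]] by (auto simp: fun_eq_iff PiE_def extensional_def)
  then show thesis using r q_eq that kernel_eq[of r] by (auto simp: fibre_def)
qed

lemma triv_cup_triv: "triv \<squnion>\<^sub>p triv = unit_loop"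
  by (rule path_cup_eqI) (auto simp: const_path_def)

lemma path_mult_triv:
  assumes "\<gamma> \<in> paths M"
  shows "path_mult G triv \<gamma> = \<gamma>" "path_mult G \<gamma> triv = \<gamma>"
proof -
  have "\<gamma> \<in> {0..1} \<rightarrow>\<^sub>E carrier G" using assms mfd(2) by (simp add: paths_def)
  then show "path_mult G triv \<gamma> = \<gamma>" "path_mult G \<gamma> triv = \<gamma>"
    by (auto simp: path_mult_def const_path_def fun_eq_iff PiE_iff extensional_def)
qed

lemma lam_fibre:
  assumes "coterminal M {\<gamma>\<^sub>1, \<gamma>\<^sub>2, \<gamma>\<^sub>3}" "p \<in> fibre E (\<gamma>\<^sub>1 \<squnion>\<^sub>p \<gamma>\<^sub>2)" "q \<in> fibre E (\<gamma>\<^sub>2 \<squnion>\<^sub>p \<gamma>\<^sub>3)"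
  shows "lam \<gamma>\<^sub>1 \<gamma>\<^sub>2 \<gamma>\<^sub>3 p q \<in> fibre E (\<gamma>\<^sub>1 \<squnion>\<^sub>p \<gamma>\<^sub>3)"
  using fus assms unfolding fusion_product_def by blast

lemma lam_incl:
  assumes "coterminal M {\<gamma>\<^sub>1, \<gamma>\<^sub>2, \<gamma>\<^sub>3}" "p \<in> fibre E (\<gamma>\<^sub>1 \<squnion>\<^sub>p \<gamma>\<^sub>2)" "q \<in> fibre E (\<gamma>\<^sub>2 \<squnion>\<^sub>p \<gamma>\<^sub>3)"
    and "z \<in> circle"
  shows "lam \<gamma>\<^sub>1 \<gamma>\<^sub>2 \<gamma>\<^sub>3 (p \<cdot> incl E z) q = lam \<gamma>\<^sub>1 \<gamma>\<^sub>2 \<gamma>\<^sub>3 p q \<cdot> incl E z"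
    and "lam \<gamma>\<^sub>1 \<gamma>\<^sub>2 \<gamma>\<^sub>3 p (q \<cdot> incl E z) = lam \<gamma>\<^sub>1 \<gamma>\<^sub>2 \<gamma>\<^sub>3 p q \<cdot> incl E z"
  using fus assms unfolding fusion_product_def by blast+

lemma lam_assoc:
  assumes "coterminal M {\<gamma>\<^sub>1, \<gamma>\<^sub>2, \<gamma>\<^sub>3, \<gamma>\<^sub>4}" "p \<in> fibre E (\<gamma>\<^sub>1 \<squnion>\<^sub>p \<gamma>\<^sub>2)"
    and "q \<in> fibre E (\<gamma>\<^sub>2 \<squnion>\<^sub>p \<gamma>\<^sub>3)" "r \<in> fibre E (\<gamma>\<^sub>3 \<squnion>\<^sub>p \<gamma>\<^sub>4)"
  shows "lam \<gamma>\<^sub>1 \<gamma>\<^sub>3 \<gamma>\<^sub>4 (lam \<gamma>\<^sub>1 \<gamma>\<^sub>2 \<gamma>\<^sub>3 p q) r = lam \<gamma>\<^sub>1 \<gamma>\<^sub>2 \<gamma>\<^sub>4 p (lam \<gamma>\<^sub>2 \<gamma>\<^sub>3 \<gamma>\<^sub>4 q r)"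
  using fus assms unfolding fusion_product_def by blast

lemma lam_mult:
  assumes "coterminal M {\<gamma>\<^sub>1, \<gamma>\<^sub>2, \<gamma>\<^sub>3}" "coterminal M {\<gamma>\<^sub>1', \<gamma>\<^sub>2', \<gamma>\<^sub>3'}"
    and "p \<in> fibre E (\<gamma>\<^sub>1 \<squnion>\<^sub>p \<gamma>\<^sub>2)" "q \<in> fibre E (\<gamma>\<^sub>2 \<squnion>\<^sub>p \<gamma>\<^sub>3)"
    and "p' \<in> fibre E (\<gamma>\<^sub>1' \<squnion>\<^sub>p \<gamma>\<^sub>2')" "q' \<in> fibre E (\<gamma>\<^sub>2' \<squnion>\<^sub>p \<gamma>\<^sub>3')"
  shows "lam \<gamma>\<^sub>1 \<gamma>\<^sub>2 \<gamma>\<^sub>3 p q \<cdot> lam \<gamma>\<^sub>1' \<gamma>\<^sub>2' \<gamma>\<^sub>3' p' q' =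
    lam (path_mult G \<gamma>\<^sub>1 \<gamma>\<^sub>1') (path_mult G \<gamma>\<^sub>2 \<gamma>\<^sub>2') (path_mult G \<gamma>\<^sub>3 \<gamma>\<^sub>3') (p \<cdot> p') (q \<cdot> q')"
  using mult assms unfolding multiplicative_fusion_def by blast

lemma incl_cancel:
  assumes "p \<in> carrier (ext_group E)" "z \<in> circle" "p \<cdot> incl E z = p"
  shows "incl E z = \<one>\<^bsub>ext_group E\<^esub>"
  using assms(3) L.l_cancel_one[OF assms(1) incl_closed[OF assms(2)]] by simp

lemma coterminal_mono: "coterminal M \<Gamma> \<Longrightarrow> \<Gamma>' \<subseteq> \<Gamma> \<Longrightarrow> coterminal M \<Gamma>'"
  by (auto simp: coterminal_def subset_iff)

text \<open>By multiplicativity, fusing the unit with itself gives an idempotent of the group.\<close>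
lemma lam_triv:
  assumes "triv \<in> paths M"
  shows "lam triv triv triv \<one>\<^bsub>ext_group E\<^esub> \<one>\<^bsub>ext_group E\<^esub> = \<one>\<^bsub>ext_group E\<^esub>"
proof -
  let ?c = "lam triv triv triv \<one>\<^bsub>ext_group E\<^esub> \<one>\<^bsub>ext_group E\<^esub>"
  have co: "coterminal M {triv, triv, triv}" using assms by (simp add: coterminal_def)
  have one: "\<one>\<^bsub>ext_group E\<^esub> \<in> fibre E (triv \<squnion>\<^sub>p triv)" by (simp add: triv_cup_triv one_fibre)
  have "?c \<cdot> ?c = ?c"
    using lam_mult[OF co co one one one one] by (simp add: path_mult_triv[OF assms])
  moreover have "?c \<in> carrier (ext_group E)" using lam_fibre[OF co one one] by (rule fibre_closed)
  ultimately show ?thesis using L.r_cancel_one[of ?c ?c] by simp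
qed

text \<open>
  Fusion with the unit differs from the identity by a factor in U(1), since it preserves the fibre.
  It is idempotent by associativity and \<open>lam_triv\<close>, and it commutes with the action of U(1). So the
  factor is \<open>1\<close>.
\<close>
lemma lam_unit_right:
  assumes co: "coterminal M {\<gamma>, triv}" and p: "p \<in> fibre E (\<gamma> \<squnion>\<^sub>p triv)"
  shows "lam \<gamma> triv triv p \<one>\<^bsub>ext_group E\<^esub> = p"
proof -
  let ?l = "\<lambda>p. lam \<gamma> triv triv p \<one>\<^bsub>ext_group E\<^esub>"
  have triv: "triv \<in> paths M" using co by (simp add: coterminal_def)
  have co3: "coterminal M {\<gamma>, triv, triv}" and co4: "coterminal M {\<gamma>, triv, triv, triv}"
    using co by simp_all
  have one: "\<one>\<^bsub>ext_group E\<^esub> \<in> fibre E (triv \<squnion>\<^sub>p triv)" by (simp add: triv_cup_triv one_fibre)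
  have lp: "?l p \<in> fibre E (\<gamma> \<squnion>\<^sub>p triv)" by (rule lam_fibre[OF co3 p one])
  then obtain z where z: "z \<in> circle" "?l p = p \<cdot> incl E z" using fibre_torsor[OF p] by metis
  have "?l (?l p) = ?l p"
    using lam_assoc[OF co4 p one one] by (simp add: lam_triv[OF triv])
  moreover have "?l (p \<cdot> incl E z) = ?l p \<cdot> incl E z" by (rule lam_incl(1)[OF co3 p one z(1)])
  ultimately have "?l p \<cdot> incl E z = ?l p" using z(2) by simp
  then have "incl E z = \<one>\<^bsub>ext_group E\<^esub>" by (rule incl_cancel[OF fibre_closed[OF lp] z(1)])
  then show ?thesis using z(2) p by (simp add: fibre_closed)
qed

lemma lam_unit_left:
  assumes co: "coterminal M {\<gamma>, triv}" and p: "p \<in> fibre E (triv \<squnion>\<^sub>p \<gamma>)"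
  shows "lam triv triv \<gamma> \<one>\<^bsub>ext_group E\<^esub> p = p"
proof -
  let ?l = "\<lambda>p. lam triv triv \<gamma> \<one>\<^bsub>ext_group E\<^esub> p"
  have triv: "triv \<in> paths M" using co by (simp add: coterminal_def)
  have co3: "coterminal M {triv, triv, \<gamma>}" and co4: "coterminal M {triv, triv, triv, \<gamma>}"
    using co by (simp_all add: insert_commute)
  have one: "\<one>\<^bsub>ext_group E\<^esub> \<in> fibre E (triv \<squnion>\<^sub>p triv)" by (simp add: triv_cup_triv one_fibre)
  have lp: "?l p \<in> fibre E (triv \<squnion>\<^sub>p \<gamma>)" by (rule lam_fibre[OF co3 one p])
  then obtain z where z: "z \<in> circle" "?l p = p \<cdot> incl E z" using fibre_torsor[OF p] by metis
  have "?l (?l p) = ?l p"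
    using lam_assoc[OF co4 one one p] by (simp add: lam_triv[OF triv])
  moreover have "?l (p \<cdot> incl E z) = ?l p \<cdot> incl E z" by (rule lam_incl(2)[OF co3 one p z(1)])
  ultimately have "?l p \<cdot> incl E z = ?l p" using z(2) by simp
  then have "incl E z = \<one>\<^bsub>ext_group E\<^esub>" by (rule incl_cancel[OF fibre_closed[OF lp] z(1)])
  then show ?thesis using z(2) p by (simp add: fibre_closed)
qed

text \<open>
  The Eckmann--Hilton argument: both orders of the product are the same fusion, because the constant
  path is the unit for pointwise multiplication of paths and the unit of the extension is inserted
  in complementary places.
\<close>
lemma half_loops_commute:
  assumes co: "coterminal M {\<gamma>\<^sub>1, triv, \<gamma>\<^sub>2}"
    and p: "p \<in> fibre E (\<gamma>\<^sub>1 \<squnion>\<^sub>p triv)" and q: "q \<in> fibre E (triv \<squnion>\<^sub>p \<gamma>\<^sub>2)"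
  shows "p \<cdot> q = q \<cdot> p"
proof -
  let ?e = "\<one>\<^bsub>ext_group E\<^esub>"
  have co1: "coterminal M {\<gamma>\<^sub>1, triv}" and co2: "coterminal M {\<gamma>\<^sub>2, triv}"
    using coterminal_mono[OF co] by auto
  have co1': "coterminal M {\<gamma>\<^sub>1, triv, triv}" and co2': "coterminal M {triv, triv, \<gamma>\<^sub>2}"
    using co1 co2 by (simp_all add: insert_commute)
  have paths: "\<gamma>\<^sub>1 \<in> paths M" "triv \<in> paths M" "\<gamma>\<^sub>2 \<in> paths M" using co by (simp_all add: coterminal_def)
  have e: "?e \<in> fibre E (triv \<squnion>\<^sub>p triv)" by (simp add: triv_cup_triv one_fibre)
  have pq: "p \<in> carrier (ext_group E)" "q \<in> carrier (ext_group E)" using p q by (simp_all add: fibre_closed)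
  have "lam \<gamma>\<^sub>1 triv triv p ?e \<cdot> lam triv triv \<gamma>\<^sub>2 ?e q = lam \<gamma>\<^sub>1 triv \<gamma>\<^sub>2 p q"
    using lam_mult[OF co1' co2' p e e q] pq by (simp add: path_mult_triv paths)
  moreover have "lam triv triv \<gamma>\<^sub>2 ?e q \<cdot> lam \<gamma>\<^sub>1 triv triv p ?e = lam \<gamma>\<^sub>1 triv \<gamma>\<^sub>2 p q"
    using lam_mult[OF co2' co1' e q p e] pq by (simp add: path_mult_triv paths)
  ultimately show ?thesis using lam_unit_right[OF co1 p] lam_unit_left[OF co2 q] by simp
qed

end


section \<open>Disjoint commutativity\<close>

lemma thin_transport_fibre:
  assumes "thin_structure M E d" "(\<tau>\<^sub>0, \<tau>\<^sub>1) \<in> thin_pairs M"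
  shows "\<And>p. p \<in> fibre E \<tau>\<^sub>0 \<Longrightarrow> d \<tau>\<^sub>0 \<tau>\<^sub>1 p \<in> fibre E \<tau>\<^sub>1" and "inj_on (d \<tau>\<^sub>0 \<tau>\<^sub>1) (fibre E \<tau>\<^sub>0)"
proof -
  let ?D = "\<lambda>((\<tau>\<^sub>0, \<tau>\<^sub>1), p). ((\<tau>\<^sub>0, \<tau>\<^sub>1), d \<tau>\<^sub>0 \<tau>\<^sub>1 p)"
  have bij: "bij_betw ?D (pullback_total E (thin_pairs M) fst) (pullback_total E (thin_pairs M) snd)"
    using assms(1) by (simp add: thin_structure_def Let_def)
  have mem: "((\<tau>\<^sub>0, \<tau>\<^sub>1), p) \<in> pullback_total E (thin_pairs M) fst" if "p \<in> fibre E \<tau>\<^sub>0" for p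
    using that assms(2) by (simp add: pullback_total_def)
  show "d \<tau>\<^sub>0 \<tau>\<^sub>1 p \<in> fibre E \<tau>\<^sub>1" if "p \<in> fibre E \<tau>\<^sub>0" for p
    using bspec[OF bij_betwE[OF bij] mem[OF that]] by (simp add: pullback_total_def)
  show "inj_on (d \<tau>\<^sub>0 \<tau>\<^sub>1) (fibre E \<tau>\<^sub>0)"
  proof (rule inj_onI)
    fix p q assume "p \<in> fibre E \<tau>\<^sub>0" "q \<in> fibre E \<tau>\<^sub>0" "d \<tau>\<^sub>0 \<tau>\<^sub>1 p = d \<tau>\<^sub>0 \<tau>\<^sub>1 q"
    then show "p = q"
      using inj_onD[OF bij_betw_imp_inj_on[OF bij] _ mem mem, of p q] by simp
  qed
qed

theorem theorem3p3p1:
  fixes n :: nat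
    and G :: "'g monoid"
    and M :: "('g, nat \<Rightarrow> real) mfd"
    and E :: "('g, 'l, 'w::real_vector) extension"
    and lam :: "('g, 'l) fusion"
    and d :: "('g, 'l) thin_transport"
  assumes "lie_group n G M"
    and "central_extension n G M E"
    and "fusion_product M E lam" and "multiplicative_fusion G M E lam"
    and "thin_structure M E d" and "multiplicative_thin G M E d" and "fusive M E lam d"
  shows "\<forall>\<tau>\<^sub>1\<in>loops M. \<forall>\<tau>\<^sub>2\<in>loops M. \<forall>I\<^sub>1 I\<^sub>2.
    circle_interval I\<^sub>1 \<and> circle_interval I\<^sub>2 \<and> I\<^sub>1 \<inter> I\<^sub>2 = {} \<and>
    supported_on G \<tau>\<^sub>1 I\<^sub>1 \<and> supported_on G \<tau>\<^sub>2 I\<^sub>2 \<longrightarrow>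
    (\<forall>p\<^sub>1\<in>fibre E \<tau>\<^sub>1. \<forall>p\<^sub>2\<in>fibre E \<tau>\<^sub>2. p\<^sub>1 \<otimes>\<^bsub>ext_group E\<^esub> p\<^sub>2 = p\<^sub>2 \<otimes>\<^bsub>ext_group E\<^esub> p\<^sub>1)"
proof (intro ballI allI impI)
  interpret multiplicative_fusion_extension n G M E lam
    using assms(1-4) by unfold_locales
  fix \<tau>\<^sub>1 \<tau>\<^sub>2 I\<^sub>1 I\<^sub>2 p\<^sub>1 p\<^sub>2
  assume \<tau>: "\<tau>\<^sub>1 \<in> loops M" "\<tau>\<^sub>2 \<in> loops M"
    and I: "circle_interval I\<^sub>1 \<and> circle_interval I\<^sub>2 \<and> I\<^sub>1 \<inter> I\<^sub>2 = {} \<and>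
      supported_on G \<tau>\<^sub>1 I\<^sub>1 \<and> supported_on G \<tau>\<^sub>2 I\<^sub>2"
    and p: "p\<^sub>1 \<in> fibre E \<tau>\<^sub>1" "p\<^sub>2 \<in> fibre E \<tau>\<^sub>2"
  have L: "p\<^sub>1 \<in> carrier (ext_group E)" "p\<^sub>2 \<in> carrier (ext_group E)" using p by (simp_all add: fibre_closed)
  have ext: "\<tau>\<^sub>1 \<in> circle \<rightarrow>\<^sub>E carrier G" "\<tau>\<^sub>2 \<in> circle \<rightarrow>\<^sub>E carrier G" using \<tau> loop_closed by auto
  have trivial: "\<tau> = unit_loop" if "\<tau> \<in> circle \<rightarrow>\<^sub>E carrier G" "supported_on G \<tau> {}" for \<tau>
    using that by (auto simp: supported_on_def fun_eq_iff PiE_iff extensional_def)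
  \<comment> \<open>A loop with empty support is trivial, so its fibre is the central U(1).\<close>
  consider "I\<^sub>1 = {}" | "I\<^sub>2 = {}" | "I\<^sub>1 \<noteq> {}" "I\<^sub>2 \<noteq> {}" by blast
  then show "p\<^sub>1 \<cdot> p\<^sub>2 = p\<^sub>2 \<cdot> p\<^sub>1"
  proof cases
    case 1
    then have "p\<^sub>1 \<in> fibre E unit_loop" using trivial[OF ext(1)] I p(1) by simp
    then show ?thesis using L by (intro unit_fibre_central)
  next
    case 2
    then have "p\<^sub>2 \<in> fibre E unit_loop" using trivial[OF ext(2)] I p(2) by simp
    then show ?thesis using L by (intro unit_fibre_central[symmetric])
  next
    case 3
    obtain a b where ab: "a \<le> b" "b \<le> a + 2 * pi"
      and one1: "\<And>\<theta>. \<theta> \<in> {b..a + 2 * pi} \<Longrightarrow> \<tau>\<^sub>1 (cis \<theta>) = \<one>\<^bsub>G\<^esub>"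
      and one2: "\<And>\<theta>. \<theta> \<in> {a..b} \<Longrightarrow> \<tau>\<^sub>2 (cis \<theta>) = \<one>\<^bsub>G\<^esub>"
      using disjoint_supports_split_circle[OF mfd(1) coords \<tau> _ _ _ 3, of G] I by metis
    obtain f :: "real \<Rightarrow> real" where f: "\<And>k. Ck euclideanreal UNIV k f"
      and deg: "degree_one f"
      and f_upper: "\<And>\<theta>. 0 \<le> \<theta> \<Longrightarrow> \<theta> \<le> pi \<Longrightarrow> f \<theta> \<in> {a..b}"
      and f_lower: "\<And>\<theta>. pi \<le> \<theta> \<Longrightarrow> \<theta> \<le> 2 * pi \<Longrightarrow> f \<theta> \<in> {b..a + 2 * pi}"
      and f_flat: "\<And>\<theta>. 0 \<le> \<theta> \<Longrightarrow> \<theta> \<le> pi / 6 \<Longrightarrow> f \<theta> = a"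
        "\<And>\<theta>. 5 * pi / 6 \<le> \<theta> \<Longrightarrow> \<theta> \<le> 7 * pi / 6 \<Longrightarrow> f \<theta> = b"
        "\<And>\<theta>. 11 * pi / 6 \<le> \<theta> \<Longrightarrow> \<theta> \<le> 2 * pi \<Longrightarrow> f \<theta> = a + 2 * pi"
      by (rule circle_reparametrization[OF ab], rule that)
    define \<gamma>\<^sub>1 where "\<gamma>\<^sub>1 = (\<lambda>s\<in>{0..1}. \<tau>\<^sub>1 (cis (f (0 + pi * s))))"
    \<comment> \<open>The lower half of a union of paths is traversed backwards.\<close>
    define \<gamma>\<^sub>2 where "\<gamma>\<^sub>2 = (\<lambda>s\<in>{0..1}. \<tau>\<^sub>2 (cis (f (2 * pi + - pi * s))))"
    have Ck: "Ck euclideanreal UNIV k (\<lambda>s. f (c + e * s))" for k c e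
    proof (rule real_coords.Ck_compose_real[where A = UNIV, OF _ _ f])
      show "Ck euclideanreal UNIV k (\<lambda>s. c + e * s)"
        unfolding real_scaleR_def[symmetric]
        by (intro real_coords.Ck_add real_coords.Ck_scaleR real_coords.Ck_const Ck_id) auto
    qed auto
    \<comment> \<open>The constant path is smooth as a segment of \<open>\<tau>\<^sub>1\<close> with constant parameter.\<close>
    have "triv = (\<lambda>s\<in>{0..1}. \<tau>\<^sub>1 (cis b))" using one1[of b] ab by (simp add: const_path_def)
    also have "\<dots> \<in> paths M"
      by (intro loop_segment_path[OF coords \<tau>(1)] real_coords.Ck_const) auto
    finally have "triv \<in> paths M" .
    moreover have "triv 0 = \<one>\<^bsub>G\<^esub>" "triv 1 = \<one>\<^bsub>G\<^esub>" by (simp_all add: const_path_def)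
    moreover have "\<gamma>\<^sub>1 \<in> paths M"
      unfolding \<gamma>\<^sub>1_def
    proof (rule loop_segment_path[OF coords \<tau>(1) Ck])
      show "f (0 + pi * t) = f (0 + pi * 0)" if "0 \<le> t" "t < 1 / 6" for t
        using f_flat(1)[of "pi * t"] f_flat(1)[of 0] that by (simp add: field_simps)
      show "f (0 + pi * t) = f (0 + pi * 1)" if "5 / 6 < t" "t \<le> 1" for t
        using f_flat(2)[of "pi * t"] f_flat(2)[of pi] that by (simp add: field_simps)
    qed
    moreover have "\<gamma>\<^sub>2 \<in> paths M"
      unfolding \<gamma>\<^sub>2_def
    proof (rule loop_segment_path[OF coords \<tau>(2) Ck])
      show "f (2 * pi + - pi * t) = f (2 * pi + - pi * 0)" if "0 \<le> t" "t < 1 / 6" for t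
        using f_flat(3)[of "2 * pi + - pi * t"] f_flat(3)[of "2 * pi"] that by (simp add: field_simps)
      show "f (2 * pi + - pi * t) = f (2 * pi + - pi * 1)" if "5 / 6 < t" "t \<le> 1" for t
        using f_flat(2)[of "2 * pi + - pi * t"] f_flat(2)[of pi] that by (simp add: field_simps)
    qed
    moreover have "\<gamma>\<^sub>1 0 = \<one>\<^bsub>G\<^esub>" "\<gamma>\<^sub>1 1 = \<one>\<^bsub>G\<^esub>" "\<gamma>\<^sub>2 0 = \<one>\<^bsub>G\<^esub>" "\<gamma>\<^sub>2 1 = \<one>\<^bsub>G\<^esub>"
    proof -
      have "cis (a + 2 * pi) = cis a" using cis_eq_iff[of "a + 2 * pi" a] by (auto intro: exI[of _ 1])
      then have "\<tau>\<^sub>1 (cis a) = \<one>\<^bsub>G\<^esub>" "\<tau>\<^sub>2 (cis (a + 2 * pi)) = \<one>\<^bsub>G\<^esub>"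
        using one1[of "a + 2 * pi"] one2[of a] ab by simp_all
      then show "\<gamma>\<^sub>1 0 = \<one>\<^bsub>G\<^esub>" "\<gamma>\<^sub>1 1 = \<one>\<^bsub>G\<^esub>" "\<gamma>\<^sub>2 0 = \<one>\<^bsub>G\<^esub>" "\<gamma>\<^sub>2 1 = \<one>\<^bsub>G\<^esub>"
        using f_flat(1)[of 0] f_flat(2)[of pi] f_flat(3)[of "2 * pi"] one1[of b] one2[of b] ab
        by (simp_all add: \<gamma>\<^sub>1_def \<gamma>\<^sub>2_def)
    qed
    ultimately have co: "coterminal M {\<gamma>\<^sub>1, triv, \<gamma>\<^sub>2}"
      by (simp add: coterminal_def)
    have ext': "reparam \<tau> f \<in> extensional circle" for \<tau> :: "complex \<Rightarrow> 'g" by (simp add: reparam_def)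
    have cup1: "\<gamma>\<^sub>1 \<squnion>\<^sub>p triv = reparam \<tau>\<^sub>1 f"
    proof (rule path_cup_eqI[OF ext'])
      fix s :: real assume s: "0 \<le> s" "s \<le> 1"
      show "\<gamma>\<^sub>1 s = reparam \<tau>\<^sub>1 f (cis (pi * s))"
        using s by (simp add: reparam_cis[OF deg] \<gamma>\<^sub>1_def)
      have "f (2 * pi - pi * s) \<in> {b..a + 2 * pi}" using s by (intro f_lower) (auto simp: field_simps)
      then show "triv s = reparam \<tau>\<^sub>1 f (cis (2 * pi - pi * s))"
        using s by (simp add: reparam_cis[OF deg] const_path_def one1)
    qed
    have cup2: "triv \<squnion>\<^sub>p \<gamma>\<^sub>2 = reparam \<tau>\<^sub>2 f"
    proof (rule path_cup_eqI[OF ext'])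
      fix s :: real assume s: "0 \<le> s" "s \<le> 1"
      show "\<gamma>\<^sub>2 s = reparam \<tau>\<^sub>2 f (cis (2 * pi - pi * s))"
        using s by (simp add: reparam_cis[OF deg] \<gamma>\<^sub>2_def)
      have "f (pi * s) \<in> {a..b}" using s by (intro f_upper) (auto simp: field_simps)
      then show "triv s = reparam \<tau>\<^sub>2 f (cis (pi * s))"
        using s by (simp add: reparam_cis[OF deg] const_path_def one2)
    qed
    have thin: "(\<tau>, reparam \<tau> f) \<in> thin_pairs M" if "\<tau> \<in> loops M" for \<tau>
      using that
      by (intro thin_pair_reparam[OF coords that _ f deg] chartwise_differentiable_smooth[OF mfd(1) coords])
        (simp add: loops_def)
    let ?d = "\<lambda>\<tau>. d \<tau> (reparam \<tau> f)"
    have d_mult: "?d (\<tau> \<otimes>\<^bsub>loop_group G M\<^esub> \<sigma>) (p \<cdot> q) = ?d \<tau> p \<cdot> ?d \<sigma> q"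
      if "p \<in> fibre E \<tau>" "q \<in> fibre E \<sigma>" for \<tau> \<sigma> p q
    proof -
      have loops: "\<tau> \<in> loops M" "\<sigma> \<in> loops M" using that by (simp_all add: fibre_loop)
      have "reparam (\<tau> \<otimes>\<^bsub>loop_group G M\<^esub> \<sigma>) f = reparam \<tau> f \<otimes>\<^bsub>loop_group G M\<^esub> reparam \<sigma> f"
        by (auto simp: mult_loop reparam_def)
      then show ?thesis
        using assms(6) that loops thin_pair_reparam_pair[OF mfd(1) coords loops f deg]
          reparam_in_loops[OF coords loops(1) f deg] reparam_in_loops[OF coords loops(2) f deg]
        unfolding multiplicative_thin_def by simp
    qed
    have "\<tau>\<^sub>1 z \<otimes>\<^bsub>G\<^esub> \<tau>\<^sub>2 z = \<tau>\<^sub>2 z \<otimes>\<^bsub>G\<^esub> \<tau>\<^sub>1 z" if z: "z \<in> circle" for z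
    proof -
      have "\<tau>\<^sub>1 z = \<one>\<^bsub>G\<^esub> \<or> \<tau>\<^sub>2 z = \<one>\<^bsub>G\<^esub>" using I z unfolding supported_on_def by blast
      moreover have "\<tau>\<^sub>1 z \<in> carrier G" "\<tau>\<^sub>2 z \<in> carrier G" using ext z by auto
      ultimately show ?thesis by auto
    qed
    then have comm: "\<tau>\<^sub>2 \<otimes>\<^bsub>loop_group G M\<^esub> \<tau>\<^sub>1 = \<tau>\<^sub>1 \<otimes>\<^bsub>loop_group G M\<^esub> \<tau>\<^sub>2"
      by (auto simp: mult_loop)
    let ?\<tau> = "\<tau>\<^sub>1 \<otimes>\<^bsub>loop_group G M\<^esub> \<tau>\<^sub>2"
    have fib: "p\<^sub>1 \<cdot> p\<^sub>2 \<in> fibre E ?\<tau>" "p\<^sub>2 \<cdot> p\<^sub>1 \<in> fibre E ?\<tau>"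
      using fibre_mult[OF p] fibre_mult[OF p(2,1)] comm by simp_all
    have "?d \<tau>\<^sub>1 p\<^sub>1 \<cdot> ?d \<tau>\<^sub>2 p\<^sub>2 = ?d \<tau>\<^sub>2 p\<^sub>2 \<cdot> ?d \<tau>\<^sub>1 p\<^sub>1"
      using thin_transport_fibre(1)[OF assms(5) thin[OF \<tau>(1)] p(1)]
        thin_transport_fibre(1)[OF assms(5) thin[OF \<tau>(2)] p(2)]
      by (intro half_loops_commute[OF co]) (simp_all add: cup1 cup2)
    then have "?d ?\<tau> (p\<^sub>1 \<cdot> p\<^sub>2) = ?d ?\<tau> (p\<^sub>2 \<cdot> p\<^sub>1)"
      using d_mult[OF p] d_mult[OF p(2,1)] by (simp add: comm)
    then show ?thesis
      using inj_onD[OF thin_transport_fibre(2)[OF assms(5) thin[OF fibre_loop[OF fib(1)]]] _ fib] by blast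
  qed
qed

end
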